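(* Let $G$ be a finitely generated nilpotent group and $H<G$ a subgroup. The relative growth of $H$ in $G$ is given by $$\mathrm{gr}_G(H)=\sum_j j\,d_j^{H;G}=:D_{H;G},$$ and the growth of the associated Schreier graph is given by $$\mathrm{gr}(G/H)=\sum_j j\,(d_j^G-d_j^{H;G})=D_G-D_{H;G},\qquad D_G:=\sum_j j\,d_j^G.$$ Moreover, both these growth functions are equivalent to polynomials, in the sense that $$\#\big(B_n^G(e)\cap H\big)\asymp n^{D_{H;G}}\qquad\text{and}\qquad \#B_n^{G/H}(e)\asymp n^{D_G-D_{H;G}}.$$
   Context: Lower central series: $G_1:=G$, $G_{j+1}:=[G,G_j]$; $G$ nilpotent means $G_{m+1}=\{e\}$ for some $m$. Each quotient $G_j/G_{j+1}$ is a finitely generated abelian group, $G_j/G_{j+1}\simeq\mathbb{Z}^{d_j^G}\oplus T_j$ with $T_j$ finite; $d_j^G$ is its rank. Let $\varphi_j:G_j\to G_j/G_{j+1}$ be the quotient map and $H_j:=H\cap G_j$; $d_j^{H;G}$ denotes the rank of the abelian group $\varphi_j(H_j)$. Fix a finite generating set $\mathcal{F}$ of $G$. $B_n^G(e)$ is the ball of radius $n$ around $e$ in the word metric of $G$ (Cayley graph, $g$ joined to $fg$ for $f\in\mathcal{F}$). The set $G/H$ of left cosets carries the distance of the Schreier graph, in which $gH$ is joined by an edge to $fgH$ for all $f\in\mathcal{F}$, and $B_n^{G/H}(e)$ is the ball of radius $n$ around the class of $e$. Define $$\mathrm{gr}_G(H):=\lim_{n\to\infty}\frac{\log\#(B_n^G(e)\cap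 H)}{\log n},\qquad \mathrm{gr}(G/H):=\lim_{n\to\infty}\frac{\log\#B_n^{G/H}(e)}{\log n}$$ (the existence of these limits is part of the claim). For sequences of positive numbers, $a_n\asymp b_n$ means that there is a constant $C$ with $\frac1C\le\frac{a_n}{b_n}\le C$ for all sufficiently large $n$. *)

theory Defs
  imports Complex_Main "HOL-Library.Extended_Nat" "HOL-Algebra.Algebra"
begin

definition commutator_subgroup :: "('a, 'b) monoid_scheme \<Rightarrow> 'a set \<Rightarrow> 'a set \<Rightarrow> 'a set" where
  "commutator_subgroup G A B =
     generate G {a \<otimes>\<^bsub>G\<^esub> b \<otimes>\<^bsub>G\<^esub> inv\<^bsub>G\<^esub> a \<otimes>\<^bsub>G\<^esub> inv\<^bsub>G\<^esub> b | a b. a \<in> A \<and> b \<in> B}"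

text \<open>The series is indexed from 1; the value at 0 is a dummy, and always carries weight 0 below.\<close>

fun lower_central :: "('a, 'b) monoid_scheme \<Rightarrow> nat \<Rightarrow> 'a set" where
  "lower_central G 0 = carrier G"
| "lower_central G (Suc 0) = carrier G"
| "lower_central G (Suc (Suc j)) = commutator_subgroup G (carrier G) (lower_central G (Suc j))"

definition nilpotent_group :: "('a, 'b) monoid_scheme \<Rightarrow> bool" where
  "nilpotent_group G \<longleftrightarrow> group G \<and> (\<exists>m. lower_central G (m + 1) = {\<one>\<^bsub>G\<^esub>})"

text \<open>The rank of a finitely generated abelian group: the number \<open>d\<close> in a decomposition
  of \<open>A\<close> as the product of \<open>d\<close> copies of the integers and a finite group. The finite factor is
  isomorphic to the torsion subgroup of \<open>A\<close>, so that it may be sought over the element type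
  of \<open>A\<close>.\<close>

definition abelian_rank :: "('a, 'b) monoid_scheme \<Rightarrow> nat" where
  "abelian_rank A =
     (THE d. \<exists>T :: 'a monoid. group T \<and> finite (carrier T) \<and>
        A \<cong> product_group {..<d} (\<lambda>_. integer_group) \<times>\<times> T)"

definition lower_central_quotient :: "('a, 'b) monoid_scheme \<Rightarrow> nat \<Rightarrow> 'a set monoid" where
  "lower_central_quotient G j = (G\<lparr>carrier := lower_central G j\<rparr>) Mod (lower_central G (j + 1))"

definition lower_central_proj :: "('a, 'b) monoid_scheme \<Rightarrow> nat \<Rightarrow> 'a \<Rightarrow> 'a set" where
  "lower_central_proj G j x = lower_central G (j + 1) #>\<^bsub>G\<^esub> x"

definition lc_rank :: "('a, 'b) monoid_scheme \<Rightarrow> nat \<Rightarrow> nat" where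
  "lc_rank G j = abelian_rank (lower_central_quotient G j)"

definition lc_rel_rank :: "('a, 'b) monoid_scheme \<Rightarrow> 'a set \<Rightarrow> nat \<Rightarrow> nat" where
  "lc_rel_rank G H j =
     abelian_rank ((lower_central_quotient G j)
       \<lparr>carrier := lower_central_proj G j ` (H \<inter> lower_central G j)\<rparr>)"

text \<open>For a nilpotent group only finitely many terms of the following series are nonzero.\<close>

definition hom_dim :: "('a, 'b) monoid_scheme \<Rightarrow> nat" where
  "hom_dim G = suminf (\<lambda>j. j * lc_rank G j)"

definition rel_hom_dim :: "('a, 'b) monoid_scheme \<Rightarrow> 'a set \<Rightarrow> nat" where
  "rel_hom_dim G H = suminf (\<lambda>j. j * lc_rel_rank G H j)"

text \<open>Path distance in the undirected graph whose edges are the pairs in \<open>E\<close>, regardless of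
  orientation; it is \<open>\<infinity>\<close> if there is no path.\<close>

definition graph_dist :: "('v \<times> 'v) set \<Rightarrow> 'v \<Rightarrow> 'v \<Rightarrow> enat" where
  "graph_dist E x y = Inf {enat k | k. (x, y) \<in> (E \<union> E\<inverse>) ^^ k}"

definition graph_ball :: "('v \<times> 'v) set \<Rightarrow> 'v \<Rightarrow> nat \<Rightarrow> 'v set" where
  "graph_ball E x n = {y. graph_dist E x y \<le> enat n}"

definition cayley_edges :: "('a, 'b) monoid_scheme \<Rightarrow> 'a set \<Rightarrow> ('a \<times> 'a) set" where
  "cayley_edges G F = {(g, f \<otimes>\<^bsub>G\<^esub> g) | f g. f \<in> F \<and> g \<in> carrier G}"

definition schreier_edges ::
    "('a, 'b) monoid_scheme \<Rightarrow> 'a set \<Rightarrow> 'a set \<Rightarrow> ('a set \<times> 'a set) set" where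
  "schreier_edges G F H =
     {(g <#\<^bsub>G\<^esub> H, (f \<otimes>\<^bsub>G\<^esub> g) <#\<^bsub>G\<^esub> H) | f g. f \<in> F \<and> g \<in> carrier G}"

definition word_ball :: "('a, 'b) monoid_scheme \<Rightarrow> 'a set \<Rightarrow> nat \<Rightarrow> 'a set" where
  "word_ball G F n = graph_ball (cayley_edges G F) \<one>\<^bsub>G\<^esub> n"

definition schreier_ball :: "('a, 'b) monoid_scheme \<Rightarrow> 'a set \<Rightarrow> 'a set \<Rightarrow> nat \<Rightarrow> 'a set set" where
  "schreier_ball G F H n = graph_ball (schreier_edges G F H) (\<one>\<^bsub>G\<^esub> <#\<^bsub>G\<^esub> H) n"

definition rel_growth_fun :: "('a, 'b) monoid_scheme \<Rightarrow> 'a set \<Rightarrow> 'a set \<Rightarrow> nat \<Rightarrow> real" where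
  "rel_growth_fun G F H n = real (card (word_ball G F n \<inter> H))"

definition schreier_growth_fun :: "('a, 'b) monoid_scheme \<Rightarrow> 'a set \<Rightarrow> 'a set \<Rightarrow> nat \<Rightarrow> real" where
  "schreier_growth_fun G F H n = real (card (schreier_ball G F H n))"

definition log_ratio :: "(nat \<Rightarrow> real) \<Rightarrow> nat \<Rightarrow> real" where
  "log_ratio a n = ln (a n) / ln (real n)"

definition rel_growth :: "('a, 'b) monoid_scheme \<Rightarrow> 'a set \<Rightarrow> 'a set \<Rightarrow> real" where
  "rel_growth G F H = lim (log_ratio (rel_growth_fun G F H))"

definition schreier_growth :: "('a, 'b) monoid_scheme \<Rightarrow> 'a set \<Rightarrow> 'a set \<Rightarrow> real" where
  "schreier_growth G F H = lim (log_ratio (schreier_growth_fun G F H))"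

definition growth_equiv :: "(nat \<Rightarrow> real) \<Rightarrow> (nat \<Rightarrow> real) \<Rightarrow> bool" where
  "growth_equiv a b \<longleftrightarrow>
     (\<exists>C>0. \<forall>\<^sub>F n in sequentially. 1 / C \<le> a n / b n \<and> a n / b n \<le> C)"

end

theory Submission
  imports Defs
begin

text \<open>
  Write \<open>G\<^sub>j\<close> for the lower central series, and call an iterated commutator of \<open>k\<close> generators (or
  inverses) a letter of weight \<open>k\<close>; a letter of weight \<open>k\<close> lies in \<open>G\<^sub>k\<close>.  Interchanging a letter of
  weight \<open>a\<close> with one of weight \<open>b\<close> costs one letter of weight \<open>a + b\<close>.  In a word that contains
  \<open>O(n\<^sup>k)\<close> letters of weight \<open>k\<close>, for every \<open>k\<close>, at most \<open>O(n\<^sup>a n\<^sup>b)\<close> such interchanges occur, so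
  that collection does not leave this class of words (\<open>commutator_Wball\<close>, \<open>word_rearrange\<close>).  This
  single fact carries the whole proof, in two directions.

  An element \<open>g \<in> G\<^sub>j\<close> of word length \<open>n\<close> is a product of \<open>O(n\<^sup>k)\<close> letters of weight \<open>k\<close> with only
  \<open>k \<ge> j\<close> occurring (\<open>Wball_inter_lcs\<close>): if \<open>g \<in> G\<^bsub>j+1\<^esub>\<close> is written with letters of weight at
  least \<open>j\<close>, then its letters of weight \<open>j\<close> form a relation of the abelian group \<open>G\<^sub>j/G\<^bsub>j+1\<^esub>\<close>.  By
  Dickson's lemma this relation is a sum of \<open>O(n\<^sup>j)\<close> relations taken from a finite list, and each
  of them can be replaced by a fixed word in letters of higher weight (\<open>Wball_descend\<close>).  Hence the
  elements of \<open>G\<^sub>j\<close> in the ball of radius \<open>n\<close> have coordinates of size \<open>O(n\<^sup>j)\<close> in \<open>G\<^sub>j/G\<^bsub>j+1\<^esub>\<close>.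

  Conversely, a product of \<open>O(n\<^sup>k)\<close> letters of weight \<open>k\<close> has word length \<open>O(n)\<close>
  (\<open>Wball_subset_ball\<close>).  Modulo \<open>G\<^bsub>j+1\<^esub>\<close> commutators are bilinear, so that \<open>[x,y]\<^sup>a\<close> with
  \<open>a \<le> n\<^sup>j\<close> is a product of two commutators of short powers of \<open>x\<close> and \<open>y\<close>; the error lies in
  \<open>G\<^bsub>j+1\<^esub>\<close> and is again such a product, by the first direction.  In particular \<open>h\<^sup>a\<close> has length
  \<open>O(n)\<close> for each \<open>h \<in> G\<^sub>j\<close> and \<open>a \<le> n\<^sup>j\<close>.

  For a subgroup \<open>H\<close> let \<open>d\<^sub>j\<close> be the rank of the image of \<open>H \<inter> G\<^sub>j\<close> in \<open>G\<^sub>j/G\<^bsub>j+1\<^esub>\<close>.  The two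
  directions show that the elements of \<open>H \<inter> G\<^sub>j\<close> of length \<open>O(n)\<close> have about as many images in this
  group as \<open>n\<close> to the power \<open>j d\<^sub>j\<close>, and multiplying over \<open>j\<close> gives the growth of \<open>H\<close> in \<open>G\<close>
  (\<open>card_ball_subgroup\<close>).  Taking \<open>H = G\<close> gives the growth of \<open>G\<close> itself.  In the
  Schreier graph the ball of radius \<open>n\<close> is the image of the ball of \<open>G\<close>, and the fibres of this
  map are compared with \<open>H\<close> intersected with balls (\<open>card_gen_ball_le\<close>, \<open>card_gen_ball_ge\<close>).

  The ranks in the statement are handled through integer coordinates: \<open>d\<close> additive functions and
  \<open>d\<close> elements dual to them, such that the common kernel of the functions is finite.
\<close>

section \<open>Integer coordinates on finitely generated abelian groups\<close>

definition additive_on :: "('a, 'b) monoid_scheme \<Rightarrow> 'a set \<Rightarrow> ('a \<Rightarrow> int) \<Rightarrow> bool" where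
  "additive_on A B \<chi> \<longleftrightarrow> (\<forall>x\<in>B. \<forall>y\<in>B. \<chi> (x \<otimes>\<^bsub>A\<^esub> y) = \<chi> x + \<chi> y)"

text \<open>
  A splitting of \<open>B\<close> as the product of a free abelian group with basis \<open>e\<close> and of the common
  kernel of the coordinate functions \<open>\<chi>\<close> (the null part below). If the null part is finite, then
  \<open>d\<close> is the rank of \<open>B\<close>. Functions with values in the integers are used instead of an isomorphism
  because sizes of elements are measured with them later.
\<close>
definition dual_system ::
    "('a, 'b) monoid_scheme \<Rightarrow> 'a set \<Rightarrow> nat \<Rightarrow> (nat \<Rightarrow> 'a \<Rightarrow> int) \<Rightarrow> (nat \<Rightarrow> 'a) \<Rightarrow> bool" where
  "dual_system A B d \<chi> e \<longleftrightarrow>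
     (\<forall>i<d. additive_on A B (\<chi> i)) \<and> (\<forall>i<d. e i \<in> B) \<and>
     (\<forall>i<d. \<forall>k<d. \<chi> i (e k) = (if i = k then 1 else 0))"

definition null_part :: "'a set \<Rightarrow> nat \<Rightarrow> (nat \<Rightarrow> 'a \<Rightarrow> int) \<Rightarrow> 'a set" where
  "null_part B d \<chi> = {x \<in> B. \<forall>i<d. \<chi> i x = 0}"

lemma additive_onD:
  "additive_on A B \<chi> \<Longrightarrow> x \<in> B \<Longrightarrow> y \<in> B \<Longrightarrow> \<chi> (x \<otimes>\<^bsub>A\<^esub> y) = \<chi> x + \<chi> y"
  by (simp add: additive_on_def)

text \<open>
  More integer vectors than coordinates are linearly dependent; this is what bounds the number of
  coordinate functions. The proof is Gaussian elimination of one coordinate \<open>y\<close>.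
\<close>
lemma integer_dependence:
  fixes f :: "'i \<Rightarrow> 'x \<Rightarrow> int"
  assumes "finite S" "finite I" "card I > card S"
  shows "\<exists>c. (\<exists>i\<in>I. c i \<noteq> 0) \<and> (\<forall>x\<in>S. (\<Sum>i\<in>I. c i * f i x) = 0)"
  using assms
proof (induction S arbitrary: I f rule: finite_induct)
  case empty
  then obtain i where "i \<in> I" by fastforce
  then show ?case by (intro exI[of _ "\<lambda>_. 1"]) auto
next
  case (insert y S)
  show ?case
  proof (cases "\<forall>i\<in>I. f i y = 0")
    case True
    obtain c where "\<exists>i\<in>I. c i \<noteq> 0" "\<forall>x\<in>S. (\<Sum>i\<in>I. c i * f i x) = 0"
      using insert.IH[of I f] insert.prems insert.hyps by auto
    then show ?thesis using True by (intro exI[of _ c]) auto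
  next
    case False
    then obtain p where p: "p \<in> I" "f p y \<noteq> 0" by blast
    define I' where "I' = I - {p}"
    define f' where "f' = (\<lambda>i x. f p y * f i x - f i y * f p x)"
    have "card I' > card S"
      using insert.prems insert.hyps p by (simp add: I'_def)
    then obtain c where c: "\<exists>i\<in>I'. c i \<noteq> 0" "\<forall>x\<in>S. (\<Sum>i\<in>I'. c i * f' i x) = 0"
      using insert.IH[of I' f'] insert.prems by (auto simp: I'_def)
    define c' where "c' = (\<lambda>i. if i = p then - (\<Sum>i\<in>I'. c i * f i y) else c i * f p y)"
    have sum: "(\<Sum>i\<in>I. c' i * f i x) = (\<Sum>i\<in>I'. c i * f' i x)" for x
    proof -
      have "(\<Sum>i\<in>I. c' i * f i x) = c' p * f p x + (\<Sum>i\<in>I'. c' i * f i x)"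
        unfolding I'_def using insert.prems(1) p(1) by (rule sum.remove)
      also have "(\<Sum>i\<in>I'. c' i * f i x) = (\<Sum>i\<in>I'. c i * f p y * f i x)"
        by (rule sum.cong) (auto simp: c'_def I'_def)
      also have "c' p * f p x = - (\<Sum>i\<in>I'. c i * f i y * f p x)"
        by (simp add: c'_def sum_distrib_right)
      finally show ?thesis
        by (simp add: f'_def algebra_simps sum_subtractf)
    qed
    have "(\<Sum>i\<in>I'. c i * f' i y) = 0" by (simp add: f'_def)
    moreover have "\<exists>i\<in>I. c' i \<noteq> 0"
      using c(1) p by (auto simp: c'_def I'_def)
    ultimately show ?thesis using c(2) sum by (intro exI[of _ c']) auto
  qed
qed

definition lattice_part ::
    "('a, 'b) monoid_scheme \<Rightarrow> nat \<Rightarrow> (nat \<Rightarrow> 'a \<Rightarrow> int) \<Rightarrow> (nat \<Rightarrow> 'a) \<Rightarrow> 'a \<Rightarrow> 'a" where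
  "lattice_part A d \<chi> e x = finprod A (\<lambda>k. e k [^]\<^bsub>A\<^esub> \<chi> k x) {..<d}"

context comm_group begin

lemma additive_one: "additive_on G B \<chi> \<Longrightarrow> subgroup B G \<Longrightarrow> \<chi> \<one> = 0"
proof -
  assume "additive_on G B \<chi>" "subgroup B G"
  then have "\<chi> (\<one> \<otimes> \<one>) = \<chi> \<one> + \<chi> \<one>"
    using subgroup.one_closed unfolding additive_on_def by blast
  then show "\<chi> \<one> = 0" by simp
qed

lemma additive_inv:
  assumes "additive_on G B \<chi>" "subgroup B G" "x \<in> B"
  shows "\<chi> (inv x) = - \<chi> x"
proof -
  have "\<chi> (x \<otimes> inv x) = \<chi> x + \<chi> (inv x)"
    using additive_onD[OF assms(1,3)] subgroup.m_inv_closed[OF assms(2,3)] by blast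
  moreover have "x \<otimes> inv x = \<one>" using subgroup.mem_carrier[OF assms(2,3)] by simp
  ultimately show ?thesis using additive_one[OF assms(1,2)] by simp
qed

lemma additive_nat_pow:
  assumes "additive_on G B \<chi>" "subgroup B G" "x \<in> B"
  shows "x [^] (n::nat) \<in> B \<and> \<chi> (x [^] n) = int n * \<chi> x"
proof (induction n)
  case 0
  then show ?case using additive_one[OF assms(1,2)] subgroup.one_closed[OF assms(2)] by simp
next
  case (Suc n)
  then show ?case
    using subgroup.m_closed[OF assms(2) _ assms(3)] additive_onD[OF assms(1) _ assms(3)]
    by (simp add: algebra_simps)
qed

lemma additive_int_pow:
  assumes "additive_on G B \<chi>" "subgroup B G" "x \<in> B"
  shows "\<chi> (x [^] (n::int)) = n * \<chi> x"
proof (cases "n < 0")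
  case True
  then have "x [^] n = inv (x [^] nat (- n))" by (simp only: int_pow_def2 if_True)
  then have "\<chi> (x [^] n) = - (int (nat (- n)) * \<chi> x)"
    using additive_nat_pow[OF assms, of "nat (- n)"] additive_inv[OF assms(1,2)] by metis
  then show ?thesis using True by simp
next
  case False
  then have "x [^] n = x [^] nat n" by (simp only: int_pow_def2 if_False)
  then show ?thesis using additive_nat_pow[OF assms, of "nat n"] False by simp
qed

lemma additive_finprod:
  assumes "additive_on G B \<chi>" "subgroup B G" "finite I" "\<And>i. i \<in> I \<Longrightarrow> f i \<in> B"
  shows "finprod G f I \<in> B \<and> \<chi> (finprod G f I) = (\<Sum>i\<in>I. \<chi> (f i))"
  using assms(3,4)
proof (induction I rule: finite_induct)
  case empty
  then show ?case using additive_one[OF assms(1,2)] subgroup.one_closed[OF assms(2)] by simp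
next
  case (insert a I)
  have "f \<in> I \<rightarrow> carrier G" "f a \<in> carrier G"
    using insert subgroup.subset[OF assms(2)] by auto
  then show ?case
    using insert additive_onD[OF assms(1)] subgroup.m_closed[OF assms(2)] by simp
qed

lemma subgroup_finprod:
  assumes "subgroup B G" "\<And>i. i \<in> I \<Longrightarrow> f i \<in> B"
  shows "finprod G f I \<in> B"
proof (cases "finite I")
  case True
  have "additive_on G B (\<lambda>_. 0)" by (simp add: additive_on_def)
  then show ?thesis using additive_finprod[OF _ assms(1) True] assms(2) by blast
qed (use subgroup.one_closed[OF assms(1)] in \<open>simp add: finprod_def\<close>)

lemma additive_combination:
  assumes "\<And>i. i \<in> I \<Longrightarrow> additive_on G B (\<chi> i)"
  shows "additive_on G B (\<lambda>x. \<Sum>i\<in>I. c i * \<chi> i x)"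
  unfolding additive_on_def
proof (intro ballI)
  fix x y assume "x \<in> B" "y \<in> B"
  then have "(\<Sum>i\<in>I. c i * \<chi> i (x \<otimes> y)) = (\<Sum>i\<in>I. c i * \<chi> i x + c i * \<chi> i y)"
    using assms by (intro sum.cong) (auto simp: additive_on_def algebra_simps)
  then show "(\<Sum>i\<in>I. c i * \<chi> i (x \<otimes> y)) = (\<Sum>i\<in>I. c i * \<chi> i x) + (\<Sum>i\<in>I. c i * \<chi> i y)"
    by (simp add: sum.distrib)
qed

lemma additive_zero_generate:
  assumes "additive_on G (carrier G) \<chi>" "S \<subseteq> carrier G" "\<And>x. x \<in> S \<Longrightarrow> \<chi> x = 0" "y \<in> generate G S"
  shows "\<chi> y = 0"
  using assms(4)
proof induction
  case one
  then show ?case using additive_one[OF assms(1)] subgroup_self by auto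
next
  case (inv h)
  then show ?case using additive_inv[OF assms(1) subgroup_self, of h] assms(2,3) by auto
next
  case (eng h1 h2)
  then show ?case using assms(1) generate_in_carrier[OF assms(2)]
    by (auto simp: additive_on_def)
qed (use assms in auto)

text \<open>
  One step of extending an additive function: to the subgroup generated by \<open>B\<close> and \<open>y\<close>. The
  condition says that prescribing the value \<open>t\<close> at \<open>y\<close> is consistent on the powers of \<open>y\<close> that
  already lie in \<open>B\<close>. As the integers are not divisible, \<open>\<chi>\<close> has to be replaced by a multiple.
\<close>
lemma additive_extend_one:
  assumes B: "subgroup B G" and add: "additive_on G B \<chi>" and y: "y \<in> carrier G"
    and nt: "\<And>c::int. y [^] c \<in> B \<Longrightarrow> n * \<chi> (y [^] c) = c * t"
  shows "\<exists>B' \<chi>'. subgroup B' G \<and> B \<subseteq> B' \<and> y \<in> B' \<and> additive_on G B' \<chi>' \<and>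
    (\<forall>x\<in>B. \<chi>' x = n * \<chi> x) \<and> \<chi>' y = t"
proof -
  have Bc: "b \<in> carrier G" if "b \<in> B" for b using subgroup.mem_carrier[OF B that] .
  define B' where "B' = {b \<otimes> y [^] (a::int) | b a. b \<in> B}"
  define \<chi>' where "\<chi>' = (\<lambda>z. SOME v. \<exists>b a. b \<in> B \<and> z = b \<otimes> y [^] (a::int) \<and> v = n * \<chi> b + a * t)"
  \<comment> \<open>the value is independent of the chosen representation\<close>
  have val: "\<chi>' (b \<otimes> y [^] a) = n * \<chi> b + a * t" if b: "b \<in> B" for b a
  proof -
    have "\<exists>b' a'. b' \<in> B \<and> b \<otimes> y [^] a = b' \<otimes> y [^] (a'::int) \<and> \<chi>' (b \<otimes> y [^] a) = n * \<chi> b' + a' * t"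
      unfolding \<chi>'_def by (rule someI[of _ "n * \<chi> b + a * t"]) (use b in blast)
    then obtain b' a' where b': "b' \<in> B" and eq: "b \<otimes> y [^] a = b' \<otimes> y [^] (a'::int)"
      and v: "\<chi>' (b \<otimes> y [^] a) = n * \<chi> b' + a' * t" by blast
    have "y [^] (a - a') = y [^] a \<otimes> inv (y [^] a')" using y by (simp add: int_pow_diff)
    also have "\<dots> = inv b \<otimes> (b \<otimes> y [^] a) \<otimes> inv (y [^] a')"
      using y b Bc by (simp add: m_assoc[symmetric])
    also have "\<dots> = inv b \<otimes> b'"
      unfolding eq using y b b' Bc by (simp add: m_assoc)
    finally have *: "y [^] (a - a') = inv b \<otimes> b'" .
    then have "y [^] (a - a') \<in> B"
      using b b' B by (simp add: subgroup.m_closed subgroup.m_inv_closed)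
    from nt[OF this] have "n * \<chi> (inv b \<otimes> b') = (a - a') * t" using * by simp
    moreover have "\<chi> (inv b \<otimes> b') = - \<chi> b + \<chi> b'"
      using additive_inv[OF add B b] add b b' B
      by (simp add: additive_on_def subgroup.m_inv_closed)
    ultimately show ?thesis using v by (simp add: algebra_simps)
  qed
  have mul: "(b \<otimes> y [^] a) \<otimes> (b' \<otimes> y [^] a') = (b \<otimes> b') \<otimes> y [^] (a + a')"
    if "b \<in> B" "b' \<in> B" for b b' and a a' :: int
    using that y Bc by (simp add: int_pow_mult m_ac)
  have sub: "subgroup B' G"
  proof (rule subgroupI)
    show "B' \<subseteq> carrier G" using y Bc by (auto simp: B'_def)
    show "B' \<noteq> {}" using subgroup.one_closed[OF B] by (auto simp: B'_def)
    show "inv a \<in> B'" if a: "a \<in> B'" for a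
    proof -
      obtain b c where "a = b \<otimes> y [^] (c::int)" "b \<in> B" using a by (auto simp: B'_def)
      then have "inv a = inv b \<otimes> y [^] (- c)"
        using y Bc by (simp add: inv_mult int_pow_neg)
      then show ?thesis using \<open>b \<in> B\<close> B by (auto simp: B'_def subgroup.m_inv_closed)
    qed
    show "a \<otimes> b \<in> B'" if "a \<in> B'" "b \<in> B'" for a b
      using that mul subgroup.m_closed[OF B] by (fastforce simp: B'_def)
  qed
  have "B \<subseteq> B'"
  proof
    fix b assume "b \<in> B"
    moreover from this have "b = b \<otimes> y [^] (0::int)" using Bc by simp
    ultimately show "b \<in> B'" unfolding B'_def by blast
  qed
  moreover have y1: "y = \<one> \<otimes> y [^] (1::int)" using y by simp
  then have "y \<in> B'" using subgroup.one_closed[OF B] unfolding B'_def by blast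
  moreover have "additive_on G B' \<chi>'"
    unfolding additive_on_def
  proof (intro ballI)
    fix u v assume "u \<in> B'" "v \<in> B'"
    then obtain b a b' a' where *: "u = b \<otimes> y [^] (a::int)" "v = b' \<otimes> y [^] (a'::int)" "b \<in> B" "b' \<in> B"
      by (auto simp: B'_def)
    then have "\<chi> (b \<otimes> b') = \<chi> b + \<chi> b'" using add by (simp add: additive_on_def)
    then show "\<chi>' (u \<otimes> v) = \<chi>' u + \<chi>' v"
      using * subgroup.m_closed[OF B] by (simp add: mul val algebra_simps)
  qed
  moreover have "\<forall>x\<in>B. \<chi>' x = n * \<chi> x"
  proof
    fix b assume "b \<in> B"
    then show "\<chi>' b = n * \<chi> b" using val[of b 0] Bc by simp
  qed
  moreover have "\<chi>' y = t"
    using val[of \<one> 1] y additive_one[OF add B] subgroup.one_closed[OF B] by simp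
  ultimately show ?thesis using sub by blast
qed

lemma additive_extend_step:
  assumes B: "subgroup B G" and add: "additive_on G B \<chi>" and y: "y \<in> carrier G"
  shows "\<exists>n>0. \<exists>B' \<chi>'. subgroup B' G \<and> B \<subseteq> B' \<and> y \<in> B' \<and> additive_on G B' \<chi>' \<and>
    (\<forall>x\<in>B. \<chi>' x = n * \<chi> x)"
proof (cases "\<exists>n>0. y [^] (n::int) \<in> B")
  case True
  then obtain n where n: "n > 0" "y [^] (n::int) \<in> B" by blast
  have "n * \<chi> (y [^] c) = c * \<chi> (y [^] n)" if "y [^] c \<in> B" for c
  proof -
    have "y [^] (c * n) = y [^] (n * c)" by (simp add: mult.commute)
    then have "(y [^] c) [^] n = (y [^] n) [^] c" using y by (simp add: int_pow_pow)
    then show ?thesis using additive_int_pow[OF add B] that n(2) by metis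
  qed
  from additive_extend_one[OF B add y this] n(1) show ?thesis by blast
next
  case False
  have "c = 0" if "y [^] c \<in> B" for c :: int
  proof (rule ccontr)
    assume "c \<noteq> 0"
    moreover have "y [^] (- c) \<in> B"
      using subgroup.m_inv_closed[OF B that] y by (simp add: int_pow_neg)
    ultimately show False using False that by (metis linorder_neqE_linordered_idom neg_0_less_iff_less)
  qed
  moreover have "\<chi> \<one> = 0" using additive_one add B by blast
  ultimately have "1 * \<chi> (y [^] c) = c * 0" if "y [^] c \<in> B" for c :: int
    using that by fastforce
  from additive_extend_one[OF B add y this] show ?thesis by (intro exI[of _ 1]) auto
qed

text \<open>
  This allows values of an additive function on a subgroup to be estimated by word length in the
  ambient group, although the subgroup comes without generators.
\<close>
lemma additive_extend:
  assumes B: "subgroup B G" and add: "additive_on G B \<chi>"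
    and S: "finite S" "S \<subseteq> carrier G" "generate G S = carrier G"
  shows "\<exists>n>0. \<exists>\<chi>'. additive_on G (carrier G) \<chi>' \<and> (\<forall>x\<in>B. \<chi>' x = n * \<chi> x)"
proof -
  have "\<exists>n>0. \<exists>B' \<chi>'. subgroup B' G \<and> B \<subseteq> B' \<and> S \<subseteq> B' \<and> additive_on G B' \<chi>' \<and>
      (\<forall>x\<in>B. \<chi>' x = n * \<chi> x)"
    using S(1,2)
  proof (induction S rule: finite_induct)
    case empty
    then show ?case using B add by (intro exI[of _ 1]) auto
  next
    case (insert y S)
    then obtain n B1 \<chi>1 where 1: "n > 0" "subgroup B1 G" "B \<subseteq> B1" "S \<subseteq> B1" "additive_on G B1 \<chi>1"
      "\<forall>x\<in>B. \<chi>1 x = n * \<chi> x" by auto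
    obtain n' B2 \<chi>2 where 2: "n' > 0" "subgroup B2 G" "B1 \<subseteq> B2" "y \<in> B2" "additive_on G B2 \<chi>2"
      "\<forall>x\<in>B1. \<chi>2 x = n' * \<chi>1 x"
      using additive_extend_step[OF 1(2,5), of y] insert.prems by auto
    have "n' * n > 0" "\<forall>x\<in>B. \<chi>2 x = (n' * n) * \<chi> x" "B \<subseteq> B2" "insert y S \<subseteq> B2"
      using 1 2 by auto
    then show ?case using 2 by blast
  qed
  then obtain n B' \<chi>' where *: "n > 0" "subgroup B' G" "B \<subseteq> B'" "S \<subseteq> B'" "additive_on G B' \<chi>'"
      "\<forall>x\<in>B. \<chi>' x = n * \<chi> x" by blast
  have "B' = carrier G"
    using generate_subgroup_incl[OF *(4,2)] S(3) subgroup.subset[OF *(2)] by auto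
  then show ?thesis using * by blast
qed

lemma infinite_order_functional:
  assumes S: "finite S" "S \<subseteq> carrier G" "generate G S = carrier G"
    and x: "x \<in> carrier G" "\<And>n::nat. n > 0 \<Longrightarrow> x [^] n \<noteq> \<one>"
  shows "\<exists>\<chi>. additive_on G (carrier G) \<chi> \<and> \<chi> x \<noteq> 0"
proof -
  have triv: "subgroup {\<one>} G" "additive_on G {\<one>} (\<lambda>_. 0)"
    by (simp_all add: triv_subgroup additive_on_def)
  have "c = 0" if "x [^] c \<in> {\<one>}" for c :: int
  proof (rule ccontr)
    assume "c \<noteq> 0"
    have "x [^] int (nat \<bar>c\<bar>) = \<one>"
    proof (cases "c < 0")
      case True
      then have "x [^] int (nat \<bar>c\<bar>) = inv (x [^] c)" using x(1) by (simp add: int_pow_neg)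
      then show ?thesis using that by simp
    qed (use that in simp)
    then have "x [^] nat \<bar>c\<bar> = \<one>" by (simp only: int_pow_int)
    then show False using x(2)[of "nat \<bar>c\<bar>"] \<open>c \<noteq> 0\<close> by simp
  qed
  then have *: "1 * 0 = c * (1::int)" if "x [^] c \<in> {\<one>}" for c :: int
    using that by fastforce
  obtain B \<chi> where B: "subgroup B G" "x \<in> B" "additive_on G B \<chi>" "\<chi> x = 1"
    using additive_extend_one[OF triv x(1) *] by blast
  obtain n \<chi>' where "n > 0" "additive_on G (carrier G) \<chi>'" "\<forall>x\<in>B. \<chi>' x = n * \<chi> x"
    using additive_extend[OF B(1,3) S] by blast
  then show ?thesis using B by (metis mult.right_neutral less_irrefl)
qed

text \<open>
  After extension of multiples of the \<open>\<chi> i\<close> to the whole group, a linear dependence of their values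
  on the generators would be a dependence of the functions themselves, contradicting duality.
\<close>
lemma dual_system_le:
  assumes sys: "dual_system G B d \<chi> e" and B: "subgroup B G"
    and S: "finite S" "S \<subseteq> carrier G" "generate G S = carrier G"
  shows "d \<le> card S"
proof (rule ccontr)
  assume "\<not> d \<le> card S"
  have "\<exists>n \<psi>. i < d \<longrightarrow> n > 0 \<and> additive_on G (carrier G) \<psi> \<and> (\<forall>x\<in>B. \<psi> x = n * \<chi> i x)" for i
  proof (cases "i < d")
    case True
    then have "additive_on G B (\<chi> i)" using sys by (simp add: dual_system_def)
    from additive_extend[OF B this S] show ?thesis by blast
  qed simp
  then obtain n \<psi> where \<psi>: "\<And>i. i < d \<Longrightarrow> n i > (0::int) \<and> additive_on G (carrier G) (\<psi> i) \<and> (\<forall>x\<in>B. \<psi> i x = n i * \<chi> i x)"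
    by metis
  obtain c where c: "\<exists>i\<in>{..<d}. c i \<noteq> 0" "\<forall>x\<in>S. (\<Sum>i\<in>{..<d}. c i * \<psi> i x) = 0"
    using integer_dependence[of S "{..<d}" \<psi>] S \<open>\<not> d \<le> card S\<close> by auto
  have "additive_on G (carrier G) (\<lambda>x. \<Sum>i\<in>{..<d}. c i * \<psi> i x)"
    using \<psi> by (intro additive_combination) auto
  from additive_zero_generate[OF this S(2)] c(2)
  have zero: "(\<Sum>i\<in>{..<d}. c i * \<psi> i x) = 0" if "x \<in> carrier G" for x
    using that S(3) by blast
  obtain p where p: "p < d" "c p \<noteq> 0" using c(1) by auto
  have ep: "e p \<in> B" using sys p by (auto simp: dual_system_def)
  then have "0 = (\<Sum>i\<in>{..<d}. c i * \<psi> i (e p))"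
    using zero[of "e p"] subgroup.mem_carrier[OF B] by simp
  also have "\<dots> = (\<Sum>i\<in>{..<d}. if i = p then c p * n p else 0)"
    using \<psi> ep sys p by (intro sum.cong) (auto simp: dual_system_def)
  also have "\<dots> = c p * n p" using p by simp
  finally show False using p \<psi>[of p] by simp
qed

lemma finprod_dual:
  assumes sys: "dual_system G B d \<chi> e" and B: "subgroup B G"
  shows "finprod G (\<lambda>k. e k [^] (c k::int)) {..<d} \<in> B"
    and "i < d \<Longrightarrow> \<chi> i (finprod G (\<lambda>k. e k [^] (c k::int)) {..<d}) = c i"
proof -
  have e: "e k [^] (m::int) \<in> B" if "k < d" for k m
    using sys that subgroup_int_pow_closed[OF B] by (auto simp: dual_system_def)
  show "finprod G (\<lambda>k. e k [^] c k) {..<d} \<in> B"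
    by (rule subgroup_finprod[OF B]) (auto intro: e)
  assume i: "i < d"
  have add: "additive_on G B (\<chi> i)" using sys i by (auto simp: dual_system_def)
  have "\<chi> i (finprod G (\<lambda>k. e k [^] c k) {..<d}) = (\<Sum>k\<in>{..<d}. \<chi> i (e k [^] c k))"
    by (rule additive_finprod[OF add B, THEN conjunct2]) (auto intro: e)
  also have "\<dots> = (\<Sum>k\<in>{..<d}. if k = i then c i else 0)"
  proof (rule sum.cong[OF refl])
    fix k assume k: "k \<in> {..<d}"
    have "e k \<in> B" "\<chi> i (e k) = (if i = k then 1 else 0)"
      using sys i k by (auto simp: dual_system_def)
    then show "\<chi> i (e k [^] c k) = (if k = i then c i else 0)"
      using additive_int_pow[OF add B] by auto
  qed
  also have "\<dots> = c i" using i by simp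
  finally show "\<chi> i (finprod G (\<lambda>k. e k [^] c k) {..<d}) = c i" .
qed

text \<open>
  The lattice part of \<open>x\<close> is its component in the span of the \<open>e k\<close>, so that the quotient of \<open>x\<close> by
  it is the component in the null part.
\<close>
lemma lattice_part:
  assumes sys: "dual_system G B d \<chi> e" and B: "subgroup B G" and x: "x \<in> B"
  shows "lattice_part G d \<chi> e x \<in> B" "\<And>i. i < d \<Longrightarrow> \<chi> i (lattice_part G d \<chi> e x) = \<chi> i x"
    "x \<otimes> inv (lattice_part G d \<chi> e x) \<in> null_part B d \<chi>"
proof -
  define s where "s = lattice_part G d \<chi> e x"
  show s: "lattice_part G d \<chi> e x \<in> B"
    and val: "\<And>i. i < d \<Longrightarrow> \<chi> i (lattice_part G d \<chi> e x) = \<chi> i x"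
    unfolding lattice_part_def using finprod_dual[OF sys B] by auto
  note s = s[folded s_def] and val = val[folded s_def]
  have "\<chi> i (x \<otimes> inv s) = 0" if i: "i < d" for i
  proof -
    have add: "additive_on G B (\<chi> i)" using sys i by (auto simp: dual_system_def)
    then show ?thesis
      using val[OF i] additive_inv[OF add B s] x subgroup.m_inv_closed[OF B s]
      by (simp add: additive_on_def)
  qed
  then show "x \<otimes> inv (lattice_part G d \<chi> e x) \<in> null_part B d \<chi>"
    using x subgroup.m_closed[OF B] subgroup.m_inv_closed[OF B s]
    by (simp add: null_part_def s_def[symmetric])
qed

lemma lattice_part_mult:
  assumes sys: "dual_system G B d \<chi> e" and B: "subgroup B G" and x: "x \<in> B" and y: "y \<in> B"
  shows "lattice_part G d \<chi> e (x \<otimes> y) = lattice_part G d \<chi> e x \<otimes> lattice_part G d \<chi> e y"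
proof -
  have ec: "e k \<in> carrier G" if "k < d" for k
    using sys that subgroup.subset[OF B] by (auto simp: dual_system_def)
  have add: "additive_on G B (\<chi> k)" if "k < d" for k using sys that by (auto simp: dual_system_def)
  have fc: "(\<lambda>k. e k [^] (f k::int)) \<in> {..<d} \<rightarrow> carrier G" for f using ec by auto
  have "lattice_part G d \<chi> e (x \<otimes> y) = finprod G (\<lambda>k. e k [^] \<chi> k x \<otimes> e k [^] \<chi> k y) {..<d}"
    unfolding lattice_part_def
    using x y additive_onD[OF add] ec by (intro finprod_cong') (auto simp: int_pow_mult)
  also have "\<dots> = lattice_part G d \<chi> e x \<otimes> lattice_part G d \<chi> e y"
    unfolding lattice_part_def using fc by (rule finprod_multf) (use fc in auto)
  finally show ?thesis .
qed

lemma dual_coordinates_inject: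
  assumes sys: "dual_system G B d \<chi> e" and B: "subgroup B G" and xy: "x \<in> B" "y \<in> B"
    and val: "\<And>i. i < d \<Longrightarrow> \<chi> i x = \<chi> i y"
    and res: "x \<otimes> inv (lattice_part G d \<chi> e x) = y \<otimes> inv (lattice_part G d \<chi> e y)"
  shows "x = y"
proof -
  have e: "e k \<in> carrier G" if "k < d" for k
    using sys that subgroup.subset[OF B] by (auto simp: dual_system_def)
  have "lattice_part G d \<chi> e x = lattice_part G d \<chi> e y"
    unfolding lattice_part_def by (intro finprod_cong') (use val e in auto)
  then show ?thesis
    using res xy lattice_part(1)[OF sys B] subgroup.mem_carrier[OF B] by simp
qed

text \<open>
  An element of infinite order in the null part is detected by an additive function \<open>\<psi>\<close> on the
  whole group. The values of \<open>\<psi>\<close> on the null part are the multiples of some \<open>g\<close>; correcting \<open>\<psi>\<close> by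
  the old coordinates and dividing by \<open>g\<close> yields a further coordinate.
\<close>
lemma dual_system_refine:
  assumes sys: "dual_system G B d \<chi> e" and B: "subgroup B G"
    and S: "finite S" "S \<subseteq> carrier G" "generate G S = carrier G"
    and x: "x \<in> null_part B d \<chi>" "\<And>n::nat. n > 0 \<Longrightarrow> x [^] n \<noteq> \<one>"
  shows "\<exists>\<chi>' e'. dual_system G B (Suc d) \<chi>' e'"
proof -
  define T where "T = null_part B d \<chi>"
  have TB: "T \<subseteq> B" by (auto simp: T_def null_part_def)
  obtain \<psi> where \<psi>: "additive_on G (carrier G) \<psi>" "\<psi> x \<noteq> 0"
    using infinite_order_functional[OF S, of x] x subgroup.mem_carrier[OF B] TB unfolding T_def by blast
  have \<psi>B: "additive_on G B \<psi>"
    using \<psi>(1) subgroup.subset[OF B] by (auto simp: additive_on_def)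
  have addc: "additive_on G B (\<chi> i)" if "i < d" for i using sys that by (auto simp: dual_system_def)
  have T: "subgroup T G"
  proof (rule subgroupI)
    show "T \<subseteq> carrier G" using TB subgroup.subset[OF B] by blast
    show "T \<noteq> {}" using x T_def by auto
    show "inv a \<in> T" if "a \<in> T" for a
      using that additive_inv[OF addc B] subgroup.m_inv_closed[OF B] by (auto simp: T_def null_part_def)
    show "a \<otimes> b \<in> T" if "a \<in> T" "b \<in> T" for a b
      using that addc subgroup.m_closed[OF B] by (auto simp: T_def null_part_def additive_on_def)
  qed
  have \<psi>T: "additive_on G T \<psi>" using \<psi>B TB by (auto simp: additive_on_def)
  \<comment> \<open>The positive values of \<psi> on T have a least element g, attained at z; it divides all values.\<close>
  have "\<exists>n. n > 0 \<and> (\<exists>z\<in>T. \<psi> z = int n)"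
  proof (cases "\<psi> x > 0")
    case True
    then show ?thesis using x by (intro exI[of _ "nat (\<psi> x)"]) (auto simp: T_def)
  next
    case False
    have "inv x \<in> T" using subgroup.m_inv_closed[OF T] x by (auto simp: T_def)
    moreover have "\<psi> (inv x) = - \<psi> x" using additive_inv[OF \<psi>T T] x by (auto simp: T_def)
    ultimately show ?thesis using False \<psi>(2) by (intro exI[of _ "nat (- \<psi> x)"]) auto
  qed
  then obtain g where g: "g > 0" "\<exists>z\<in>T. \<psi> z = int g"
    and least: "\<And>n. n < g \<Longrightarrow> \<not> (n > 0 \<and> (\<exists>z\<in>T. \<psi> z = int n))"
    using exists_least_iff[of "\<lambda>n. n > 0 \<and> (\<exists>z\<in>T. \<psi> z = int n)"] by blast
  obtain z where z: "z \<in> T" "\<psi> z = int g" using g by blast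
  have dvd: "int g dvd \<psi> t" if "t \<in> T" for t
  proof (rule ccontr)
    assume nd: "\<not> int g dvd \<psi> t"
    let ?q = "\<psi> t div int g"
    have "t \<otimes> inv (z [^] ?q) \<in> T"
      using that subgroup_int_pow_closed[OF T z(1)] subgroup.m_closed[OF T] subgroup.m_inv_closed[OF T] by blast
    moreover have "\<psi> (t \<otimes> inv (z [^] ?q)) = \<psi> t mod int g"
      using that subgroup_int_pow_closed[OF T z(1)] subgroup.m_inv_closed[OF T]
        additive_inv[OF \<psi>T T] additive_int_pow[OF \<psi>T T z(1)] \<psi>T z(2)
      by (simp add: additive_on_def minus_div_mult_eq_mod)
    moreover have "\<psi> t mod int g > 0" "\<psi> t mod int g < int g"
      using g(1) nd by (simp_all add: dvd_eq_mod_eq_0 order.not_eq_order_implies_strict)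
    ultimately show False
      using least[of "nat (\<psi> t mod int g)"] by (metis nat_less_iff order_less_imp_le zero_less_nat_eq nat_0_le)
  qed
  define \<theta> where "\<theta> = (\<lambda>y. \<psi> y - (\<Sum>k<d. \<psi> (e k) * \<chi> k y))"
  have \<theta>: "additive_on G B \<theta>"
    using \<psi>B additive_combination[of "{..<d}" B \<chi> "\<lambda>k. \<psi> (e k)"] addc
    by (auto simp: additive_on_def \<theta>_def)
  have \<theta>T: "\<theta> t = \<psi> t" if "t \<in> T" for t
    using that by (simp add: \<theta>_def T_def null_part_def)
  have \<theta>e: "\<theta> (e k) = 0" if k: "k < d" for k
  proof -
    have "(\<Sum>i<d. \<psi> (e i) * \<chi> i (e k)) = (\<Sum>i<d. if i = k then \<psi> (e k) else 0)"
      using sys k by (intro sum.cong) (auto simp: dual_system_def)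
    then show ?thesis using k by (simp add: \<theta>_def)
  qed
  have \<theta>dvd: "int g dvd \<theta> y" if y: "y \<in> B" for y
  proof -
    define s where "s = lattice_part G d \<chi> e y"
    note s = lattice_part[OF sys B y, folded s_def]
    have "\<theta> s = (\<Sum>k<d. \<theta> (e k [^] \<chi> k y))"
      unfolding s_def lattice_part_def
      by (rule additive_finprod[OF \<theta> B, THEN conjunct2])
        (use sys subgroup_int_pow_closed[OF B] in \<open>auto simp: dual_system_def\<close>)
    also have "\<dots> = 0"
      using additive_int_pow[OF \<theta> B] \<theta>e sys by (intro sum.neutral) (auto simp: dual_system_def)
    finally have "\<theta> (y \<otimes> inv s) = \<theta> y"
      using \<theta> y s(1) subgroup.m_inv_closed[OF B s(1)] additive_inv[OF \<theta> B s(1)]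
      by (simp add: additive_on_def)
    then show ?thesis using dvd[of "y \<otimes> inv s"] \<theta>T[of "y \<otimes> inv s"] s(3) by (simp add: T_def)
  qed
  define \<chi>' where "\<chi>' = (\<lambda>i. if i = d then (\<lambda>y. \<theta> y div int g) else \<chi> i)"
  define e' where "e' = (\<lambda>i. if i = d then z else e i)"
  have "additive_on G B (\<lambda>y. \<theta> y div int g)"
    using \<theta> \<theta>dvd by (auto simp: additive_on_def)
  then have 1: "\<forall>i<Suc d. additive_on G B (\<chi>' i)" using addc by (auto simp: \<chi>'_def less_Suc_eq)
  have 2: "\<forall>i<Suc d. e' i \<in> B" using sys z TB by (auto simp: e'_def dual_system_def less_Suc_eq)
  have "\<theta> z div int g = 1" using \<theta>T[OF z(1)] z(2) g(1) by simp
  moreover have "\<forall>k<d. \<chi> k z = 0" using z(1) by (auto simp: T_def null_part_def)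
  ultimately have 3: "\<forall>i<Suc d. \<forall>k<Suc d. \<chi>' i (e' k) = (if i = k then 1 else 0)"
    using sys \<theta>e by (auto simp: \<chi>'_def e'_def dual_system_def less_Suc_eq)
  show ?thesis using 1 2 3 unfolding dual_system_def by blast
qed

lemma finite_generate_torsion:
  assumes "finite S" "S \<subseteq> carrier G" "\<And>x. x \<in> S \<Longrightarrow> \<exists>n>0. x [^] (n::nat) = \<one>"
  shows "finite (generate G S)"
  using assms
proof (induction S rule: finite_induct)
  case empty
  then show ?case by (simp add: generate_empty)
next
  case (insert y S)
  obtain n where n: "n > 0" "y [^] (n::nat) = \<one>" using insert.prems by blast
  have y: "y \<in> carrier G" and S: "S \<subseteq> carrier G" using insert.prems by auto
  let ?B = "generate G S"
  have B: "subgroup ?B G" using generate_is_subgroup[OF S] .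
  define W where "W = (\<lambda>(b, k). b \<otimes> y [^] (k::nat)) ` (?B \<times> {..<n})"
  have red: "b \<otimes> y [^] k \<in> W" if b: "b \<in> ?B" for b and k :: nat
  proof -
    have "k = n * (k div n) + k mod n" by simp
    then have "y [^] k = (y [^] n) [^] (k div n) \<otimes> y [^] (k mod n)"
      using y by (simp add: nat_pow_mult nat_pow_pow)
    then have "b \<otimes> y [^] k = b \<otimes> y [^] (k mod n)" using n y by simp
    moreover have "k mod n < n" using n(1) by simp
    ultimately show ?thesis using b by (force simp: W_def)
  qed
  have "generate G (insert y S) \<subseteq> W"
  proof
    fix g assume "g \<in> generate G (insert y S)"
    then show "g \<in> W"
    proof induction
      case one
      then show ?case using red[of \<one> 0] generate.one[of G S] by simp
    next
      case (incl h)
      then consider "h = y" | "h \<in> S" by blast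
      then show ?case
      proof cases
        case 1
        then show ?thesis using red[of \<one> 1] generate.one[of G S] y by simp
      next
        case 2
        then show ?thesis using red[OF generate.incl, of h 0] S by auto
      qed
    next
      case (inv h)
      then consider "h = y" | "h \<in> S" by blast
      then show ?case
      proof cases
        case 1
        have "y [^] (n - 1) \<otimes> y = \<one>" using n y by (metis Suc_diff_1 nat_pow_Suc)
        then have "inv y = y [^] (n - 1)" using y by (simp add: inv_equality)
        then show ?thesis using red[of \<one> "n - 1"] generate.one[of G S] 1 y by simp
      next
        case 2
        then show ?thesis using red[OF generate.inv, of h 0] S by auto
      qed
    next
      case (eng h1 h2)
      then obtain b k b' k' where *: "h1 = b \<otimes> y [^] (k::nat)" "h2 = b' \<otimes> y [^] (k'::nat)" "b \<in> ?B" "b' \<in> ?B"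
        by (auto simp: W_def)
      have bc: "b \<in> carrier G" "b' \<in> carrier G" using * subgroup.mem_carrier[OF B] by auto
      have "h1 \<otimes> h2 = (b \<otimes> b') \<otimes> y [^] (k + k')"
        using * bc y by (simp add: m_ac nat_pow_mult[symmetric])
      then show ?case using red[of "b \<otimes> b'" "k + k'"] * subgroup.m_closed[OF B] by simp
    qed
  qed
  moreover have "finite W" using insert S by (auto simp: W_def)
  ultimately show ?case by (rule finite_subset)
qed

lemma dual_system_maximal:
  assumes B: "subgroup B G" and S: "finite S" "S \<subseteq> carrier G" "generate G S = carrier G"
  shows "\<exists>d \<chi> e. dual_system G B d \<chi> e \<and> (\<forall>x \<in> null_part B d \<chi>. \<exists>n>0. x [^] (n::nat) = \<one>)"
proof -
  define P where "P = (\<lambda>d. \<exists>\<chi> e. dual_system G B d \<chi> e)"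
  have "P 0" by (auto simp: P_def dual_system_def)
  moreover have "\<forall>d. P d \<longrightarrow> d \<le> card S" using dual_system_le[OF _ B S] by (auto simp: P_def)
  ultimately obtain d where d: "P d" "\<And>d'. P d' \<Longrightarrow> d' \<le> d"
    using Greatest_le_nat GreatestI_nat by metis
  then show ?thesis
    using dual_system_refine[OF _ B S] unfolding P_def by (metis Suc_n_not_le_n)
qed

text \<open>
  Projecting along the lattice part of a maximal dual system of the whole group maps it onto a
  group that is generated by finitely many torsion elements, and fixes each torsion element.
\<close>
lemma finite_torsion:
  assumes S: "finite S" "S \<subseteq> carrier G" "generate G S = carrier G"
  shows "finite {x \<in> carrier G. \<exists>n>0. x [^] (n::nat) = \<one>}"
proof -
  obtain d \<chi> e where sys: "dual_system G (carrier G) d \<chi> e"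
    and tor: "\<forall>x \<in> null_part (carrier G) d \<chi>. \<exists>n>0. x [^] (n::nat) = \<one>"
    using dual_system_maximal[OF subgroup_self S] by blast
  have ec: "e k \<in> carrier G" if "k < d" for k using sys that by (auto simp: dual_system_def)
  have add: "additive_on G (carrier G) (\<chi> k)" if "k < d" for k using sys that by (auto simp: dual_system_def)
  define \<tau> where "\<tau> = (\<lambda>x. x \<otimes> inv (lattice_part G d \<chi> e x))"
  note lat = lattice_part[OF sys subgroup_self]
  have \<tau>null: "\<tau> x \<in> null_part (carrier G) d \<chi>" if "x \<in> carrier G" for x
    using lat(3)[OF that] by (simp add: \<tau>_def)
  have \<tau>mult: "\<tau> (x \<otimes> y) = \<tau> x \<otimes> \<tau> y" if "x \<in> carrier G" "y \<in> carrier G" for x y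
    using that lat(1) lattice_part_mult[OF sys subgroup_self that] by (simp add: \<tau>_def inv_mult m_ac)
  interpret \<tau>: group_hom G G \<tau>
    using \<tau>mult \<tau>null by unfold_locales (auto simp: hom_def null_part_def)
  have "\<tau> ` S \<subseteq> carrier G" using S(2) \<tau>.hom_closed by blast
  moreover have "\<exists>n>0. y [^] (n::nat) = \<one>" if "y \<in> \<tau> ` S" for y using that tor \<tau>null S(2) by blast
  ultimately have "finite (generate G (\<tau> ` S))" using S(1) by (intro finite_generate_torsion) auto
  then have fin: "finite (\<tau> ` carrier G)" using \<tau>.generate_img[OF S(2)] S(3) by simp
  have "{x \<in> carrier G. \<exists>n>0. x [^] (n::nat) = \<one>} \<subseteq> \<tau> ` carrier G"
  proof
    fix x assume "x \<in> {x \<in> carrier G. \<exists>n>0. x [^] (n::nat) = \<one>}"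
    then obtain n where x: "x \<in> carrier G" and n: "n > 0" "x [^] (n::nat) = \<one>" by blast
    have "\<chi> k x = 0" if "k < d" for k
      using additive_nat_pow[OF add[OF that] subgroup_self x, of n] n
        additive_one[OF add[OF that] subgroup_self] by simp
    then have "lattice_part G d \<chi> e x = \<one>"
      unfolding lattice_part_def by (intro finprod_one_eqI) simp
    then have "\<tau> x = x" using x by (simp add: \<tau>_def)
    then show "x \<in> \<tau> ` carrier G" using x by (metis imageI)
  qed
  then show ?thesis using fin by (rule finite_subset)
qed

text \<open>
  The structure theorem, for subgroups of finitely generated abelian groups: a maximal dual system
  exists by the bound on its size, and its null part consists of torsion elements.
\<close>
lemma dual_system_exists:
  assumes B: "subgroup B G" and S: "finite S" "S \<subseteq> carrier G" "generate G S = carrier G"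
  shows "\<exists>d \<chi> e. dual_system G B d \<chi> e \<and> finite (null_part B d \<chi>)"
proof -
  obtain d \<chi> e where sys: "dual_system G B d \<chi> e"
    and tor: "\<forall>x \<in> null_part B d \<chi>. \<exists>n>0. x [^] (n::nat) = \<one>"
    using dual_system_maximal[OF B S] by blast
  have "null_part B d \<chi> \<subseteq> {x \<in> carrier G. \<exists>n>0. x [^] (n::nat) = \<one>}"
    using tor subgroup.subset[OF B] by (auto simp: null_part_def)
  then show ?thesis using sys finite_torsion[OF S] finite_subset by blast
qed

text \<open>
  Uniqueness of the rank: additive functions vanish on a finite null part, so that they are
  determined by their values on \<open>e'\<close>; more than \<open>d'\<close> of them are dependent.
\<close>
lemma dual_system_dim_le:
  assumes B: "subgroup B G" and sys: "dual_system G B d \<chi> e"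
    and sys': "dual_system G B d' \<chi>' e'" and fin: "finite (null_part B d' \<chi>')"
  shows "d \<le> d'"
proof (rule ccontr)
  assume "\<not> d \<le> d'"
  then have "card (e' ` {..<d'}) < card {..<d}"
    using card_image_le[of "{..<d'}" e'] by simp
  then obtain c where c: "\<exists>i\<in>{..<d}. c i \<noteq> 0" "\<forall>x\<in>e' ` {..<d'}. (\<Sum>i\<in>{..<d}. c i * \<chi> i x) = 0"
    using integer_dependence[of "e' ` {..<d'}" "{..<d}" \<chi>] by auto
  define \<psi> where "\<psi> = (\<lambda>x. \<Sum>i\<in>{..<d}. c i * \<chi> i x)"
  have \<psi>: "additive_on G B \<psi>"
    unfolding \<psi>_def using sys by (intro additive_combination) (auto simp: dual_system_def)
  have \<psi>null: "\<psi> t = 0" if t: "t \<in> null_part B d' \<chi>'" for t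
  proof (rule ccontr)
    assume ne: "\<psi> t \<noteq> 0"
    have tB: "t \<in> B" and t0: "\<And>i. i < d' \<Longrightarrow> \<chi>' i t = 0" using t by (auto simp: null_part_def)
    have "t [^] n \<in> null_part B d' \<chi>'" for n :: nat
    proof -
      have "\<chi>' i (t [^] n) = 0" if "i < d'" for i
        using additive_nat_pow[OF _ B tB, of "\<chi>' i" n] t0[OF that] sys' that by (simp add: dual_system_def)
      then show ?thesis using additive_nat_pow[OF \<psi> B tB, of n] by (simp add: null_part_def)
    qed
    then have "range (\<lambda>n::nat. t [^] n) \<subseteq> null_part B d' \<chi>'" by blast
    then have "finite (range (\<lambda>n::nat. t [^] n))" using fin finite_subset by blast
    moreover have "inj (\<lambda>n::nat. t [^] n)"
    proof (rule injI)
      fix n m :: nat assume "t [^] n = t [^] m"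
      then have "int n * \<psi> t = int m * \<psi> t" using additive_nat_pow[OF \<psi> B tB] by metis
      then show "n = m" using ne by simp
    qed
    ultimately show False using finite_imageD by blast
  qed
  have zero: "\<psi> x = 0" if x: "x \<in> B" for x
  proof -
    define s where "s = lattice_part G d' \<chi>' e' x"
    note s = lattice_part[OF sys' B x, folded s_def]
    have "\<psi> s = (\<Sum>k<d'. \<psi> (e' k [^] \<chi>' k x))"
      unfolding s_def lattice_part_def
      by (rule additive_finprod[OF \<psi> B, THEN conjunct2])
        (use sys' subgroup_int_pow_closed[OF B] in \<open>auto simp: dual_system_def\<close>)
    also have "\<dots> = 0"
      using additive_int_pow[OF \<psi> B] c(2) sys' by (intro sum.neutral) (auto simp: dual_system_def \<psi>_def)
    finally have "\<psi> (x \<otimes> inv s) = \<psi> x"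
      using \<psi> x s(1) subgroup.m_inv_closed[OF B s(1)] additive_inv[OF \<psi> B s(1)]
      by (simp add: additive_on_def)
    then show ?thesis using \<psi>null[OF s(3)] by simp
  qed
  obtain p where p: "p < d" "c p \<noteq> 0" using c(1) by auto
  have "\<psi> (e p) = (\<Sum>i\<in>{..<d}. if i = p then c p else 0)"
    unfolding \<psi>_def using sys p by (intro sum.cong) (auto simp: dual_system_def)
  also have "\<dots> = c p" using p by simp
  finally show False using zero[of "e p"] sys p by (simp add: dual_system_def)
qed

lemma dual_system_imp_iso:
  assumes sys: "dual_system G (carrier G) d \<chi> e"
  shows "group \<lparr>carrier = null_part (carrier G) d \<chi>, monoid.mult = monoid.mult G, one = \<one>\<rparr>"
    and "G \<cong> product_group {..<d} (\<lambda>_. integer_group) \<times>\<times>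
      \<lparr>carrier = null_part (carrier G) d \<chi>, monoid.mult = monoid.mult G, one = \<one>\<rparr>"
proof -
  let ?T = "null_part (carrier G) d \<chi>"
  let ?TG = "\<lparr>carrier = ?T, monoid.mult = monoid.mult G, one = \<one>\<rparr>"
  have add: "additive_on G (carrier G) (\<chi> i)" if "i < d" for i using sys that by (simp add: dual_system_def)
  note lat = lattice_part[OF sys subgroup_self]
  have ec: "e k \<in> carrier G" if "k < d" for k using sys that by (simp add: dual_system_def)
  show "group ?TG"
  proof (rule groupI; simp)
    show "\<one> \<in> ?T" using additive_one[OF add subgroup_self] by (simp add: null_part_def)
    show "x \<otimes> y \<in> ?T" if "x \<in> ?T" "y \<in> ?T" for x y
      using that additive_onD[OF add] by (simp add: null_part_def)
    show "x \<otimes> y \<otimes> z = x \<otimes> (y \<otimes> z)" if "x \<in> ?T" "y \<in> ?T" "z \<in> ?T" for x y z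
      using that by (simp add: null_part_def m_assoc)
    show "\<one> \<otimes> x = x" if "x \<in> ?T" for x using that by (simp add: null_part_def)
    show "\<exists>y\<in>?T. y \<otimes> x = \<one>" if "x \<in> ?T" for x
      using that additive_inv[OF add subgroup_self] by (intro bexI[of _ "inv x"]) (auto simp: null_part_def)
  qed
  define h where "h = (\<lambda>x. ((\<lambda>i\<in>{..<d}. \<chi> i x), x \<otimes> inv (lattice_part G d \<chi> e x)))"
  have "h \<in> hom G (product_group {..<d} (\<lambda>_. integer_group) \<times>\<times> ?TG)"
  proof (rule homI)
    show "h x \<in> carrier (product_group {..<d} (\<lambda>_. integer_group) \<times>\<times> ?TG)" if "x \<in> carrier G" for x
      using that lat(3) by (auto simp: h_def DirProd_def)
    show "h (x \<otimes> y) = h x \<otimes>\<^bsub>product_group {..<d} (\<lambda>_. integer_group) \<times>\<times> ?TG\<^esub> h y"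
      if "x \<in> carrier G" "y \<in> carrier G" for x y
    proof -
      have "(\<lambda>i\<in>{..<d}. \<chi> i (x \<otimes> y)) = (\<lambda>i\<in>{..<d}. (\<lambda>i\<in>{..<d}. \<chi> i x) i + (\<lambda>i\<in>{..<d}. \<chi> i y) i)"
        using additive_onD[OF add that] by (auto simp: restrict_def)
      moreover have "x \<otimes> y \<otimes> inv (lattice_part G d \<chi> e (x \<otimes> y)) =
          x \<otimes> inv (lattice_part G d \<chi> e x) \<otimes> (y \<otimes> inv (lattice_part G d \<chi> e y))"
        using that lat(1) lattice_part_mult[OF sys subgroup_self that] by (simp add: inv_mult m_ac)
      ultimately show ?thesis by (simp add: h_def DirProd_def)
    qed
  qed
  moreover have "bij_betw h (carrier G) (carrier (product_group {..<d} (\<lambda>_. integer_group) \<times>\<times> ?TG))"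
    unfolding bij_betw_def
  proof
    show "inj_on h (carrier G)"
    proof (rule inj_onI)
      fix x y assume x: "x \<in> carrier G" and y: "y \<in> carrier G" and eq: "h x = h y"
      have "\<chi> i x = \<chi> i y" if "i < d" for i
      proof -
        have "(\<lambda>i\<in>{..<d}. \<chi> i x) i = (\<lambda>i\<in>{..<d}. \<chi> i y) i" using eq unfolding h_def by simp
        then show ?thesis using that by simp
      qed
      then show "x = y"
        using eq dual_coordinates_inject[OF sys subgroup_self x y] by (simp add: h_def)
    qed
    show "h ` carrier G = carrier (product_group {..<d} (\<lambda>_. integer_group) \<times>\<times> ?TG)"
    proof
      show "h ` carrier G \<subseteq> carrier (product_group {..<d} (\<lambda>_. integer_group) \<times>\<times> ?TG)"
        using lat(3) by (auto simp: h_def DirProd_def)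
      show "carrier (product_group {..<d} (\<lambda>_. integer_group) \<times>\<times> ?TG) \<subseteq> h ` carrier G"
      proof
        fix z assume "z \<in> carrier (product_group {..<d} (\<lambda>_. integer_group) \<times>\<times> ?TG)"
        then obtain f t where z: "z = (f, t)" and f: "f \<in> {..<d} \<rightarrow>\<^sub>E UNIV" and t: "t \<in> ?T"
          by (auto simp: DirProd_def)
        define s where "s = finprod G (\<lambda>k. e k [^] f k) {..<d}"
        have s: "s \<in> carrier G" "\<And>i. i < d \<Longrightarrow> \<chi> i s = f i"
          unfolding s_def using finprod_dual[OF sys subgroup_self] by auto
        have tc: "t \<in> carrier G" and t0: "\<And>i. i < d \<Longrightarrow> \<chi> i t = 0" using t by (auto simp: null_part_def)
        have val: "\<chi> i (s \<otimes> t) = f i" if "i < d" for i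
          using additive_onD[OF add[OF that] s(1) tc] s(2) t0 that by simp
        then have "(\<lambda>i\<in>{..<d}. \<chi> i (s \<otimes> t)) = f"
          using f by (auto simp: restrict_def PiE_def extensional_def)
        moreover have "lattice_part G d \<chi> e (s \<otimes> t) = s"
          unfolding lattice_part_def s_def[symmetric]
          using val ec by (subst s_def, intro finprod_cong') auto
        ultimately have "h (s \<otimes> t) = z"
          using s(1) tc z m_comm[of s t] inv_solve_right'[of t s "s \<otimes> t"] by (simp add: h_def m_assoc)
        then show "z \<in> h ` carrier G" using s(1) tc by (metis imageI m_closed)
      qed
    qed
  qed
  ultimately show "G \<cong> product_group {..<d} (\<lambda>_. integer_group) \<times>\<times> ?TG"
    unfolding is_iso_def iso_def by blast
qed

text \<open>
  The converse of the preceding lemma. It is needed because the rank is defined by a definite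
  description, whose uniqueness part starts from an arbitrary decomposition.
\<close>
lemma iso_imp_dual_system:
  assumes iso: "G \<cong> product_group {..<d} (\<lambda>_. integer_group) \<times>\<times> T"
    and T: "group T" "finite (carrier T)"
  shows "\<exists>\<chi> e. dual_system G (carrier G) d \<chi> e \<and> finite (null_part (carrier G) d \<chi>)"
proof -
  let ?P = "product_group {..<d} (\<lambda>_. integer_group) \<times>\<times> T"
  obtain h where h: "h \<in> hom G ?P" "bij_betw h (carrier G) (carrier ?P)"
    using iso unfolding is_iso_def iso_def by blast
  define \<delta> where "\<delta> = (\<lambda>k::nat. ((\<lambda>i\<in>{..<d}. if i = k then 1 else (0::int)), \<one>\<^bsub>T\<^esub>))"
  define \<chi> where "\<chi> = (\<lambda>i x. fst (h x) i)"
  define e where "e = (\<lambda>k. inv_into (carrier G) h (\<delta> k))"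
  have \<delta>: "\<delta> k \<in> carrier ?P" for k
    using group.is_monoid[OF T(1)] by (auto simp: \<delta>_def DirProd_def monoid.one_closed)
  have surj: "h ` carrier G = carrier ?P" using h(2) by (simp add: bij_betw_def)
  have e: "e k \<in> carrier G" "h (e k) = \<delta> k" for k
    using \<delta>[of k] surj by (auto simp: e_def inv_into_into f_inv_into_f)
  have "additive_on G (carrier G) (\<chi> i)" if i: "i < d" for i
    unfolding additive_on_def
  proof (intro ballI)
    fix x y assume "x \<in> carrier G" "y \<in> carrier G"
    then have "h (x \<otimes> y) = h x \<otimes>\<^bsub>?P\<^esub> h y" using h(1) by (simp add: hom_mult)
    then show "\<chi> i (x \<otimes> y) = \<chi> i x + \<chi> i y"
      using i by (simp add: \<chi>_def DirProd_def case_prod_beta)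
  qed
  then have "dual_system G (carrier G) d \<chi> e"
    using e by (auto simp: dual_system_def \<chi>_def \<delta>_def)
  moreover have "finite (null_part (carrier G) d \<chi>)"
  proof (rule finite_imageD)
    show "inj_on h (null_part (carrier G) d \<chi>)"
      using h(2) by (auto simp: bij_betw_def null_part_def inj_on_def)
    have "h ` null_part (carrier G) d \<chi> \<subseteq> {\<lambda>i\<in>{..<d}. 0} \<times> carrier T"
    proof
      fix z assume "z \<in> h ` null_part (carrier G) d \<chi>"
      then obtain x where x: "x \<in> carrier G" "\<forall>i<d. fst (h x) i = 0" "z = h x"
        by (auto simp: null_part_def \<chi>_def)
      have "h x \<in> ({..<d} \<rightarrow>\<^sub>E UNIV) \<times> carrier T"
        using surj x(1) by (auto simp: DirProd_def)
      then have "fst (h x) \<in> {..<d} \<rightarrow>\<^sub>E UNIV" "snd (h x) \<in> carrier T"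
        by (simp_all only: mem_Times_iff)
      moreover from this have "fst (h x) = (\<lambda>i\<in>{..<d}. 0)"
        using x(2) by (intro extensionalityI[of _ "{..<d}"]) (auto simp: PiE_def)
      ultimately show "z \<in> {\<lambda>i\<in>{..<d}. 0} \<times> carrier T"
        using x(3) by (simp add: mem_Times_iff)
    qed
    then show "finite (h ` null_part (carrier G) d \<chi>)"
      using T(2) finite_subset by blast
  qed
  ultimately show ?thesis by blast
qed

lemma abelian_rank_carrier:
  assumes sys: "dual_system G (carrier G) d \<chi> e" and fin: "finite (null_part (carrier G) d \<chi>)"
  shows "abelian_rank G = d"
  unfolding abelian_rank_def
proof (rule the_equality)
  show "\<exists>T :: 'a monoid. group T \<and> finite (carrier T) \<and>
      G \<cong> product_group {..<d} (\<lambda>_. integer_group) \<times>\<times> T"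
    using dual_system_imp_iso[OF sys] fin by (intro exI[of _
      "\<lparr>carrier = null_part (carrier G) d \<chi>, monoid.mult = monoid.mult G, one = \<one>\<rparr>"]) auto
  fix d' :: nat assume "\<exists>T :: 'a monoid. group T \<and> finite (carrier T) \<and>
      G \<cong> product_group {..<d'} (\<lambda>_. integer_group) \<times>\<times> T"
  then obtain \<chi>' e' where "dual_system G (carrier G) d' \<chi>' e'" "finite (null_part (carrier G) d' \<chi>')"
    using iso_imp_dual_system by blast
  then show "d' = d"
    using dual_system_dim_le[OF subgroup_self] sys fin by (meson order_antisym)
qed

end

lemma (in comm_group) abelian_rank_dual_system:
  assumes B: "subgroup B G" and sys: "dual_system G B d \<chi> e" and fin: "finite (null_part B d \<chi>)"
  shows "abelian_rank (G\<lparr>carrier := B\<rparr>) = d"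
proof -
  interpret B: comm_group "G\<lparr>carrier := B\<rparr>"
    by (rule group.group_comm_groupI[OF subgroup.subgroup_is_group[OF B is_group]])
      (use subgroup.mem_carrier[OF B] m_comm in simp)
  have "dual_system (G\<lparr>carrier := B\<rparr>) (carrier (G\<lparr>carrier := B\<rparr>)) d \<chi> e"
    using sys by (simp add: dual_system_def additive_on_def)
  then show ?thesis using B.abelian_rank_carrier fin by simp
qed

section \<open>Commutators and the lower central series\<close>

definition (in group) commutator :: "'a \<Rightarrow> 'a \<Rightarrow> 'a" where
  "commutator x y = x \<otimes> y \<otimes> inv x \<otimes> inv y"

definition (in group) conjugate :: "'a \<Rightarrow> 'a \<Rightarrow> 'a" where
  "conjugate p x = p \<otimes> x \<otimes> inv p"

context group begin

lemma inv_cancel_left [simp]: "x \<in> carrier G \<Longrightarrow> y \<in> carrier G \<Longrightarrow> inv x \<otimes> (x \<otimes> y) = y"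
  by (simp add: m_assoc[symmetric])

lemma inv_cancel_right [simp]: "x \<in> carrier G \<Longrightarrow> y \<in> carrier G \<Longrightarrow> x \<otimes> (inv x \<otimes> y) = y"
  by (simp add: m_assoc[symmetric])

lemma commutator_closed [simp, intro]: "x \<in> carrier G \<Longrightarrow> y \<in> carrier G \<Longrightarrow> commutator x y \<in> carrier G"
  by (simp add: commutator_def)

lemma conjugate_closed [simp, intro]: "x \<in> carrier G \<Longrightarrow> y \<in> carrier G \<Longrightarrow> conjugate x y \<in> carrier G"
  by (simp add: conjugate_def)

lemma commutator_mult_left:
  "x \<in> carrier G \<Longrightarrow> y \<in> carrier G \<Longrightarrow> z \<in> carrier G \<Longrightarrow> commutator (x \<otimes> y) z = conjugate x (commutator y z) \<otimes> commutator x z"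
  by (simp add: commutator_def conjugate_def m_assoc inv_mult_group)

lemma commutator_mult_right:
  "x \<in> carrier G \<Longrightarrow> y \<in> carrier G \<Longrightarrow> z \<in> carrier G \<Longrightarrow> commutator x (y \<otimes> z) = commutator x y \<otimes> conjugate y (commutator x z)"
  by (simp add: commutator_def conjugate_def m_assoc inv_mult_group)

lemma conjugate_eq_commutator: "p \<in> carrier G \<Longrightarrow> c \<in> carrier G \<Longrightarrow> conjugate p c = commutator p c \<otimes> c"
  by (simp add: commutator_def conjugate_def m_assoc)

lemma commutator_eq_conjugate: "p \<in> carrier G \<Longrightarrow> c \<in> carrier G \<Longrightarrow> commutator p c = conjugate p c \<otimes> inv c"
  by (simp add: commutator_def conjugate_def)

lemma commutator_eq_conjugate': "p \<in> carrier G \<Longrightarrow> c \<in> carrier G \<Longrightarrow> commutator p c = p \<otimes> conjugate c (inv p)"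
  by (simp add: commutator_def conjugate_def m_assoc)

lemma conjugate_mult_right:
  "p \<in> carrier G \<Longrightarrow> x \<in> carrier G \<Longrightarrow> y \<in> carrier G \<Longrightarrow> conjugate p (x \<otimes> y) = conjugate p x \<otimes> conjugate p y"
  by (simp add: conjugate_def m_assoc)

lemma conjugate_mult_left:
  "p \<in> carrier G \<Longrightarrow> q \<in> carrier G \<Longrightarrow> x \<in> carrier G \<Longrightarrow> conjugate (p \<otimes> q) x = conjugate p (conjugate q x)"
  by (simp add: conjugate_def m_assoc inv_mult_group)

lemma conjugate_inv: "p \<in> carrier G \<Longrightarrow> x \<in> carrier G \<Longrightarrow> conjugate p (inv x) = inv (conjugate p x)"
  by (simp add: conjugate_def m_assoc inv_mult_group)

lemma conjugate_one [simp]: "p \<in> carrier G \<Longrightarrow> conjugate p \<one> = \<one>" "x \<in> carrier G \<Longrightarrow> conjugate \<one> x = x"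
  by (simp_all add: conjugate_def)

lemma commutator_one [simp]: "x \<in> carrier G \<Longrightarrow> commutator x \<one> = \<one>" "x \<in> carrier G \<Longrightarrow> commutator \<one> x = \<one>"
  by (simp_all add: commutator_def)

lemma conjugate_conjugate_inv [simp]: "p \<in> carrier G \<Longrightarrow> x \<in> carrier G \<Longrightarrow> conjugate p (conjugate (inv p) x) = x"
  by (simp add: conjugate_def m_assoc)

lemma inv_commutator: "x \<in> carrier G \<Longrightarrow> y \<in> carrier G \<Longrightarrow> inv (commutator x y) = commutator y x"
  by (simp add: commutator_def m_assoc inv_mult_group)

lemma conjugate_commutator:
  "g \<in> carrier G \<Longrightarrow> x \<in> carrier G \<Longrightarrow> y \<in> carrier G \<Longrightarrow> conjugate g (commutator x y) = commutator (conjugate g x) (conjugate g y)"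
  by (simp add: commutator_def conjugate_def m_assoc inv_mult_group)

lemma commutator_eq_one_iff: "x \<in> carrier G \<Longrightarrow> y \<in> carrier G \<Longrightarrow> commutator x y = \<one> \<longleftrightarrow> x \<otimes> y = y \<otimes> x"
proof -
  assume x: "x \<in> carrier G" and y: "y \<in> carrier G"
  have "commutator x y = (x \<otimes> y) \<otimes> inv (y \<otimes> x)" using x y by (simp add: commutator_def m_assoc inv_mult_group)
  then show ?thesis using x y by (metis inv_closed inv_equality inv_inv m_closed r_inv)
qed

lemma conjugate_id_iff: "x \<in> carrier G \<Longrightarrow> y \<in> carrier G \<Longrightarrow> conjugate x y = y \<longleftrightarrow> x \<otimes> y = y \<otimes> x"
  by (metis conjugate_def inv_solve_right m_closed)

lemma normal_conjugate: "N \<lhd> G \<Longrightarrow> g \<in> carrier G \<Longrightarrow> n \<in> N \<Longrightarrow> conjugate g n \<in> N"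
  by (simp add: conjugate_def normal.inv_op_closed2)

lemma normal_commutator_left:
  assumes N: "N \<lhd> G" and x: "x \<in> N" and y: "y \<in> carrier G"
  shows "commutator x y \<in> N"
proof -
  have s: "subgroup N G" using N normal_imp_subgroup by blast
  have "commutator x y = x \<otimes> conjugate y (inv x)" using x y subgroup.mem_carrier[OF s] by (simp add: commutator_eq_conjugate')
  then show ?thesis
    using normal_conjugate[OF N y] x subgroup.m_closed[OF s] subgroup.m_inv_closed[OF s] by simp
qed

lemma normal_commutator_right:
  assumes N: "N \<lhd> G" and x: "x \<in> N" and y: "y \<in> carrier G"
  shows "commutator y x \<in> N"
proof -
  have s: "subgroup N G" using N normal_imp_subgroup by blast
  show ?thesis
    using subgroup.m_inv_closed[OF s normal_commutator_left[OF assms]] inv_commutator y x subgroup.mem_carrier[OF s] by simp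
qed

lemma commutator_generate_left:
  assumes N: "N \<lhd> G" and S: "S \<subseteq> carrier G" and y: "y \<in> carrier G"
    and gen: "\<And>x. x \<in> S \<Longrightarrow> commutator x y \<in> N" and u: "u \<in> generate G S"
  shows "commutator u y \<in> N"
  using u
proof induction
  have s: "subgroup N G" using N normal_imp_subgroup by blast
  case one
  then show ?case using subgroup.one_closed[OF s] y by simp
next
  case (incl h)
  then show ?case using gen by simp
next
  case (inv h)
  have s: "subgroup N G" using N normal_imp_subgroup by blast
  have h: "h \<in> carrier G" using inv S by blast
  have "\<one> = conjugate (inv h) (commutator h y) \<otimes> commutator (inv h) y"
    using commutator_mult_left[of "inv h" h y] h y by simp
  then have "commutator (inv h) y = inv (conjugate (inv h) (commutator h y))"
    using h y by (metis conjugate_closed commutator_closed inv_closed inv_equality inv_inv)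
  then show ?case using normal_conjugate[OF N, of "inv h"] gen[OF inv] h subgroup.m_inv_closed[OF s] by simp
next
  case (eng h1 h2)
  have s: "subgroup N G" using N normal_imp_subgroup by blast
  have "h1 \<in> carrier G" "h2 \<in> carrier G" using eng generate_in_carrier[OF S] by auto
  then show ?case
    using eng commutator_mult_left[of h1 h2 y] y normal_conjugate[OF N] subgroup.m_closed[OF s] by simp
qed

text \<open>
  Modulo a normal subgroup, the centralizer of a set is a subgroup; hence it is enough to test
  commutators on generators.
\<close>
lemma commutator_generate:
  assumes N: "N \<lhd> G" and S: "S \<subseteq> carrier G" and R: "R \<subseteq> carrier G"
    and gen: "\<And>x y. x \<in> S \<Longrightarrow> y \<in> R \<Longrightarrow> commutator x y \<in> N"
    and u: "u \<in> generate G S" and v: "v \<in> generate G R"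
  shows "commutator u v \<in> N"
proof -
  have s: "subgroup N G" using N normal_imp_subgroup by blast
  have flip: "commutator y x \<in> N" if "commutator x y \<in> N" "x \<in> carrier G" "y \<in> carrier G" for x y
    using subgroup.m_inv_closed[OF s that(1)] inv_commutator that by simp
  have uc: "u \<in> carrier G" using u generate_in_carrier[OF S] by blast
  have "commutator u y \<in> N" if "y \<in> R" for y
    using commutator_generate_left[OF N S _ gen u] that R by blast
  then have "commutator y u \<in> N" if "y \<in> R" for y
    using flip that R uc by blast
  then have "commutator v u \<in> N" using commutator_generate_left[OF N R uc _ v] by blast
  then show ?thesis using flip uc v generate_in_carrier[OF R] by blast
qed

text \<open>
  The case of the three subgroups lemma in which two of the commutators are trivial. Conjugation by
  \<open>x\<close> multiplies \<open>y\<close> by \<open>z\<close>; conjugation by \<open>g x g^{-1}\<close> has the same effect, because \<open>x\<close> commutes with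
  the factor \<open>w\<close> by which \<open>g^{-1}\<close> moves \<open>y\<close>. Hence the quotient of both, which is \<open>[g,x]\<close>, fixes \<open>y\<close>.
\<close>
lemma three_subgroups_elementwise:
  assumes c: "g \<in> carrier G" "x \<in> carrier G" "y \<in> carrier G"
  defines "z \<equiv> commutator x y" and "w \<equiv> commutator (inv g) y"
  assumes zg: "g \<otimes> z = z \<otimes> g" and zx: "x \<otimes> z = z \<otimes> x" and zy: "y \<otimes> z = z \<otimes> y"
    and xw: "x \<otimes> w = w \<otimes> x"
  shows "commutator (commutator g x) y = \<one>"
proof -
  have zc: "z \<in> carrier G" and wc: "w \<in> carrier G" using c by (auto simp: z_def w_def)
  have gz: "conjugate g z = z" and xz: "conjugate x z = z" and xw': "conjugate x w = w" and yz: "conjugate y z = z"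
    using zg zx zy xw c zc wc by (simp_all add: conjugate_id_iff)
  have xy: "conjugate x y = z \<otimes> y" using c by (simp add: z_def conjugate_eq_commutator)
  have gy: "conjugate (inv g) y = w \<otimes> y" using c by (simp add: w_def conjugate_eq_commutator)
  have z_inv: "conjugate u (inv z) = inv z" if "u \<in> carrier G" "conjugate u z = z" for u
    using that zc by (simp add: conjugate_inv)
  have ginvz: "conjugate (inv g) z = z" using gz c zc by (metis conjugate_conjugate_inv inv_closed inv_inv)
  \<comment> \<open>z commutes with w, which is a word in g and y\<close>
  have "conjugate z w = w"
  proof -
    have "z \<otimes> g = g \<otimes> z" "z \<otimes> y = y \<otimes> z" using zg zy by auto
    then have "conjugate z g = g" "conjugate z y = y" using c zc by (simp_all add: conjugate_id_iff)
    then show ?thesis using c zc by (simp add: w_def conjugate_commutator conjugate_inv)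
  qed
  then have zw: "z \<otimes> w = w \<otimes> z" using zc wc by (simp add: conjugate_id_iff)
  let ?x' = "conjugate g x"
  have "conjugate ?x' y = conjugate g (conjugate x (conjugate (inv g) y))"
    using c by (simp add: conjugate_def m_assoc inv_mult_group)
  also have "conjugate x (conjugate (inv g) y) = w \<otimes> (z \<otimes> y)"
    using c wc by (simp add: gy conjugate_mult_right xw' xy)
  also have "\<dots> = z \<otimes> conjugate (inv g) y"
    using c zc wc zw by (simp add: gy m_assoc[symmetric])
  also have "conjugate g \<dots> = z \<otimes> y"
    using c zc by (simp add: conjugate_mult_right gz)
  finally have x'y: "conjugate ?x' y = z \<otimes> y" .
  have "conjugate x (inv z \<otimes> y) = y"
    using c zc by (simp add: conjugate_mult_right z_inv xz xy)
  then have xinvy: "conjugate (inv x) y = inv z \<otimes> y"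
    using c zc by (metis conjugate_conjugate_inv inv_closed inv_inv m_closed)
  have x'z: "conjugate ?x' z = z"
  proof -
    have "conjugate ?x' z = conjugate g (conjugate x (conjugate (inv g) z))" using c zc by (simp add: conjugate_def m_assoc inv_mult_group)
    then show ?thesis by (simp add: ginvz xz gz)
  qed
  have "conjugate (commutator g x) y = conjugate ?x' (conjugate (inv x) y)"
    using c by (simp add: commutator_eq_conjugate conjugate_mult_left)
  also have "\<dots> = y"
    using c zc by (simp add: xinvy conjugate_mult_right z_inv x'z x'y)
  finally show ?thesis using c by (simp add: commutator_eq_conjugate[of "commutator g x" y])
qed

lemma three_subgroups_mod:
  assumes N: "N \<lhd> G" and c: "g \<in> carrier G" "x \<in> carrier G" "y \<in> carrier G"
    and z: "\<And>h. h \<in> carrier G \<Longrightarrow> commutator h (commutator x y) \<in> N"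
    and w: "commutator x (commutator (inv g) y) \<in> N"
  shows "commutator (commutator g x) y \<in> N"
proof -
  let ?Q = "G Mod N" and ?p = "\<lambda>x. N #> x"
  interpret N: normal N G by (rule N)
  interpret p: group_hom G ?Q ?p
    by (intro group_hom.intro group_hom_axioms.intro is_group N.factorgroup_is_group N.r_coset_hom_Mod)
  have one: "?p u = \<one>\<^bsub>?Q\<^esub> \<longleftrightarrow> u \<in> N" if "u \<in> carrier G" for u
    using rcos_self[OF that N.is_subgroup] coset_join2[OF that N.is_subgroup] by auto
  have commutator: "?p (commutator u v) = p.H.commutator (?p u) (?p v)" if "u \<in> carrier G" "v \<in> carrier G" for u v
    using that by (simp only: commutator_def p.H.commutator_def p.hom_mult p.hom_inv m_closed inv_closed)
  have iff: "?p u \<otimes>\<^bsub>?Q\<^esub> ?p v = ?p v \<otimes>\<^bsub>?Q\<^esub> ?p u \<longleftrightarrow> commutator u v \<in> N"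
    if "u \<in> carrier G" "v \<in> carrier G" for u v
  proof -
    have "?p u \<in> carrier ?Q" "?p v \<in> carrier ?Q" using that p.hom_closed by blast+
    from p.H.commutator_eq_one_iff[OF this] show ?thesis
      using one[OF commutator_closed[OF that]] commutator[OF that] by simp
  qed
  have xy: "p.H.commutator (?p x) (?p y) = ?p (commutator x y)" using commutator[OF c(2,3)] ..
  have gy: "p.H.commutator (inv\<^bsub>?Q\<^esub> ?p g) (?p y) = ?p (commutator (inv g) y)"
    using commutator[of "inv g" y] c p.hom_inv[OF c(1)] by simp
  have "p.H.commutator (p.H.commutator (?p g) (?p x)) (?p y) = \<one>\<^bsub>?Q\<^esub>"
  proof (rule p.H.three_subgroups_elementwise; (unfold xy gy)?)
    show "?p g \<in> carrier ?Q" "?p x \<in> carrier ?Q" "?p y \<in> carrier ?Q" using c p.hom_closed by blast+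
    show "?p g \<otimes>\<^bsub>?Q\<^esub> ?p (commutator x y) = ?p (commutator x y) \<otimes>\<^bsub>?Q\<^esub> ?p g"
      "?p x \<otimes>\<^bsub>?Q\<^esub> ?p (commutator x y) = ?p (commutator x y) \<otimes>\<^bsub>?Q\<^esub> ?p x"
      "?p y \<otimes>\<^bsub>?Q\<^esub> ?p (commutator x y) = ?p (commutator x y) \<otimes>\<^bsub>?Q\<^esub> ?p y"
      by (rule iff[THEN iffD2]; use c z in blast)+
    show "?p x \<otimes>\<^bsub>?Q\<^esub> ?p (commutator (inv g) y) = ?p (commutator (inv g) y) \<otimes>\<^bsub>?Q\<^esub> ?p x"
      by (rule iff[THEN iffD2]) (use c w in auto)
  qed
  then have "?p (commutator (commutator g x) y) = \<one>\<^bsub>?Q\<^esub>"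
    using commutator[of "commutator g x" y] commutator[OF c(1,2)] c by simp
  then show ?thesis using one[of "commutator (commutator g x) y"] c by blast
qed

lemma lower_central_Suc:
  assumes "j \<ge> 1"
  shows "lower_central G (Suc j) = generate G {commutator a b | a b. a \<in> carrier G \<and> b \<in> lower_central G j}"
  using assms by (cases j) (simp_all add: commutator_subgroup_def commutator_def)

lemma lower_central_normal: "lower_central G j \<lhd> G"
proof (induction j)
  case 0
  then show ?case by (simp add: normal_inv_iff subgroup_self)
next
  case (Suc j)
  show ?case
  proof (cases "j \<ge> 1")
    case True
    have sub: "lower_central G j \<subseteq> carrier G"
      using Suc normal_imp_subgroup subgroup.subset by blast
    show ?thesis unfolding lower_central_Suc[OF True]
    proof (rule normal_generateI)
      show "{commutator a b | a b. a \<in> carrier G \<and> b \<in> lower_central G j} \<subseteq> carrier G" using sub by auto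
      fix h g assume "h \<in> {commutator a b | a b. a \<in> carrier G \<and> b \<in> lower_central G j}" and g: "g \<in> carrier G"
      then obtain a b where h: "h = commutator a b" "a \<in> carrier G" "b \<in> lower_central G j" by blast
      then have "conjugate g h = commutator (conjugate g a) (conjugate g b)" using sub g conjugate_commutator by blast
      moreover have "conjugate g b \<in> lower_central G j" using normal_conjugate[OF Suc g h(3)] .
      ultimately have "conjugate g h \<in> {commutator a b | a b. a \<in> carrier G \<and> b \<in> lower_central G j}"
        using h(2) g by blast
      then show "g \<otimes> h \<otimes> inv g \<in> {commutator a b | a b. a \<in> carrier G \<and> b \<in> lower_central G j}"
        by (simp only: conjugate_def)
    qed
  next
    case False
    then have "j = 0" by simp
    then show ?thesis by (simp add: normal_inv_iff subgroup_self)
  qed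
qed

lemma lower_central_subgroup: "subgroup (lower_central G j) G"
  by (rule normal_imp_subgroup[OF lower_central_normal])

lemma lower_central_carrier: "x \<in> lower_central G j \<Longrightarrow> x \<in> carrier G"
  by (rule subgroup.mem_carrier[OF lower_central_subgroup])

lemma commutator_lower_central_Suc:
  "j \<ge> 1 \<Longrightarrow> x \<in> carrier G \<Longrightarrow> y \<in> lower_central G j \<Longrightarrow> commutator x y \<in> lower_central G (Suc j)"
  using generate.incl[of "commutator x y" "{commutator a b | a b. a \<in> carrier G \<and> b \<in> lower_central G j}" G]
  by (simp only: lower_central_Suc) blast

lemma lower_central_Suc_subset: "lower_central G (Suc j) \<subseteq> lower_central G j"
proof (cases "j \<ge> 1")
  case True
  have "{commutator a b | a b. a \<in> carrier G \<and> b \<in> lower_central G j} \<subseteq> lower_central G j"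
  proof clarify
    fix a b assume "a \<in> carrier G" "b \<in> lower_central G j"
    then show "commutator a b \<in> lower_central G j" by (intro normal_commutator_right[OF lower_central_normal])
  qed
  then show ?thesis
    unfolding lower_central_Suc[OF True] by (rule generate_subgroup_incl[OF _ lower_central_subgroup])
next
  case False
  then have "j = 0" by simp
  then show ?thesis by simp
qed

lemma lower_central_antimono: "i \<le> j \<Longrightarrow> lower_central G j \<subseteq> lower_central G i"
  by (rule lift_Suc_antimono_le[of "lower_central G", OF lower_central_Suc_subset])

text \<open>
  \<open>[G\<^sub>i, G\<^sub>j] \<subseteq> G\<^bsub>i+j\<^esub>\<close>, by induction on \<open>i\<close> and the three subgroups lemma modulo \<open>G\<^bsub>i+j+1\<^esub>\<close>.
\<close>
lemma commutator_lower_central: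
  assumes "i \<ge> 1" "j \<ge> 1" "x \<in> lower_central G i" "y \<in> lower_central G j"
  shows "commutator x y \<in> lower_central G (i + j)"
  using assms
proof (induction i arbitrary: j x y rule: dec_induct)
  case base
  then show ?case using commutator_lower_central_Suc[OF base(1) _ base(3)] lower_central_carrier[OF base(2)] by simp
next
  case (step i)
  let ?S = "{commutator a b | a b. a \<in> carrier G \<and> b \<in> lower_central G i}"
  let ?N = "lower_central G (Suc i + j)"
  have y: "y \<in> carrier G" using lower_central_carrier[OF step.prems(3)] .
  have x: "x \<in> generate G ?S" using step.prems(2) unfolding lower_central_Suc[OF step.hyps(1)] .
  show ?case
  proof (rule commutator_generate_left[OF lower_central_normal _ y _ x])
    show "?S \<subseteq> carrier G" using lower_central_carrier[of _ i] by auto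
    fix u assume "u \<in> ?S"
    then obtain g a where u: "u = commutator g a" "g \<in> carrier G" "a \<in> lower_central G i" by blast
    show "commutator u y \<in> ?N" unfolding u(1)
    proof (rule three_subgroups_mod[OF lower_central_normal u(2) _ y])
      show "a \<in> carrier G" using lower_central_carrier[OF u(3)] .
      have "commutator a y \<in> lower_central G (i + j)" using step.IH[OF step.prems(1) u(3) step.prems(3)] .
      then show "commutator h (commutator a y) \<in> ?N" if "h \<in> carrier G" for h
        using commutator_lower_central_Suc[of "i + j" h] that step.hyps by simp
      have "commutator (inv g) y \<in> lower_central G (Suc j)"
        using commutator_lower_central_Suc[OF step.prems(1) _ step.prems(3)] u(2) by blast
      then show "commutator a (commutator (inv g) y) \<in> ?N" using step.IH[of "Suc j" a] u(3) by simp
    qed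
  qed
qed

end

section \<open>Letters and words with weights\<close>

definition wcount :: "nat \<Rightarrow> (nat \<times> 'a) list \<Rightarrow> nat" where
  "wcount k w = length (filter (\<lambda>p. fst p = k) w)"

lemma wcount_simps [simp]:
  "wcount k [] = 0"
  "wcount k (p # w) = (if fst p = k then 1 else 0) + wcount k w"
  "wcount k (v @ w) = wcount k v + wcount k w"
  by (simp_all add: wcount_def)

lemma wcount_mset: "mset v = mset w \<Longrightarrow> wcount k v = wcount k w"
proof -
  assume "mset v = mset w"
  then have "mset (filter (\<lambda>p. fst p = k) v) = mset (filter (\<lambda>p. fst p = k) w)" by (simp only: mset_filter)
  from mset_eq_length[OF this] show ?thesis by (simp only: wcount_def)
qed

text \<open>
  The trivial group has class 0, but a larger \<open>m\<close> does no harm, and \<open>m \<ge> 1\<close> ensures that the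
  generators are letters of weight at most \<open>m\<close>.
\<close>
locale fg_nilpotent = group G for G (structure) +
  fixes F :: "'a set" and m :: nat
  assumes F_finite: "finite F" and F_carrier: "F \<subseteq> carrier G" and F_gen: "generate G F = carrier G"
    and m_pos: "m \<ge> 1" and lower_central_trivial: "lower_central G (Suc m) = {\<one>}"

text \<open>
  All bracketings are admitted, not just the left-normed ones, so that commutators of letters are
  letters again. The weight is part of the letter because the same group element may arise with
  several weights. Closure under inverses is built in at weight 1 and propagates, as the inverse of
  \<open>[x,y]\<close> is \<open>[y,x]\<close>.
\<close>
inductive_set (in fg_nilpotent) letters :: "(nat \<times> 'a) set" where
  gen: "x \<in> F \<Longrightarrow> (1, x) \<in> letters"
| gen_inv: "x \<in> F \<Longrightarrow> (1, inv x) \<in> letters"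
| bracket: "(i, x) \<in> letters \<Longrightarrow> (k, y) \<in> letters \<Longrightarrow> (i + k, commutator x y) \<in> letters"

context fg_nilpotent begin

abbreviation lcs :: "nat \<Rightarrow> 'a set" where "lcs j \<equiv> lower_central G j"

lemma lcs_trivial: "k > m \<Longrightarrow> lcs k = {\<one>}"
proof -
  assume "k > m"
  from lower_central_antimono[OF Suc_leI[OF this]]
  have "lcs k \<subseteq> {\<one>}" unfolding lower_central_trivial .
  then show ?thesis using subgroup.one_closed[OF lower_central_subgroup[of k]] by blast
qed

lemma letters_lcs: "(k, x) \<in> letters \<Longrightarrow> k \<ge> 1 \<and> x \<in> lcs k"
proof (induction rule: letters.induct)
  case (bracket i x k y)
  then show ?case using commutator_lower_central[of i k x y] by simp
qed (use F_carrier in auto)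

lemma letters_carrier: "(k, x) \<in> letters \<Longrightarrow> x \<in> carrier G"
  by (rule lower_central_carrier[OF letters_lcs[THEN conjunct2]])

lemma letters_inv: "(k, x) \<in> letters \<Longrightarrow> (k, inv x) \<in> letters"
proof (induction rule: letters.induct)
  case (bracket i x k y)
  have "(k + i, commutator y x) \<in> letters" using letters.bracket[OF bracket.hyps(2,1)] .
  moreover have "inv (commutator x y) = commutator y x" 
    by (rule inv_commutator[OF letters_carrier[OF bracket.hyps(1)] letters_carrier[OF bracket.hyps(2)]])
  ultimately show ?case by (simp add: add.commute)
next
  case (gen_inv x)
  then have "inv (inv x) = x" using F_carrier by (intro inv_inv) auto
  then show ?case using letters.gen[OF gen_inv] by simp
qed (rule letters.gen_inv)

lemma finite_letters: "finite {x. (k, x) \<in> letters}"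
proof (induction k rule: less_induct)
  case (less k)
  let ?S = "F \<union> (\<lambda>x. inv x) ` F \<union>
    (\<Union>i\<in>{..<k}. \<Union>l\<in>{..<k}. (\<lambda>(x, y). commutator x y) ` ({x. (i, x) \<in> letters} \<times> {x. (l, x) \<in> letters}))"
  have "{x. (k, x) \<in> letters} \<subseteq> ?S"
  proof (rule subsetI)
    fix z assume "z \<in> {x. (k, x) \<in> letters}"
    then have "(k, z) \<in> letters" by simp
    then show "z \<in> ?S"
    proof cases
      case (bracket i x l y)
      moreover have "i < k" "l < k" using bracket letters_lcs[of i x] letters_lcs[of l y] by auto
      ultimately show ?thesis by blast
    qed auto
  qed
  moreover have "finite ?S" using less F_finite by auto
  ultimately show ?case by (rule finite_subset)
qed

definition tail_letters :: "nat \<Rightarrow> 'a set" where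
  "tail_letters k = {x. \<exists>i\<ge>k. (i, x) \<in> letters}"

lemma tail_letters_carrier: "tail_letters k \<subseteq> carrier G"
  unfolding tail_letters_def using letters_carrier by blast

text \<open>
  Conjugating a letter \<open>l\<close> by a generator \<open>f\<close> gives \<open>[f,l] l\<close>, a product of two letters whose
  weights are at least that of \<open>l\<close>.
\<close>
lemma tail_letters_normal: "generate G (tail_letters k) \<lhd> G"
proof -
  let ?N = "generate G (tail_letters k)"
  have N: "subgroup ?N G" using generate_is_subgroup[OF tail_letters_carrier] .
  have base: "conjugate f h \<in> ?N" if f: "(1, f) \<in> letters" and h: "h \<in> ?N" for f h
  proof -
    have fc: "f \<in> carrier G" using f letters_carrier by blast
    have l: "conjugate f l \<in> ?N" if l: "l \<in> tail_letters k" for l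
    proof -
      obtain i where i: "i \<ge> k" "(i, l) \<in> letters" using l by (auto simp: tail_letters_def)
      have "(1 + i, commutator f l) \<in> letters" using letters.bracket[OF f i(2)] .
      moreover have "k \<le> 1 + i" using i(1) by simp
      ultimately have "commutator f l \<in> tail_letters k" unfolding tail_letters_def by blast
      then have "commutator f l \<otimes> l \<in> ?N" using l by (intro generate.eng generate.incl)
      then show ?thesis using fc letters_carrier[OF i(2)] by (simp add: conjugate_eq_commutator)
    qed
    show ?thesis using h
    proof induction
      case one
      then show ?case using fc subgroup.one_closed[OF N] by simp
    next
      case (incl h)
      then show ?case using l by blast
    next
      case (inv h)
      then have "conjugate f (inv h) = inv (conjugate f h)" using fc tail_letters_carrier conjugate_inv by blast
      then show ?case using l[OF inv] subgroup.m_inv_closed[OF N] by simp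
    next
      case (eng h1 h2)
      then have "conjugate f (h1 \<otimes> h2) = conjugate f h1 \<otimes> conjugate f h2"
        using fc generate_in_carrier[OF tail_letters_carrier] conjugate_mult_right by blast
      then show ?case using eng subgroup.m_closed[OF N] by simp
    qed
  qed
  have "conjugate g h \<in> ?N" if g: "g \<in> generate G F" and h: "h \<in> ?N" for g h
    using g h
  proof (induction arbitrary: h)
    case one
    then show ?case using generate_in_carrier[OF tail_letters_carrier] by simp
  next
    case (incl f)
    then show ?case using base letters.gen by blast
  next
    case (inv f)
    then show ?case using base letters.gen_inv by blast
  next
    case (eng g1 g2)
    have "g1 \<in> carrier G" "g2 \<in> carrier G" using eng.hyps generate_in_carrier[OF F_carrier] by auto
    moreover have "h \<in> carrier G" using generate_in_carrier[OF tail_letters_carrier eng.prems] .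
    ultimately have "conjugate (g1 \<otimes> g2) h = conjugate g1 (conjugate g2 h)" by (rule conjugate_mult_left)
    then show ?case using eng.IH(1)[OF eng.IH(2)[OF eng.prems]] by simp
  qed
  then have "\<forall>g\<in>carrier G. \<forall>h\<in>?N. g \<otimes> h \<otimes> inv g \<in> ?N" unfolding F_gen conjugate_def by blast
  then show ?thesis using N normal_inv_iff by blast
qed

text \<open>
  Since the right-hand side is normal, the commutators of \<open>G\<close> with \<open>G\<^sub>k\<close> need to be tested only on a
  generator and a letter, where they are letters of weight at least \<open>k + 1\<close>.
\<close>
lemma lcs_generated: "k \<ge> 1 \<Longrightarrow> lcs k \<subseteq> generate G (tail_letters k)"
proof (induction k rule: dec_induct)
  case base
  have "F \<subseteq> tail_letters 1" using letters.gen by (auto simp: tail_letters_def)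
  then have "generate G F \<subseteq> generate G (tail_letters 1)" by (rule mono_generate)
  then show ?case using F_gen by simp
next
  case (step k)
  have sub: "{commutator a b | a b. a \<in> carrier G \<and> b \<in> lcs k} \<subseteq> generate G (tail_letters (Suc k))"
  proof clarify
    fix a b assume a: "a \<in> carrier G" and b: "b \<in> lcs k"
    show "commutator a b \<in> generate G (tail_letters (Suc k))"
    proof (rule commutator_generate[OF tail_letters_normal F_carrier tail_letters_carrier])
      show "a \<in> generate G F" using a F_gen by simp
      show "b \<in> generate G (tail_letters k)" using b step.IH by blast
      fix x y assume x: "x \<in> F" and "y \<in> tail_letters k"
      then obtain i where i: "i \<ge> k" "(i, y) \<in> letters" by (auto simp: tail_letters_def)
      then have "(1 + i, commutator x y) \<in> letters" using letters.bracket[OF letters.gen[OF x] i(2)] by simp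
      moreover have "Suc k \<le> 1 + i" using i(1) by simp
      ultimately have "commutator x y \<in> tail_letters (Suc k)" unfolding tail_letters_def by blast
      then show "commutator x y \<in> generate G (tail_letters (Suc k))" by (rule generate.incl)
    qed
  qed
  show ?case
    unfolding lower_central_Suc[OF step.hyps(1)]
    by (rule generate_subgroup_incl[OF sub generate_is_subgroup[OF tail_letters_carrier]])
qed

text \<open>
  Letters of weight above \<open>m\<close> are trivial. Leaving them out makes the number of weights in a word
  bounded, which keeps the constants in the estimates below finite.
\<close>
definition wletters :: "(nat \<times> 'a) set" where
  "wletters = {(k, x). (k, x) \<in> letters \<and> k \<le> m}"

definition wprod :: "(nat \<times> 'a) list \<Rightarrow> 'a" where
  "wprod w = foldr (\<lambda>p z. snd p \<otimes> z) w \<one>"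

lemma wprod_simps [simp]: "wprod [] = \<one>" "wprod (p # w) = snd p \<otimes> wprod w"
  by (simp_all add: wprod_def)

lemma wletters_carrier: "p \<in> wletters \<Longrightarrow> snd p \<in> carrier G"
  using letters_carrier[of "fst p" "snd p"] by (cases p) (simp add: wletters_def)

lemma wletters_weight: "p \<in> wletters \<Longrightarrow> 1 \<le> fst p \<and> fst p \<le> m"
  using letters_lcs[of "fst p" "snd p"] by (cases p) (simp add: wletters_def)

lemma wprod_closed [simp]: "set w \<subseteq> wletters \<Longrightarrow> wprod w \<in> carrier G"
  by (induction w) (auto simp: wletters_carrier)

lemma wprod_append [simp]:
  "set v \<subseteq> wletters \<Longrightarrow> set w \<subseteq> wletters \<Longrightarrow> wprod (v @ w) = wprod v \<otimes> wprod w"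
  by (induction v) (auto simp: m_assoc wletters_carrier)

definition inv_word :: "(nat \<times> 'a) list \<Rightarrow> (nat \<times> 'a) list" where
  "inv_word w = rev (map (\<lambda>p. (fst p, inv (snd p))) w)"

lemma inv_word:
  assumes "set w \<subseteq> wletters"
  shows "set (inv_word w) \<subseteq> wletters \<and> wprod (inv_word w) = inv (wprod w) \<and> (\<forall>k. wcount k (inv_word w) = wcount k w)"
  using assms
proof (induction w)
  case (Cons p w)
  have "(fst p, inv (snd p)) \<in> wletters" using Cons.prems letters_inv by (auto simp: wletters_def)
  moreover have "snd p \<in> carrier G" using Cons.prems wletters_carrier by auto
  moreover have "inv_word (p # w) = inv_word w @ [(fst p, inv (snd p))]" by (simp add: inv_word_def)
  ultimately show ?case using Cons by (simp add: inv_mult_group)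
qed (simp add: inv_word_def)

lemma lcs_word:
  assumes "k \<ge> 1" "g \<in> lcs k"
  shows "\<exists>w. set w \<subseteq> wletters \<and> (\<forall>p\<in>set w. k \<le> fst p) \<and> wprod w = g"
proof -
  have "g \<in> generate G (tail_letters k)" using assms lcs_generated by blast
  then show ?thesis
  proof induction
    case one
    then show ?case by (intro exI[of _ "[]"]) simp
  next
    case (incl h)
    then obtain i where i: "i \<ge> k" "(i, h) \<in> letters" by (auto simp: tail_letters_def)
    show ?case
    proof (cases "i \<le> m")
      case True
      then show ?thesis using i letters_carrier[OF i(2)]
        by (intro exI[of _ "[(i, h)]"]) (simp add: wletters_def)
    next
      case False
      then have "h = \<one>" using letters_lcs[OF i(2)] lcs_trivial[of i] by simp
      then show ?thesis by (intro exI[of _ "[]"]) simp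
    qed
  next
    case (inv h)
    then obtain i where i: "i \<ge> k" "(i, h) \<in> letters" by (auto simp: tail_letters_def)
    show ?case
    proof (cases "i \<le> m")
      case True
      then show ?thesis using i letters_carrier[OF i(2)] letters_inv[OF i(2)]
        by (intro exI[of _ "[(i, inv h)]"]) (simp add: wletters_def)
    next
      case False
      then have "h = \<one>" using letters_lcs[OF i(2)] lcs_trivial[of i] by simp
      then show ?thesis by (intro exI[of _ "[]"]) simp
    qed
  next
    case (eng h1 h2)
    then obtain v w where "set v \<subseteq> wletters" "\<forall>p\<in>set v. k \<le> fst p" "wprod v = h1"
      "set w \<subseteq> wletters" "\<forall>p\<in>set w. k \<le> fst p" "wprod w = h2" by blast
    then show ?case by (intro exI[of _ "v @ w"]) auto
  qed
qed

text \<open>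
  The elements that have a word in which at most \<open>f k\<close> letters of weight \<open>k\<close> occur, for every \<open>k\<close>.
  These bounds simply add up under multiplication.
\<close>
definition counted :: "(nat \<Rightarrow> nat) \<Rightarrow> 'a set" where
  "counted f = {wprod w | w. set w \<subseteq> wletters \<and> (\<forall>k. wcount k w \<le> f k)}"

lemma counted_carrier: "g \<in> counted f \<Longrightarrow> g \<in> carrier G"
  by (auto simp: counted_def)

lemma countedI: "set w \<subseteq> wletters \<Longrightarrow> (\<And>k. wcount k w \<le> f k) \<Longrightarrow> wprod w \<in> counted f"
  by (auto simp: counted_def)

lemma counted_mono: "g \<in> counted f \<Longrightarrow> (\<And>k. f k \<le> f' k) \<Longrightarrow> g \<in> counted f'"
  unfolding counted_def by (blast intro: order_trans)

lemma counted_one: "\<one> \<in> counted f"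
  using countedI[of "[]"] by simp

lemma counted_mult:
  assumes "g \<in> counted f" "h \<in> counted f'"
  shows "g \<otimes> h \<in> counted (\<lambda>k. f k + f' k)"
proof -
  obtain v w where "set v \<subseteq> wletters" "\<And>k. wcount k v \<le> f k" "wprod v = g"
    "set w \<subseteq> wletters" "\<And>k. wcount k w \<le> f' k" "wprod w = h"
    using assms by (auto simp: counted_def)
  then show ?thesis using countedI[of "v @ w" "\<lambda>k. f k + f' k"] by (simp add: add_mono)
qed

lemma counted_inv: "g \<in> counted f \<Longrightarrow> inv g \<in> counted f"
proof -
  assume "g \<in> counted f"
  then obtain w where w: "set w \<subseteq> wletters" "\<And>k. wcount k w \<le> f k" "wprod w = g" by (auto simp: counted_def)
  then show ?thesis using inv_word[OF w(1)] countedI[of "inv_word w" f] by simp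
qed

lemma wcount_outside: "set w \<subseteq> wletters \<Longrightarrow> k = 0 \<or> k > m \<Longrightarrow> wcount k w = 0"
  using wletters_weight unfolding wcount_def filter_empty_conv length_0_conv
  by (metis not_less subset_iff less_one)

lemma word_weight_ge:
  assumes "\<And>k. wcount k w \<le> (if j \<le> k then f k else 0)" "p \<in> set w"
  shows "j \<le> fst p"
proof (rule ccontr)
  assume "\<not> j \<le> fst p"
  then have "wcount (fst p) w = 0" using assms(1)[of "fst p"] by simp
  then have "filter (\<lambda>q. fst q = fst p) w = []" by (simp only: wcount_def length_0_conv)
  then show False using assms(2) unfolding filter_empty_conv by blast
qed

lemma wletters_lcs: "p \<in> wletters \<Longrightarrow> snd p \<in> lcs (fst p)"
  using letters_lcs[of "fst p" "snd p"] by (cases p) (simp add: wletters_def)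

lemma wprod_lcs:
  assumes "set v \<subseteq> wletters" "\<And>p. p \<in> set v \<Longrightarrow> j \<le> fst p"
  shows "wprod v \<in> lcs j"
  using assms
proof (induction v)
  case Nil
  then show ?case using subgroup.one_closed[OF lower_central_subgroup[of j]] by simp
next
  case (Cons p w)
  have "snd p \<in> lcs (fst p)" using Cons.prems(1) wletters_lcs by simp
  then have "snd p \<in> lcs j" using lower_central_antimono[of j "fst p"] Cons.prems(2)[of p] by auto
  then show ?case using Cons subgroup.m_closed[OF lower_central_subgroup[of j]] by simp
qed

lemma counted_lcs:
  assumes "g \<in> counted f" "\<And>k. k < j \<Longrightarrow> f k = 0"
  shows "g \<in> lcs j"
proof -
  obtain w where w: "set w \<subseteq> wletters" "\<And>k. wcount k w \<le> f k" "wprod w = g"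
    using assms(1) by (auto simp: counted_def)
  have "wcount k w \<le> (if j \<le> k then f k else 0)" for k
    using w(2)[of k] assms(2)[of k] by (cases "j \<le> k") auto
  from wprod_lcs[OF w(1) word_weight_ge[OF this]] show ?thesis using w(3) by simp
qed

end

lemma sum_list_wcount:
  fixes h :: "nat \<Rightarrow> nat"
  assumes "\<And>p. p \<in> set w \<Longrightarrow> fst p \<le> m"
  shows "(\<Sum>p\<leftarrow>w. h (fst p)) = (\<Sum>k\<le>m. wcount k w * h k)"
  using assms
proof (induction w)
  case (Cons p w)
  have "(\<Sum>k\<le>m. wcount k (p # w) * h k) = (\<Sum>k\<le>m. (if fst p = k then h k else 0) + wcount k w * h k)"
    by (intro sum.cong) (auto simp: algebra_simps)
  also have "\<dots> = h (fst p) + (\<Sum>k\<le>m. wcount k w * h k)"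
    using Cons.prems[of p] by (simp add: sum.distrib)
  finally show ?case using Cons by simp
qed simp

section \<open>Minimal elements among multisets\<close>

text \<open>
  Dickson's lemma: a sequence of natural numbers has a monotone subsequence, and a decreasing one is
  eventually constant; this is applied to one coordinate after the other.
\<close>
lemma count_monotone_subsequence:
  fixes f :: "nat \<Rightarrow> 'x multiset"
  assumes "finite S"
  shows "\<exists>r::nat \<Rightarrow> nat. strict_mono r \<and> (\<forall>x\<in>S. mono (\<lambda>i. count (f (r i)) x))"
  using assms
proof (induction S rule: finite_induct)
  case empty
  then show ?case by (intro exI[of _ id]) (simp add: strict_mono_def)
next
  case (insert x S)
  then obtain r :: "nat \<Rightarrow> nat" where r: "strict_mono r" "\<forall>x\<in>S. mono (\<lambda>i. count (f (r i)) x)" by blast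
  define s where "s = (\<lambda>i. count (f (r i)) x)"
  obtain g :: "nat \<Rightarrow> nat" where g: "strict_mono g" "monoseq (\<lambda>n. s (g n))" using seq_monosub by blast
  have "\<exists>g'. strict_mono g' \<and> mono (\<lambda>n::nat. s (g' n))"
  proof (cases "\<forall>i k. i \<le> k \<longrightarrow> s (g i) \<le> s (g k)")
    case True
    then show ?thesis using g(1) by (intro exI[of _ g]) (simp add: mono_def)
  next
    case False
    then have dec: "s (g k) \<le> s (g i)" if "i \<le> k" for i k using g(2) that unfolding monoseq_def by blast
    define v where "v = (LEAST v. \<exists>i. s (g i) = v)"
    have "\<exists>i. s (g i) = v" unfolding v_def by (rule LeastI) blast
    then obtain N where N: "s (g N) = v" by blast
    have "v \<le> s (g i)" for i unfolding v_def by (rule Least_le) blast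
    then have "s (g (N + i)) = v" for i using dec[of N "N + i"] N by (simp add: order_antisym)
    moreover have "strict_mono (\<lambda>i. g (N + i))" using g(1) by (simp add: strict_mono_def)
    ultimately show ?thesis by (intro exI[of _ "\<lambda>i. g (N + i)"]) (simp add: mono_def)
  qed
  then obtain g' where g': "strict_mono g'" "mono (\<lambda>n::nat. s (g' n))" by blast
  have "mono (\<lambda>i. count (f (r (g' i))) y)" if "y \<in> S" for y
    using r(2) that g'(1) unfolding mono_def strict_mono_def by (meson g'(1) strict_mono_less_eq)
  then show ?case
    using g' r(1) by (intro exI[of _ "r \<circ> g'"]) (auto simp: s_def strict_mono_def)
qed

lemma finite_multiset_antichain:
  assumes "finite S" "\<And>M. M \<in> R \<Longrightarrow> set_mset M \<subseteq> S"
    and anti: "\<And>M N. M \<in> R \<Longrightarrow> N \<in> R \<Longrightarrow> M \<subseteq># N \<Longrightarrow> M = N"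
  shows "finite R"
proof (rule ccontr)
  assume "infinite R"
  then obtain f :: "nat \<Rightarrow> 'a multiset" where f: "inj f" "range f \<subseteq> R"
    using infinite_countable_subset by blast
  obtain r :: "nat \<Rightarrow> nat" where r: "strict_mono r" "\<forall>x\<in>S. mono (\<lambda>i. count (f (r i)) x)"
    using count_monotone_subsequence[OF assms(1)] by blast
  have R: "f (r i) \<in> R" for i using f(2) by auto
  have "count (f (r 0)) x \<le> count (f (r 1)) x" for x
  proof (cases "x \<in> S")
    case True
    then show ?thesis using r(2) by (simp add: mono_def)
  next
    case False
    then have "x \<notin> set_mset (f (r 0))" using assms(2)[OF R[of 0]] by blast
    then show ?thesis by (simp add: not_in_iff)
  qed
  then have "f (r 0) \<subseteq># f (r 1)" by (simp add: subseteq_mset_def)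
  then have "r 0 = r 1" using anti[OF R R] f(1) by (simp add: inj_eq)
  moreover have "r 0 < r 1" using r(1) by (simp add: strict_mono_def)
  ultimately show False by simp
qed

lemma multiset_minimal_decomposition:
  fixes Z :: "'a multiset set"
  defines "R \<equiv> {M \<in> Z. M \<noteq> {#} \<and> (\<forall>N\<in>Z. N \<subseteq># M \<longrightarrow> N = {#} \<or> N = M)}"
  assumes diff: "\<And>M N. M \<in> Z \<Longrightarrow> N \<in> Z \<Longrightarrow> N \<subseteq># M \<Longrightarrow> M - N \<in> Z"
    and M: "M \<in> Z"
  shows "\<exists>Ms. set Ms \<subseteq> R \<and> sum_list Ms = M \<and> length Ms \<le> size M"
  using M
proof (induction "size M" arbitrary: M rule: less_induct)
  case less
  consider "M = {#}" | "M \<in> R" | N where "N \<in> Z" "N \<subseteq># M" "N \<noteq> {#}" "N \<noteq> M"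
    using less.prems unfolding R_def by blast
  then show ?case
  proof cases
    case 1
    then show ?thesis by (intro exI[of _ "[]"]) simp
  next
    case 2
    then have "1 \<le> size M" unfolding R_def by (simp add: Suc_le_eq nonempty_has_size[symmetric])
    then show ?thesis using 2 by (intro exI[of _ "[M]"]) simp
  next
    case 3
    have MN: "N + (M - N) = M" using 3(2) by simp
    then have sz: "size N + size (M - N) = size M" by (metis size_union)
    have "M - N \<noteq> {#}" using 3(4) MN by (metis add.right_neutral)
    then have "size (M - N) > 0" "size N > 0" using 3(3) by (simp_all add: nonempty_has_size[symmetric])
    then have lt: "size N < size M" "size (M - N) < size M" using sz by linarith+
    obtain Ns where Ns: "set Ns \<subseteq> R" "sum_list Ns = N" "length Ns \<le> size N"
      using less.hyps[OF lt(1) 3(1)] by blast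
    obtain Ps where Ps: "set Ps \<subseteq> R" "sum_list Ps = M - N" "length Ps \<le> size (M - N)"
      using less.hyps[OF lt(2) diff[OF less.prems 3(1,2)]] by blast
    have "length (Ns @ Ps) \<le> size M" using Ns(3) Ps(3) sz by simp
    then show ?thesis using Ns Ps MN by (intro exI[of _ "Ns @ Ps"]) simp
  qed
qed

section \<open>Collection\<close>

context fg_nilpotent begin

text \<open>
  Only weights at least \<open>j\<close> occur. For \<open>r = 0\<close> these are the elements that are expected to have
  length \<open>O(n)\<close>. The deficit \<open>r\<close> makes the class stable under products whose number of factors
  depends on \<open>n\<close>: a product of \<open>n\<^sup>s\<close> elements of deficit \<open>r\<close> has deficit \<open>r - s\<close>, and a single
  letter of weight \<open>k\<close> has deficit \<open>k\<close>.
\<close>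
definition Wball :: "nat \<Rightarrow> nat \<Rightarrow> nat \<Rightarrow> nat \<Rightarrow> 'a set" where
  "Wball j r C n = counted (\<lambda>k. if j \<le> k then C * n ^ (k - r) else 0)"

lemma Wball_carrier: "g \<in> Wball j r C n \<Longrightarrow> g \<in> carrier G"
  unfolding Wball_def by (rule counted_carrier)

lemma Wball_mono:
  assumes "g \<in> Wball j r C n" "n \<ge> 1" "j' \<le> j" "r' \<le> r" "C \<le> C'"
  shows "g \<in> Wball j' r' C' n"
  using assms(1) unfolding Wball_def
  by (rule counted_mono) (use assms in \<open>auto intro!: mult_le_mono power_increasing\<close>)

lemma Wball_one: "\<one> \<in> Wball j r C n"
  unfolding Wball_def by (rule counted_one)

lemma Wball_mult:
  assumes "g \<in> Wball j r C n" "h \<in> Wball j r C' n"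
  shows "g \<otimes> h \<in> Wball j r (C + C') n"
  using counted_mult[OF assms[unfolded Wball_def]] unfolding Wball_def
  by (rule counted_mono) (simp add: algebra_simps)

lemma Wball_inv: "g \<in> Wball j r C n \<Longrightarrow> inv g \<in> Wball j r C n"
  unfolding Wball_def by (rule counted_inv)

lemma Wball_lcs: "g \<in> Wball j r C n \<Longrightarrow> g \<in> lcs j"
  unfolding Wball_def by (erule counted_lcs) simp

lemma Wball_letter: "p \<in> wletters \<Longrightarrow> snd p \<in> Wball (fst p) (fst p) 1 n"
  using countedI[of "[p]" "\<lambda>k. if fst p \<le> k then 1 * n ^ (k - fst p) else 0"] wletters_carrier[of p]
  unfolding Wball_def by (simp cong: if_cong)

lemma conjugate_commutator_letter_word:
  assumes conj: "\<And>P k c. P \<in> S \<Longrightarrow> (k, c) \<in> letters \<Longrightarrow> s \<le> k \<Longrightarrow> conjugate P c \<in> counted (E k)"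
    and x: "(k, x) \<in> letters" and v: "set v \<subseteq> wletters" "\<And>q. q \<in> set v \<Longrightarrow> s \<le> k + fst q"
    and P: "P \<in> carrier G" and pre: "\<And>v1 v2. v = v1 @ v2 \<Longrightarrow> P \<otimes> wprod v1 \<in> S"
  shows "conjugate P (commutator x (wprod v)) \<in> counted (\<lambda>l. \<Sum>q\<leftarrow>v. E (k + fst q) l)"
  using v P pre
proof (induction v arbitrary: P)
  case Nil
  then show ?case using letters_carrier[OF x] counted_one by simp
next
  case (Cons q v)
  have q: "q \<in> wletters" "snd q \<in> carrier G" using Cons.prems(1) wletters_carrier by auto
  have vc: "wprod v \<in> carrier G" using Cons.prems(1) by simp
  have xc: "x \<in> carrier G" using letters_carrier[OF x] .
  have "conjugate P (commutator x (wprod (q # v))) = conjugate P (commutator x (snd q)) \<otimes> conjugate (P \<otimes> snd q) (commutator x (wprod v))"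
    using q vc xc Cons.prems(3) by (simp add: commutator_mult_right conjugate_mult_right conjugate_mult_left)
  moreover have "conjugate P (commutator x (snd q)) \<in> counted (E (k + fst q))"
  proof (rule conj)
    show "P \<in> S" using Cons.prems(4)[of "[]" "q # v"] Cons.prems(3) by simp
    have "(fst q, snd q) \<in> letters" using q(1) by (auto simp: wletters_def)
    then show "(k + fst q, commutator x (snd q)) \<in> letters" by (rule letters.bracket[OF x])
    show "s \<le> k + fst q" using Cons.prems(2)[of q] by simp
  qed
  moreover have "conjugate (P \<otimes> snd q) (commutator x (wprod v)) \<in> counted (\<lambda>l. \<Sum>q\<leftarrow>v. E (k + fst q) l)"
  proof (rule Cons.IH)
    show "set v \<subseteq> wletters" "P \<otimes> snd q \<in> carrier G" using Cons.prems q by auto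
    show "s \<le> k + fst p" if "p \<in> set v" for p using Cons.prems(2)[of p] that by simp
    show "P \<otimes> snd q \<otimes> wprod v1 \<in> S" if "v = v1 @ v2" for v1 v2
    proof -
      have "set v1 \<subseteq> wletters" using Cons.prems(1) that by auto
      then have "P \<otimes> snd q \<otimes> wprod v1 = P \<otimes> wprod (q # v1)"
        using q Cons.prems(3) by (simp add: m_assoc)
      then show ?thesis using Cons.prems(4)[of "q # v1" v2] that by simp
    qed
  qed
  ultimately show ?case using counted_mult by simp
qed

text \<open>
  The commutator of two products is the product of conjugates of the commutators of all pairs of
  factors, by \<open>[x y, z] = x [y,z] x\<^sup>i [x,z]\<close> (with \<open>x\<^sup>i\<close> the inverse) and its mirror image. The
  conjugators are products of prefixes of the two words, collected in \<open>S\<close>, and \<open>E k\<close> bounds the cost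
  of a conjugated letter of weight \<open>k\<close>.
\<close>
lemma conjugate_commutator_words:
  assumes conj: "\<And>P k c. P \<in> S \<Longrightarrow> (k, c) \<in> letters \<Longrightarrow> s \<le> k \<Longrightarrow> conjugate P c \<in> counted (E k)"
    and w: "set w \<subseteq> wletters" and v: "set v \<subseteq> wletters"
    and s: "\<And>p q. p \<in> set w \<Longrightarrow> q \<in> set v \<Longrightarrow> s \<le> fst p + fst q"
    and P: "P \<in> carrier G"
    and pre: "\<And>w1 w2 v1 v2. w = w1 @ w2 \<Longrightarrow> v = v1 @ v2 \<Longrightarrow> P \<otimes> wprod w1 \<otimes> wprod v1 \<in> S"
  shows "conjugate P (commutator (wprod w) (wprod v)) \<in> counted (\<lambda>l. \<Sum>p\<leftarrow>w. \<Sum>q\<leftarrow>v. E (fst p + fst q) l)"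
  using w s P pre
proof (induction w arbitrary: P)
  case Nil
  then show ?case using v counted_one by simp
next
  case (Cons p w)
  have p: "p \<in> wletters" "snd p \<in> carrier G" using Cons.prems(1) wletters_carrier by auto
  have pl: "(fst p, snd p) \<in> letters" using p(1) by (auto simp: wletters_def)
  have wc: "wprod w \<in> carrier G" and vc: "wprod v \<in> carrier G" using Cons.prems(1) v by simp_all
  have "conjugate P (commutator (wprod (p # w)) (wprod v)) = conjugate (P \<otimes> snd p) (commutator (wprod w) (wprod v)) \<otimes> conjugate P (commutator (snd p) (wprod v))"
    using p vc wc Cons.prems(3) by (simp add: commutator_mult_left conjugate_mult_right conjugate_mult_left)
  moreover have "conjugate P (commutator (snd p) (wprod v)) \<in> counted (\<lambda>l. \<Sum>q\<leftarrow>v. E (fst p + fst q) l)"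
  proof (rule conjugate_commutator_letter_word[OF conj pl v])
    show "s \<le> fst p + fst q" if "q \<in> set v" for q using Cons.prems(2)[of p q] that by simp
    show "P \<in> carrier G" using Cons.prems by blast
    show "P \<otimes> wprod v1 \<in> S" if "v = v1 @ v2" for v1 v2
      using Cons.prems(4)[of "[]" "p # w" v1 v2] that Cons.prems(3) by simp
  qed
  moreover have "conjugate (P \<otimes> snd p) (commutator (wprod w) (wprod v)) \<in> counted (\<lambda>l. \<Sum>p\<leftarrow>w. \<Sum>q\<leftarrow>v. E (fst p + fst q) l)"
  proof (rule Cons.IH)
    show "set w \<subseteq> wletters" "P \<otimes> snd p \<in> carrier G" using Cons.prems p by auto
    show "s \<le> fst p' + fst q" if "p' \<in> set w" "q \<in> set v" for p' q
      using Cons.prems(2)[of p' q] that by simp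
    show "P \<otimes> snd p \<otimes> wprod w1 \<otimes> wprod v1 \<in> S" if "w = w1 @ w2" "v = v1 @ v2" for w1 w2 v1 v2
    proof -
      have "set w1 \<subseteq> wletters" "set v1 \<subseteq> wletters" using Cons.prems(1) v that by auto
      then have "P \<otimes> snd p \<otimes> wprod w1 \<otimes> wprod v1 = P \<otimes> wprod (p # w1) \<otimes> wprod v1"
        using p Cons.prems(3) by (simp add: m_assoc)
      then show ?thesis using Cons.prems(4)[of "p # w1" w2 v1 v2] that by simp
    qed
  qed
  ultimately have "conjugate P (commutator (wprod (p # w)) (wprod v)) \<in> counted (\<lambda>k. (\<Sum>p\<leftarrow>w. \<Sum>q\<leftarrow>v. E (fst p + fst q) k) + (\<Sum>q\<leftarrow>v. E (fst p + fst q) k))"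
    using counted_mult by simp
  then show ?case by (simp add: add.commute)
qed

lemma Wball_word:
  assumes "g \<in> Wball j r C n"
  shows "\<exists>w. set w \<subseteq> wletters \<and> wprod w = g \<and> (\<forall>k. wcount k w \<le> (if j \<le> k then C * n ^ (k - r) else 0))"
  using assms unfolding Wball_def counted_def by blast

lemma Wball_prefix:
  assumes w: "set w \<subseteq> wletters" "\<And>k. wcount k w \<le> (if i \<le> k then C * n ^ (k - r) else 0)"
    and n: "n \<ge> 1" and v: "\<And>k. wcount k v \<le> wcount k w" "set v \<subseteq> set w"
  shows "wprod v \<in> Wball 1 0 C n"
  unfolding Wball_def
proof (rule countedI)
  show "set v \<subseteq> wletters" using v w by blast
  fix k
  show "wcount k v \<le> (if 1 \<le> k then C * n ^ (k - 0) else 0)"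
  proof (cases "k = 0")
    case True
    then show ?thesis using wcount_outside[of w k] w(1) v(1)[of k] by simp
  next
    case False
    have "C * n ^ (k - r) \<le> C * n ^ k" using n by (intro mult_le_mono power_increasing) auto
    then have "(if i \<le> k then C * n ^ (k - r) else 0) \<le> C * n ^ k" by simp
    from order_trans[OF w(2) this] have "wcount k w \<le> C * n ^ k" .
    then show ?thesis using v(1)[of k] False by simp
  qed
qed

text \<open>
  The number of pairs of letters of weights \<open>a\<close> and \<open>b\<close> is at most \<open>C * n ^ (a - r)\<close> times
  \<open>C * n ^ (b - r')\<close>, as it should be for letters of weight \<open>a + b\<close> with deficit \<open>r + r'\<close>.
  Each pair contributes a conjugated letter \<open>c\<close> of weight \<open>k = a + b\<close>, and this is \<open>[P,c] c\<close>, where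
  \<open>[P,c]\<close> falls under the induction hypothesis with deficits \<open>0\<close> and \<open>k\<close> and larger total weight. The
  induction ends because all commutators of total weight above \<open>m\<close> are trivial.
\<close>
theorem commutator_Wball:
  assumes "1 \<le> i" "1 \<le> j" "r \<le> i" "r' \<le> j"
  shows "\<exists>C'. \<forall>n\<ge>1. \<forall>u\<in>Wball i r C n. \<forall>v\<in>Wball j r' C n. commutator u v \<in> Wball (i + j) (r + r') C' n"
  using assms
proof (induction "Suc m - (i + j)" arbitrary: i j r r' C rule: less_induct)
  case less
  show ?case
  proof (cases "i + j \<le> m")
    case False
    have "commutator u v \<in> Wball (i + j) (r + r') 0 n" if "u \<in> Wball i r C n" "v \<in> Wball j r' C n" for n u v
    proof -
      have "commutator u v \<in> lcs (i + j)" using that less.prems by (intro commutator_lower_central Wball_lcs)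
      then have "commutator u v = \<one>" using False lcs_trivial[of "i + j"] by simp
      then show ?thesis using Wball_one by simp
    qed
    then show ?thesis by blast
  next
    case True
    \<comment> \<open>conjugators are products of two prefixes, whence \<open>2 * C\<close>; single letters need \<open>1\<close>\<close>
    define C0 where "C0 = 2 * C + 1"
    have "\<exists>D. i + j \<le> k \<and> k \<le> m \<longrightarrow> (\<forall>n\<ge>1. \<forall>u\<in>Wball 1 0 C0 n. \<forall>v\<in>Wball k k C0 n. commutator u v \<in> Wball (1 + k) (0 + k) D n)" for k
    proof (cases "i + j \<le> k \<and> k \<le> m")
      case k: True
      have "\<exists>C'. \<forall>n\<ge>1. \<forall>u\<in>Wball 1 0 C0 n. \<forall>v\<in>Wball k k C0 n. commutator u v \<in> Wball (1 + k) (0 + k) C' n"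
        by (rule less.hyps) (use k less.prems True in auto)
      then show ?thesis by blast
    qed blast
    then obtain D where D: "\<And>k n u v. i + j \<le> k \<Longrightarrow> k \<le> m \<Longrightarrow> n \<ge> 1 \<Longrightarrow> u \<in> Wball 1 0 C0 n \<Longrightarrow> v \<in> Wball k k C0 n \<Longrightarrow>
        commutator u v \<in> Wball (1 + k) k (D k) n" by (metis add_0)
    define C1 where "C1 = (\<Sum>k\<le>m. D k) + 1"
    have conj: "conjugate P c \<in> Wball k k C1 n"
      if P: "P \<in> Wball 1 0 (2 * C) n" and c: "(k, c) \<in> letters" "i + j \<le> k" and n: "n \<ge> 1" for P k c n
    proof (cases "k \<le> m")
      case k: True
      have cl: "c \<in> Wball k k 1 n" using Wball_letter[of "(k, c)" n] c(1) k by (simp add: wletters_def)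
      have "commutator P c \<in> Wball (1 + k) k (D k) n"
        using D[OF c(2) k n] Wball_mono[OF P n, of 1 0 C0] Wball_mono[OF cl n, of k k C0] by (simp add: C0_def)
      then have "commutator P c \<in> Wball k k (D k) n" by (rule Wball_mono) (use n in auto)
      then have "conjugate P c \<in> Wball k k (D k + 1) n"
        using Wball_mult[OF _ cl] conjugate_eq_commutator[OF Wball_carrier[OF P] letters_carrier[OF c(1)]] by simp
      moreover have "D k \<le> (\<Sum>k\<le>m. D k)" using k by (intro member_le_sum) auto
      ultimately show ?thesis using Wball_mono[of _ k k "D k + 1" n k k C1] n by (simp add: C1_def)
    next
      case False
      then have "c = \<one>" using letters_lcs[OF c(1)] lcs_trivial[of k] by simp
      then show ?thesis using Wball_one conjugate_one(1)[OF Wball_carrier[OF P]] by simp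
    qed
    define C' where "C' = (Suc m) * ((Suc m) * (C * C * C1))"
    have "commutator u v \<in> Wball (i + j) (r + r') C' n" if n: "n \<ge> 1" and u: "u \<in> Wball i r C n" and v: "v \<in> Wball j r' C n" for n u v
    proof -
      obtain wu where wu: "set wu \<subseteq> wletters" "wprod wu = u" "\<And>k. wcount k wu \<le> (if i \<le> k then C * n ^ (k - r) else 0)"
        using Wball_word[OF u] by blast
      obtain wv where wv: "set wv \<subseteq> wletters" "wprod wv = v" "\<And>k. wcount k wv \<le> (if j \<le> k then C * n ^ (k - r') else 0)"
        using Wball_word[OF v] by blast
      define E where "E = (\<lambda>k l. if k \<le> l then C1 * n ^ (l - k) else 0)"
      have "conjugate \<one> (commutator (wprod wu) (wprod wv)) \<in> counted (\<lambda>l. \<Sum>p\<leftarrow>wu. \<Sum>q\<leftarrow>wv. E (fst p + fst q) l)"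
      proof (rule conjugate_commutator_words[of "Wball 1 0 (2 * C) n" "i + j"])
        show "conjugate P c \<in> counted (E k)" if "P \<in> Wball 1 0 (2 * C) n" "(k, c) \<in> letters" "i + j \<le> k" for P k c
          using conj[OF that n] unfolding Wball_def E_def .
        show "i + j \<le> fst p + fst q" if "p \<in> set wu" "q \<in> set wv" for p q
          using word_weight_ge[OF wu(3) that(1)] word_weight_ge[OF wv(3) that(2)] by simp
        show "\<one> \<otimes> wprod w1 \<otimes> wprod v1 \<in> Wball 1 0 (2 * C) n" if "wu = w1 @ w2" "wv = v1 @ v2" for w1 w2 v1 v2
        proof -
          have w1: "wprod w1 \<in> Wball 1 0 C n" by (rule Wball_prefix[OF wu(1,3) n]) (use that in auto)
          have v1: "wprod v1 \<in> Wball 1 0 C n" by (rule Wball_prefix[OF wv(1,3) n]) (use that in auto)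
          show ?thesis using Wball_mult[OF w1 v1] Wball_carrier[OF w1] by (simp add: mult_2)
        qed
      qed (use wu wv in auto)
      then have "commutator u v \<in> counted (\<lambda>l. \<Sum>p\<leftarrow>wu. \<Sum>q\<leftarrow>wv. E (fst p + fst q) l)"
        using wu(2) wv(2) Wball_carrier[OF u] Wball_carrier[OF v] by simp
      then show ?thesis unfolding Wball_def
      proof (rule counted_mono)
        fix l
        have wm: "fst p \<le> m" if "p \<in> set wu \<union> set wv" for p
          using wletters_weight[of p] wu(1) wv(1) that by blast
        have "(\<Sum>p\<leftarrow>wu. \<Sum>q\<leftarrow>wv. E (fst p + fst q) l) = (\<Sum>p\<leftarrow>wu. \<Sum>b\<le>m. wcount b wv * E (fst p + b) l)"
        proof -
          have "(\<Sum>q\<leftarrow>wv. E (a + fst q) l) = (\<Sum>b\<le>m. wcount b wv * E (a + b) l)" for a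
            using sum_list_wcount[of wv m "\<lambda>b. E (a + b) l"] wm by simp
          then show ?thesis by simp
        qed
        also have "\<dots> = (\<Sum>a\<le>m. wcount a wu * (\<Sum>b\<le>m. wcount b wv * E (a + b) l))"
          using sum_list_wcount[of wu m "\<lambda>a. \<Sum>b\<le>m. wcount b wv * E (a + b) l"] wm by simp
        also have "\<dots> = (\<Sum>a\<le>m. \<Sum>b\<le>m. wcount a wu * (wcount b wv * E (a + b) l))"
          by (simp add: sum_distrib_left)
        also have "\<dots> \<le> (\<Sum>a\<le>m. \<Sum>b\<le>m. if i + j \<le> l then C * C * C1 * n ^ (l - (r + r')) else 0)"
        proof (intro sum_mono)
          fix a b
          show "wcount a wu * (wcount b wv * E (a + b) l) \<le> (if i + j \<le> l then C * C * C1 * n ^ (l - (r + r')) else 0)"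
          proof (cases "i \<le> a \<and> j \<le> b \<and> a + b \<le> l")
            case True
            have "wcount a wu * (wcount b wv * E (a + b) l) \<le> (C * n ^ (a - r)) * ((C * n ^ (b - r')) * (C1 * n ^ (l - (a + b))))"
              using wu(3)[of a] wv(3)[of b] True by (intro mult_le_mono) (simp_all add: E_def)
            also have "\<dots> = C * C * C1 * n ^ ((a - r) + (b - r') + (l - (a + b)))"
              by (simp add: power_add algebra_simps)
            also have "(a - r) + (b - r') + (l - (a + b)) = l - (r + r')"
              using True less.prems by linarith
            finally show ?thesis using True by simp
          next
            case False
            then have "wcount a wu = 0 \<or> wcount b wv = 0 \<or> E (a + b) l = 0"
              using wu(3)[of a] wv(3)[of b] by (auto simp: E_def)
            then show ?thesis by auto
          qed
        qed
        also have "\<dots> = Suc m * (Suc m * (if i + j \<le> l then C * C * C1 * n ^ (l - (r + r')) else 0))"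
          by (simp only: sum_constant card_atMost of_nat_id)
        also have "\<dots> = (if i + j \<le> l then C' * n ^ (l - (r + r')) else 0)"
          by (simp only: C'_def mult.assoc if_distrib[of "(*) _"] mult_0_right cong: if_cong)
        finally show "(\<Sum>p\<leftarrow>wu. \<Sum>q\<leftarrow>wv. E (fst p + fst q) l) \<le> (if i + j \<le> l then C' * n ^ (l - (r + r')) else 0)" .
      qed
    qed
    then show ?thesis by blast
  qed
qed

text \<open>
  The error that is produced by moving the letter \<open>p\<close> from the position between \<open>P\<close> and \<open>Q\<close> to the front
  and by moving the resulting commutator to the end. A single move has deficit \<open>fst p\<close>, so that the
  \<open>O(n\<^sup>k)\<close> moves of letters of weight \<open>k\<close> add up to deficit \<open>0\<close>.
\<close>
lemma swap_letter_Wball: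
  "\<exists>C'. \<forall>n\<ge>1. \<forall>p\<in>wletters. \<forall>P\<in>Wball 1 0 C n. \<forall>Q\<in>Wball 1 0 C n.
    conjugate (inv Q) (commutator (inv P) (inv (snd p))) \<in> Wball (Suc (fst p)) (fst p) C' n"
proof -
  define C0 where "C0 = C + 1"
  have "\<exists>C'. \<forall>n\<ge>1. \<forall>x. (k, x) \<in> wletters \<longrightarrow> (\<forall>P\<in>Wball 1 0 C n. \<forall>Q\<in>Wball 1 0 C n.
    conjugate (inv Q) (commutator (inv P) (inv x)) \<in> Wball (Suc k) k C' n)" for k
  proof (cases "1 \<le> k")
    case k: True
    obtain D1 where D1: "\<forall>n\<ge>1. \<forall>u\<in>Wball 1 0 C0 n. \<forall>v\<in>Wball k k C0 n. commutator u v \<in> Wball (1 + k) (0 + k) D1 n"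
      using commutator_Wball[of 1 k 0 k C0] k by auto
    obtain D2 where D2: "\<forall>n\<ge>1. \<forall>u\<in>Wball 1 0 (C0 + D1) n. \<forall>v\<in>Wball (1 + k) k (C0 + D1) n. commutator u v \<in> Wball (1 + (1 + k)) (0 + k) D2 n"
      using commutator_Wball[of 1 "1 + k" 0 k "C0 + D1"] by auto
    have "conjugate (inv Q) (commutator (inv P) (inv x)) \<in> Wball (Suc k) k (D2 + D1) n"
      if n: "n \<ge> 1" and x: "(k, x) \<in> wletters" and P: "P \<in> Wball 1 0 C n" and Q: "Q \<in> Wball 1 0 C n" for n x P Q
    proof -
      have x1: "x \<in> Wball k k 1 n" using Wball_letter[OF x, of n] by simp
      have "inv x \<in> Wball k k C0 n" by (rule Wball_mono[OF Wball_inv[OF x1] n]) (auto simp: C0_def)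
      moreover have "inv P \<in> Wball 1 0 C0 n" by (rule Wball_mono[OF Wball_inv[OF P] n]) (auto simp: C0_def)
      ultimately have e: "commutator (inv P) (inv x) \<in> Wball (1 + k) k D1 n" using D1 n by simp
      have e': "commutator (inv P) (inv x) \<in> Wball (1 + k) k (C0 + D1) n" by (rule Wball_mono[OF e n]) auto
      have "inv Q \<in> Wball 1 0 (C0 + D1) n" by (rule Wball_mono[OF Wball_inv[OF Q] n]) (auto simp: C0_def)
      then have "commutator (inv Q) (commutator (inv P) (inv x)) \<in> Wball (1 + (1 + k)) k D2 n" using D2 n e' by simp
      then have "commutator (inv Q) (commutator (inv P) (inv x)) \<in> Wball (1 + k) k D2 n" by (rule Wball_mono) (use n in auto)
      from Wball_mult[OF this e] show ?thesis
        using conjugate_eq_commutator[OF inv_closed[OF Wball_carrier[OF Q]] Wball_carrier[OF e]] by simp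
    qed
    then show ?thesis by blast
  next
    case False
    then show ?thesis using wletters_weight by force
  qed
  then obtain D where D: "\<And>k n x P Q. n \<ge> 1 \<Longrightarrow> (k, x) \<in> wletters \<Longrightarrow> P \<in> Wball 1 0 C n \<Longrightarrow> Q \<in> Wball 1 0 C n \<Longrightarrow>
    conjugate (inv Q) (commutator (inv P) (inv x)) \<in> Wball (Suc k) k (D k) n" by metis
  have "conjugate (inv Q) (commutator (inv P) (inv (snd p))) \<in> Wball (Suc (fst p)) (fst p) (\<Sum>k\<le>m. D k) n"
    if n: "n \<ge> 1" and p: "p \<in> wletters" and P: "P \<in> Wball 1 0 C n" and Q: "Q \<in> Wball 1 0 C n" for n p P Q
  proof -
    have "D (fst p) \<le> (\<Sum>k\<le>m. D k)" using wletters_weight[OF p] by (intro member_le_sum) auto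
    moreover have "conjugate (inv Q) (commutator (inv P) (inv (snd p))) \<in> Wball (Suc (fst p)) (fst p) (D (fst p)) n"
      using D[OF n _ P Q, of "fst p" "snd p"] p by simp
    ultimately show ?thesis using Wball_mono n by blast
  qed
  then show ?thesis by blast
qed

text \<open>
  The letters of \<open>w'\<close> are moved to the front one by one, and the errors are collected at the end.
\<close>
lemma word_rearrange:
  assumes j: "1 \<le> j"
  shows "\<exists>C'. \<forall>n\<ge>1. \<forall>w w'. set w \<subseteq> wletters \<longrightarrow> (\<forall>k. wcount k w \<le> (if j \<le> k then C * n ^ k else 0)) \<longrightarrow>
    mset w = mset w' \<longrightarrow> inv (wprod w') \<otimes> wprod w \<in> Wball (Suc j) 0 C' n"
proof -
  obtain C1 where C1: "\<forall>n\<ge>1. \<forall>p\<in>wletters. \<forall>P\<in>Wball 1 0 C n. \<forall>Q\<in>Wball 1 0 C n.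
    conjugate (inv Q) (commutator (inv P) (inv (snd p))) \<in> Wball (Suc (fst p)) (fst p) C1 n" using swap_letter_Wball by blast
  define E where "E = (\<lambda>n k l. if Suc k \<le> l then C1 * n ^ (l - k) else (0::nat))"
  have key: "inv (wprod w') \<otimes> wprod w \<in> counted (\<lambda>l. \<Sum>p\<leftarrow>w'. E n (fst p) l)"
    if n: "n \<ge> 1" and "set w \<subseteq> wletters" "\<forall>k. wcount k w \<le> (if 1 \<le> k then C * n ^ k else 0)" "mset w = mset w'" for n w w'
    using that(2-)
  proof (induction w' arbitrary: w)
    case Nil
    then show ?case using counted_one by simp
  next
    case (Cons x w')
    have "x \<in> set w" using Cons.prems(3) by (metis list.set_intros(1) mset_eq_setD)
    then obtain u v where w: "w = u @ x # v" by (meson split_list)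
    have ms: "mset (u @ v) = mset w'" using Cons.prems(3) w by simp
    have uv: "set u \<subseteq> wletters" "set v \<subseteq> wletters" "x \<in> wletters" "set w' \<subseteq> wletters"
      using Cons.prems(1) w mset_eq_setD[OF ms] by auto
    have cnt: "wcount k w \<le> (if 1 \<le> k then C * n ^ (k - 0) else 0)" for k
      using Cons.prems(2)[rule_format, of k] by (simp only: diff_zero)
    have P: "wprod u \<in> Wball 1 0 C n" by (rule Wball_prefix[OF Cons.prems(1) cnt n]) (use w in auto)
    have Q: "wprod v \<in> Wball 1 0 C n" by (rule Wball_prefix[OF Cons.prems(1) cnt n]) (use w in auto)
    define e where "e = conjugate (inv (wprod v)) (commutator (inv (wprod u)) (inv (snd x)))"
    have e: "e \<in> counted (E n (fst x))"
    proof -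
      have "e \<in> Wball (Suc (fst x)) (fst x) C1 n" using C1 n uv(3) P Q by (simp only: e_def)
      then show ?thesis unfolding Wball_def E_def .
    qed
    have xc: "snd x \<in> carrier G" using wletters_carrier uv(3) by blast
    have "wprod w = snd x \<otimes> (wprod (u @ v) \<otimes> e)"
      using uv xc by (simp add: w e_def conjugate_def commutator_def m_assoc inv_mult_group)
    then have "inv (wprod (x # w')) \<otimes> wprod w = (inv (wprod w') \<otimes> wprod (u @ v)) \<otimes> e"
      using uv xc counted_carrier[OF e] by (simp add: m_assoc inv_mult_group)
    moreover have "inv (wprod w') \<otimes> wprod (u @ v) \<in> counted (\<lambda>l. \<Sum>p\<leftarrow>w'. E n (fst p) l)"
    proof (rule Cons.IH[OF _ _ ms])
      show "set (u @ v) \<subseteq> wletters" using uv by simp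
      have "wcount k (u @ v) \<le> wcount k w" for k by (simp add: w)
      then show "\<forall>k. wcount k (u @ v) \<le> (if 1 \<le> k then C * n ^ k else 0)"
        using Cons.prems(2) order_trans by blast
    qed
    ultimately have "inv (wprod (x # w')) \<otimes> wprod w \<in> counted (\<lambda>l. (\<Sum>p\<leftarrow>w'. E n (fst p) l) + E n (fst x) l)"
      using counted_mult[OF _ e] by simp
    then show ?case by (simp add: add.commute)
  qed
  define C' where "C' = Suc m * (C * C1)"
  have "inv (wprod w') \<otimes> wprod w \<in> Wball (Suc j) 0 C' n"
    if n: "n \<ge> 1" and w: "set w \<subseteq> wletters" and cnt: "\<forall>k. wcount k w \<le> (if j \<le> k then C * n ^ k else 0)"
      and ms: "mset w = mset w'" for n w w'
  proof -
    have "wcount k w \<le> (if 1 \<le> k then C * n ^ k else 0)" for k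
      using cnt[rule_format, of k] j by (auto split: if_splits)
    then have "inv (wprod w') \<otimes> wprod w \<in> counted (\<lambda>l. \<Sum>p\<leftarrow>w'. E n (fst p) l)" using key[OF n w _ ms] by blast
    then show ?thesis unfolding Wball_def
    proof (rule counted_mono)
      fix l
      have "set w' \<subseteq> wletters" using mset_eq_setD[OF ms] w by simp
      then have "(\<Sum>p\<leftarrow>w'. E n (fst p) l) = (\<Sum>k\<le>m. wcount k w' * E n k l)"
        using sum_list_wcount[of w' m "\<lambda>k. E n k l"] wletters_weight by blast
      also have "\<dots> = (\<Sum>k\<le>m. wcount k w * E n k l)" using wcount_mset[OF ms] by simp
      also have "\<dots> \<le> (\<Sum>k\<le>m. if Suc j \<le> l then C * C1 * n ^ l else 0)"
      proof (rule sum_mono)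
        fix k
        show "wcount k w * E n k l \<le> (if Suc j \<le> l then C * C1 * n ^ l else 0)"
        proof (cases "j \<le> k \<and> Suc k \<le> l")
          case True
          have "wcount k w * E n k l \<le> (C * n ^ k) * (C1 * n ^ (l - k))"
            using cnt[rule_format, of k] True by (intro mult_le_mono) (simp_all add: E_def)
          also have "\<dots> = C * C1 * n ^ (k + (l - k))" by (simp add: power_add)
          finally show ?thesis using True by simp
        next
          case False
          then have "wcount k w = 0 \<or> E n k l = 0" using cnt[rule_format, of k] by (auto simp: E_def)
          then show ?thesis by auto
        qed
      qed
      also have "\<dots> = (if Suc j \<le> l then C' * n ^ (l - 0) else 0)"
        by (simp add: C'_def algebra_simps)
      finally show "(\<Sum>p\<leftarrow>w'. E n (fst p) l) \<le> (if Suc j \<le> l then C' * n ^ (l - 0) else 0)" .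
    qed
  qed
  then show ?thesis by blast
qed

text \<open>
  The relations between the letters of weight \<open>j\<close> in \<open>G\<^sub>j/G\<^bsub>j+1\<^esub>\<close>. Their coefficients are natural
  numbers, with inverse letters in the place of negative coefficients, so that Dickson's lemma
  applies.
\<close>
definition relators :: "nat \<Rightarrow> (nat \<times> 'a) multiset set" where
  "relators j = {mset v | v. set v \<subseteq> {p \<in> wletters. fst p = j} \<and> wprod v \<in> lcs (Suc j)}"

lemma wprod_rearrange_lcs:
  assumes j: "1 \<le> j" and w: "set w \<subseteq> wletters" "\<And>p. p \<in> set w \<Longrightarrow> j \<le> fst p" and ms: "mset w = mset w'"
  shows "wprod w \<in> lcs (Suc j) \<longleftrightarrow> wprod w' \<in> lcs (Suc j)"
proof -
  have s: "subgroup (lcs (Suc j)) G" by (rule lower_central_subgroup)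
  have cnt: "wcount k w \<le> (if j \<le> k then length w * 1 ^ k else 0)" for k
  proof (cases "j \<le> k")
    case False
    then have "filter (\<lambda>p. fst p = k) w = []" using w(2) unfolding filter_empty_conv by blast
    then show ?thesis by (simp add: wcount_def)
  qed (simp add: wcount_def)
  obtain C' where "\<forall>n\<ge>1. \<forall>u w'. set u \<subseteq> wletters \<longrightarrow> (\<forall>k. wcount k u \<le> (if j \<le> k then length w * n ^ k else 0)) \<longrightarrow>
    mset u = mset w' \<longrightarrow> inv (wprod w') \<otimes> wprod u \<in> Wball (Suc j) 0 C' n"
    using word_rearrange[OF j, of "length w"] by blast
  then have "inv (wprod w') \<otimes> wprod w \<in> Wball (Suc j) 0 C' 1" using w(1) ms cnt by blast
  then have e: "inv (wprod w') \<otimes> wprod w \<in> lcs (Suc j)" by (rule Wball_lcs)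
  have c: "wprod w \<in> carrier G" "wprod w' \<in> carrier G"
    using w(1) mset_eq_setD[OF ms] by simp_all
  have 1: "wprod w = wprod w' \<otimes> (inv (wprod w') \<otimes> wprod w)" using c by simp
  have 2: "wprod w' = wprod w \<otimes> inv (inv (wprod w') \<otimes> wprod w)"
    using c by (simp add: inv_mult_group)
  show ?thesis
    using 1 2 e subgroup.m_closed[OF s] subgroup.m_inv_closed[OF s] by metis
qed

lemma relators_diff:
  assumes j: "1 \<le> j" and M: "M \<in> relators j" and N: "N \<in> relators j" and NM: "N \<subseteq># M"
  shows "M - N \<in> relators j"
proof -
  have s: "subgroup (lcs (Suc j)) G" by (rule lower_central_subgroup)
  obtain v where v: "M = mset v" "set v \<subseteq> {p \<in> wletters. fst p = j}" "wprod v \<in> lcs (Suc j)"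
    using M unfolding relators_def by blast
  obtain u where u: "N = mset u" "set u \<subseteq> {p \<in> wletters. fst p = j}" "wprod u \<in> lcs (Suc j)"
    using N unfolding relators_def by blast
  obtain x where x: "mset x = M - N" using ex_mset by blast
  have ms: "mset v = mset (u @ x)" using x u(1) v(1) NM by simp
  have sx: "set x \<subseteq> {p \<in> wletters. fst p = j}" using mset_eq_setD[OF ms] v(2) by auto
  have "wprod (u @ x) \<in> lcs (Suc j)"
    using wprod_rearrange_lcs[OF j _ _ ms] v(2,3) by auto
  then have "wprod u \<otimes> wprod x \<in> lcs (Suc j)" using u(2) sx by (subst (asm) wprod_append) auto
  moreover have "wprod x = inv (wprod u) \<otimes> (wprod u \<otimes> wprod x)"
  proof -
    have "wprod x \<in> carrier G" "wprod u \<in> carrier G" using sx u(2) by (auto intro!: wprod_closed)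
    then show ?thesis by simp
  qed
  ultimately have "wprod x \<in> lcs (Suc j)"
    using u(3) subgroup.m_closed[OF s] subgroup.m_inv_closed[OF s] by metis
  then show ?thesis using x sx unfolding relators_def by force
qed

lemma finite_wletters_weight: "finite {p \<in> wletters. fst p = j}"
proof -
  have "{p \<in> wletters. fst p = j} \<subseteq> Pair j ` {x. (j, x) \<in> letters}"
    by (auto simp: wletters_def)
  then show ?thesis using finite_letters finite_subset by blast
qed

lemma finite_minimal_relators:
  "finite {M \<in> relators j. M \<noteq> {#} \<and> (\<forall>N\<in>relators j. N \<subseteq># M \<longrightarrow> N = {#} \<or> N = M)}"
proof (rule finite_multiset_antichain[OF finite_wletters_weight[of j]])
  fix M assume "M \<in> {M \<in> relators j. M \<noteq> {#} \<and> (\<forall>N\<in>relators j. N \<subseteq># M \<longrightarrow> N = {#} \<or> N = M)}"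
  then show "set_mset M \<subseteq> {p \<in> wletters. fst p = j}"
    unfolding relators_def by (auto simp del: mem_Collect_eq) 
qed blast

text \<open>
  The letters of weight \<open>j\<close> form a relation, which is a sum of at most \<open>C n\<^sup>j\<close> minimal relations. There
  are only finitely many of these, and the value of each is a fixed word \<open>z M\<close> in letters of weight
  above \<open>j\<close>. Substituting the \<open>z M\<close>, after rearranging the word, adds at most a constant times \<open>n\<^sup>j\<close>
  letters of every higher weight, which is less than allowed.
\<close>
theorem Wball_descend:
  assumes j: "1 \<le> j"
  shows "\<exists>C'. \<forall>n\<ge>1. \<forall>g\<in>Wball j 0 C n. g \<in> lcs (Suc j) \<longrightarrow> g \<in> Wball (Suc j) 0 C' n"
proof -
  have s: "subgroup (lcs (Suc j)) G" by (rule lower_central_subgroup)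
  define R where "R = {M \<in> relators j. M \<noteq> {#} \<and> (\<forall>N\<in>relators j. N \<subseteq># M \<longrightarrow> N = {#} \<or> N = M)}"
  have finR: "finite R" unfolding R_def by (rule finite_minimal_relators)
  have "\<exists>y z. M \<in> R \<longrightarrow> mset y = M \<and> set y \<subseteq> wletters \<and> set z \<subseteq> wletters \<and> (\<forall>p\<in>set z. Suc j \<le> fst p) \<and> wprod z = wprod y" for M
  proof (cases "M \<in> R")
    case True
    then obtain y where y: "M = mset y" "set y \<subseteq> {p \<in> wletters. fst p = j}" "wprod y \<in> lcs (Suc j)"
      unfolding R_def relators_def by blast
    obtain z where "set z \<subseteq> wletters" "\<forall>p\<in>set z. Suc j \<le> fst p" "wprod z = wprod y"
      using lcs_word[OF _ y(3)] by auto
    then show ?thesis using y by blast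
  qed blast
  then obtain y z where yz: "\<And>M. M \<in> R \<Longrightarrow> mset (y M) = M \<and> set (y M) \<subseteq> wletters \<and> set (z M) \<subseteq> wletters \<and>
      (\<forall>p\<in>set (z M). Suc j \<le> fst p) \<and> wprod (z M) = wprod (y M)" by metis
  define K where "K = (\<Sum>M\<in>R. length (z M))"
  have K: "length (z M) \<le> K" if "M \<in> R" for M
    unfolding K_def using finR that by (intro member_le_sum) auto
  obtain C1 where C1: "\<forall>n\<ge>1. \<forall>w w'. set w \<subseteq> wletters \<longrightarrow> (\<forall>k. wcount k w \<le> (if j \<le> k then C * n ^ k else 0)) \<longrightarrow>
    mset w = mset w' \<longrightarrow> inv (wprod w') \<otimes> wprod w \<in> Wball (Suc j) 0 C1 n"
    using word_rearrange[OF j] by blast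
  have "g \<in> Wball (Suc j) 0 (C * K + C + C1) n" if n: "n \<ge> 1" and g: "g \<in> Wball j 0 C n" and gg: "g \<in> lcs (Suc j)" for n g
  proof -
    obtain w where w: "set w \<subseteq> wletters" "wprod w = g" "\<And>k. wcount k w \<le> (if j \<le> k then C * n ^ (k - 0) else 0)"
      using Wball_word[OF g] by blast
    have wj: "j \<le> fst p" if "p \<in> set w" for p using word_weight_ge[OF w(3) that] .
    define w1 where "w1 = filter (\<lambda>p. fst p = j) w"
    define w2 where "w2 = filter (\<lambda>p. fst p \<noteq> j) w"
    have w12: "set w1 \<subseteq> {p \<in> wletters. fst p = j}" "set w2 \<subseteq> wletters" using w(1) by (auto simp: w1_def w2_def)
    have w2j: "Suc j \<le> fst p" if "p \<in> set w2" for p using wj[of p] that by (auto simp: w2_def)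
    have ms12: "mset w = mset (w1 @ w2)" by (simp add: w1_def w2_def)
    have w1c: "set w1 \<subseteq> wletters" using w12 by auto
    have "wprod (w1 @ w2) \<in> lcs (Suc j)"
      using wprod_rearrange_lcs[OF j w(1) wj ms12] gg w(2) by simp
    then have "wprod w1 \<otimes> wprod w2 \<in> lcs (Suc j)" using w1c w12(2) by simp
    moreover have w2g: "wprod w2 \<in> lcs (Suc j)" by (rule wprod_lcs[OF w12(2) w2j])
    moreover have "wprod w1 = (wprod w1 \<otimes> wprod w2) \<otimes> inv (wprod w2)"
      using w1c w12(2) by (simp add: m_assoc)
    ultimately have "wprod w1 \<in> lcs (Suc j)"
      using subgroup.m_closed[OF s] subgroup.m_inv_closed[OF s] by metis
    then have "mset w1 \<in> relators j" using w12 unfolding relators_def by blast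
    then obtain Ms where Ms: "set Ms \<subseteq> R" "sum_list Ms = mset w1" "length Ms \<le> size (mset w1)"
      using multiset_minimal_decomposition[of "relators j" "mset w1"] relators_diff[OF j] unfolding R_def by blast
    define w' where "w' = concat (map y Ms) @ w2"
    define w'' where "w'' = concat (map z Ms) @ w2"
    have "mset (concat (map y Ms)) = sum_list Ms" using Ms(1)
      by (induction Ms) (use yz in auto)
    then have ms: "mset w = mset w'" using ms12 Ms(2) by (simp add: w'_def)
    have "\<forall>k. wcount k w \<le> (if j \<le> k then C * n ^ k else 0)" using w(3) by (simp only: diff_zero) blast
    then have e: "inv (wprod w') \<otimes> wprod w \<in> Wball (Suc j) 0 C1 n" using C1 n w(1) ms by blast
    have cz: "wprod (concat (map z Ms)) = wprod (concat (map y Ms)) \<and> set (concat (map y Ms)) \<subseteq> wletters \<and>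
        set (concat (map z Ms)) \<subseteq> wletters \<and> (\<forall>p\<in>set (concat (map z Ms)). Suc j \<le> fst p) \<and>
        (\<forall>k. wcount k (concat (map z Ms)) \<le> length Ms * K)" using Ms(1)
    proof (induction Ms)
      case (Cons M Ms)
      have M: "M \<in> R" and IH: "wprod (concat (map z Ms)) = wprod (concat (map y Ms))" "set (concat (map y Ms)) \<subseteq> wletters"
        "set (concat (map z Ms)) \<subseteq> wletters" "\<forall>p\<in>set (concat (map z Ms)). Suc j \<le> fst p"
        "\<And>k. wcount k (concat (map z Ms)) \<le> length Ms * K" using Cons by auto
      have "wcount k (z M) \<le> K" for k
        using K[OF M] length_filter_le[of "\<lambda>p. fst p = k" "z M"] unfolding wcount_def by linarith
      then have "wcount k (concat (map z (M # Ms))) \<le> length (M # Ms) * K" for k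
        using IH(5)[of k] by (simp add: add_mono)
      then show ?case using IH(1-4) yz[OF M] by auto
    qed simp
    have w'w'': "wprod w' = wprod w''" using cz w12(2) by (simp add: w'_def w''_def)
    have w'c: "set w' \<subseteq> wletters" "set w'' \<subseteq> wletters" using cz w12(2) by (simp_all add: w'_def w''_def)
    have "wprod w'' \<in> Wball (Suc j) 0 (C * K + C) n"
      unfolding Wball_def
    proof (rule countedI[OF w'c(2)])
      fix k
      show "wcount k w'' \<le> (if Suc j \<le> k then (C * K + C) * n ^ (k - 0) else 0)"
      proof (cases "Suc j \<le> k")
        case True
        have "length Ms \<le> length w1" using Ms(3) by (simp only: size_mset)
        also have "\<dots> \<le> C * n ^ j" using w(3)[of j] by (simp add: w1_def wcount_def)
        also have "\<dots> \<le> C * n ^ k" using n True by (intro mult_le_mono power_increasing) auto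
        finally have "length Ms * K \<le> (C * n ^ k) * K" by (rule mult_le_mono1)
        moreover have "wcount k w2 \<le> wcount k w" using wcount_mset[OF ms12, of k] by simp
        moreover have "wcount k w \<le> C * n ^ k" using w(3)[of k] by (auto split: if_splits)
        moreover have "wcount k (concat (map z Ms)) \<le> length Ms * K" using cz by blast
        ultimately have "wcount k (concat (map z Ms)) + wcount k w2 \<le> (C * n ^ k) * K + C * n ^ k"
          by linarith
        then have "wcount k w'' \<le> (C * n ^ k) * K + C * n ^ k" by (simp only: w''_def wcount_simps)
        then show ?thesis using True by (simp add: algebra_simps)
      next
        case False
        have "\<forall>p\<in>set w''. Suc j \<le> fst p" using cz w2j by (auto simp: w''_def)
        then have "filter (\<lambda>p. fst p = k) w'' = []" using False unfolding filter_empty_conv by blast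
        then show ?thesis by (simp add: wcount_def)
      qed
    qed
    from Wball_mult[OF this e] have "wprod w'' \<otimes> (inv (wprod w') \<otimes> wprod w) \<in> Wball (Suc j) 0 (C * K + C + C1) n" .
    moreover have "wprod w'' \<otimes> (inv (wprod w') \<otimes> wprod w) = g"
      using w'w'' w'c Wball_carrier[OF g] w(2) by simp
    ultimately show ?thesis by simp
  qed
  then show ?thesis by blast
qed

corollary Wball_inter_lcs:
  assumes "1 \<le> j"
  shows "\<exists>C'. \<forall>n\<ge>1. \<forall>g\<in>Wball 1 0 C n. g \<in> lcs j \<longrightarrow> g \<in> Wball j 0 C' n"
  using assms
proof (induction j rule: dec_induct)
  case (step j)
  then obtain C1 where C1: "\<forall>n\<ge>1. \<forall>g\<in>Wball 1 0 C n. g \<in> lcs j \<longrightarrow> g \<in> Wball j 0 C1 n" by blast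
  obtain C2 where C2: "\<forall>n\<ge>1. \<forall>g\<in>Wball j 0 C1 n. g \<in> lcs (Suc j) \<longrightarrow> g \<in> Wball (Suc j) 0 C2 n"
    using Wball_descend[OF step.hyps(1)] by blast
  show ?case using C1 C2 lower_central_Suc_subset[of j] by blast
qed blast

end

section \<open>Balls and projections to the lower central quotients\<close>

definition lprod :: "('a, 'b) monoid_scheme \<Rightarrow> 'a list \<Rightarrow> 'a" where
  "lprod G xs = foldr (\<lambda>x z. x \<otimes>\<^bsub>G\<^esub> z) xs \<one>\<^bsub>G\<^esub>"

lemma lprod_simps [simp]: "lprod G [] = \<one>\<^bsub>G\<^esub>" "lprod G (x # xs) = x \<otimes>\<^bsub>G\<^esub> lprod G xs"
  by (simp_all add: lprod_def)

definition (in group) gen_ball :: "'a set \<Rightarrow> nat \<Rightarrow> 'a set" where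
  "gen_ball F n = {lprod G xs | xs. set xs \<subseteq> F \<union> (\<lambda>x. inv x) ` F \<and> length xs \<le> n}"

context group begin

lemma lprod_closed [simp]: "set xs \<subseteq> carrier G \<Longrightarrow> lprod G xs \<in> carrier G"
  by (induction xs) auto

lemma lprod_append: "set xs \<subseteq> carrier G \<Longrightarrow> set ys \<subseteq> carrier G \<Longrightarrow> lprod G (xs @ ys) = lprod G xs \<otimes> lprod G ys"
  by (induction xs) (auto simp: m_assoc)

lemma symm_carrier: "F \<subseteq> carrier G \<Longrightarrow> F \<union> (\<lambda>x. inv x) ` F \<subseteq> carrier G"
  by auto

lemma gen_ball_carrier: "F \<subseteq> carrier G \<Longrightarrow> g \<in> gen_ball F n \<Longrightarrow> g \<in> carrier G"
  unfolding gen_ball_def using symm_carrier lprod_closed by blast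

lemma gen_ball_one: "\<one> \<in> gen_ball F n"
  unfolding gen_ball_def by (rule CollectI, rule exI[of _ "[]"]) simp

lemma gen_ball_mono: "a \<le> b \<Longrightarrow> gen_ball F a \<subseteq> gen_ball F b"
  unfolding gen_ball_def using order_trans by blast

lemma gen_ball_mult:
  assumes F: "F \<subseteq> carrier G" and "g \<in> gen_ball F a" "h \<in> gen_ball F b"
  shows "g \<otimes> h \<in> gen_ball F (a + b)"
proof -
  obtain xs ys where xs: "set xs \<subseteq> F \<union> (\<lambda>x. inv x) ` F" "length xs \<le> a" "g = lprod G xs"
    and ys: "set ys \<subseteq> F \<union> (\<lambda>x. inv x) ` F" "length ys \<le> b" "h = lprod G ys"
    using assms(2,3) unfolding gen_ball_def by blast
  have "g \<otimes> h = lprod G (xs @ ys)"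
    using xs ys symm_carrier[OF F] lprod_append[of xs ys] by (metis order_trans)
  moreover have "set (xs @ ys) \<subseteq> F \<union> (\<lambda>x. inv x) ` F" "length (xs @ ys) \<le> a + b" using xs ys by auto
  ultimately show ?thesis unfolding gen_ball_def by blast
qed

lemma gen_ball_inv:
  assumes F: "F \<subseteq> carrier G" and "g \<in> gen_ball F a"
  shows "inv g \<in> gen_ball F a"
proof -
  obtain xs where xs: "set xs \<subseteq> F \<union> (\<lambda>x. inv x) ` F" "length xs \<le> a" "g = lprod G xs"
    using assms(2) unfolding gen_ball_def by blast
  have "inv (lprod G xs) = lprod G (rev (map (\<lambda>x. inv x) xs)) \<and> set (rev (map (\<lambda>x. inv x) xs)) \<subseteq> F \<union> (\<lambda>x. inv x) ` F"
    using xs(1)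
  proof (induction xs)
    case (Cons x xs)
    have x: "x \<in> F \<union> (\<lambda>x. inv x) ` F" "x \<in> carrier G" using Cons.prems symm_carrier[OF F] by auto
    have xs: "set xs \<subseteq> carrier G" using Cons.prems symm_carrier[OF F] by (meson order_trans set_subset_Cons)
    have i: "inv x \<in> F \<union> (\<lambda>x. inv x) ` F"
    proof (cases "x \<in> F")
      case False
      then obtain y where "y \<in> F" "x = inv y" using x by blast
      then show ?thesis using F by (simp add: subset_iff)
    qed simp
    have "set (rev (map (\<lambda>x. inv x) xs)) \<subseteq> carrier G" using xs by auto
    then show ?case using Cons x(2) xs i by (simp add: lprod_append inv_mult_group)
  qed simp
  then show ?thesis using xs unfolding gen_ball_def by (metis (mono_tags, lifting) length_map length_rev mem_Collect_eq)
qed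

lemma gen_ball_finite: "finite F \<Longrightarrow> finite (gen_ball F n)"
proof -
  assume "finite F"
  then have "finite {xs. set xs \<subseteq> F \<union> (\<lambda>x. inv x) ` F \<and> length xs \<le> n}" by (intro finite_lists_length_le) simp
  then have "finite (lprod G ` {xs. set xs \<subseteq> F \<union> (\<lambda>x. inv x) ` F \<and> length xs \<le> n})" by (rule finite_imageI)
  moreover have "gen_ball F n = lprod G ` {xs. set xs \<subseteq> F \<union> (\<lambda>x. inv x) ` F \<and> length xs \<le> n}"
    unfolding gen_ball_def by blast
  ultimately show ?thesis by simp
qed

lemma gen_ball_letter: "F \<subseteq> carrier G \<Longrightarrow> x \<in> F \<union> (\<lambda>x. inv x) ` F \<Longrightarrow> x \<in> gen_ball F 1"
  unfolding gen_ball_def using symm_carrier by (intro CollectI exI[of _ "[x]"]) auto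

lemma gen_ball_pow:
  assumes F: "F \<subseteq> carrier G" and x: "x \<in> gen_ball F 1"
  shows "x [^] (k::nat) \<in> gen_ball F k"
proof (induction k)
  case 0
  then show ?case using gen_ball_one by simp
next
  case (Suc k)
  then show ?case using gen_ball_mult[OF F Suc x] by simp
qed

end

abbreviation (in group) lc_proj :: "nat \<Rightarrow> 'a \<Rightarrow> 'a set" where "lc_proj j \<equiv> lower_central_proj G j"

context group begin

lemma lc_proj_hom: "group_hom G (G Mod lower_central G (Suc j)) (lc_proj j)"
proof -
  interpret N: normal "lower_central G (Suc j)" G by (rule lower_central_normal)
  have "lc_proj j = (\<lambda>x. lower_central G (Suc j) #> x)" by (rule ext) (simp add: lower_central_proj_def)
  then show ?thesis
    using N.r_coset_hom_Mod
    by (intro group_hom.intro group_hom_axioms.intro is_group N.factorgroup_is_group) simp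
qed

lemma lc_proj_mult: "x \<in> carrier G \<Longrightarrow> y \<in> carrier G \<Longrightarrow> lc_proj j (x \<otimes> y) = lc_proj j x <#> lc_proj j y"
  using group_hom.hom_mult[OF lc_proj_hom, of x y j] by simp

lemma lc_proj_one_iff: "x \<in> carrier G \<Longrightarrow> lc_proj j x = lower_central G (Suc j) \<longleftrightarrow> x \<in> lower_central G (Suc j)"
  using rcos_self[OF _ lower_central_subgroup[of "Suc j"], of x]
    coset_join2[OF _ lower_central_subgroup[of "Suc j"], of x]
  by (auto simp: lower_central_proj_def)

lemma lc_proj_one: "lc_proj j \<one> = lower_central G (Suc j)"
  using lc_proj_one_iff[of \<one> j] subgroup.one_closed[OF lower_central_subgroup[of "Suc j"]] by simp

lemma lc_proj_eq_iff:
  assumes "x \<in> carrier G" "y \<in> carrier G"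
  shows "lc_proj j x = lc_proj j y \<longleftrightarrow> inv x \<otimes> y \<in> lower_central G (Suc j)"
proof -
  interpret p: group_hom G "G Mod lower_central G (Suc j)" "lc_proj j" by (rule lc_proj_hom)
  let ?Q = "G Mod lower_central G (Suc j)"
  have c: "lc_proj j x \<in> carrier ?Q" "lc_proj j y \<in> carrier ?Q" using assms p.hom_closed by blast+
  have "lc_proj j (inv x \<otimes> y) = inv\<^bsub>?Q\<^esub> lc_proj j x \<otimes>\<^bsub>?Q\<^esub> lc_proj j y"
    using assms by (simp only: p.hom_mult p.hom_inv inv_closed)
  moreover have "inv\<^bsub>?Q\<^esub> lc_proj j x \<otimes>\<^bsub>?Q\<^esub> lc_proj j y = \<one>\<^bsub>?Q\<^esub> \<longleftrightarrow> lc_proj j x = lc_proj j y"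
  proof
    assume e: "inv\<^bsub>?Q\<^esub> lc_proj j x \<otimes>\<^bsub>?Q\<^esub> lc_proj j y = \<one>\<^bsub>?Q\<^esub>"
    have "lc_proj j x \<otimes>\<^bsub>?Q\<^esub> (inv\<^bsub>?Q\<^esub> lc_proj j x \<otimes>\<^bsub>?Q\<^esub> lc_proj j y) = lc_proj j y" using c by (rule p.H.inv_cancel_right)
    then show "lc_proj j x = lc_proj j y" using c(1) unfolding e by (simp only: p.H.r_one)
  next
    assume "lc_proj j x = lc_proj j y"
    then show "inv\<^bsub>?Q\<^esub> lc_proj j x \<otimes>\<^bsub>?Q\<^esub> lc_proj j y = \<one>\<^bsub>?Q\<^esub>" using c by (simp only: p.H.l_inv)
  qed
  ultimately show ?thesis using lc_proj_one_iff[of "inv x \<otimes> y" j] assms by simp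
qed

lemma lc_proj_cong_mult:
  "\<lbrakk>lc_proj j x = lc_proj j x'; lc_proj j y = lc_proj j y'; x \<in> carrier G; y \<in> carrier G; x' \<in> carrier G; y' \<in> carrier G\<rbrakk>
    \<Longrightarrow> lc_proj j (x \<otimes> y) = lc_proj j (x' \<otimes> y')"
  by (simp only: lc_proj_mult)

lemma lc_proj_absorb_right:
  assumes "x \<in> carrier G" "z \<in> lower_central G (Suc j)"
  shows "lc_proj j (x \<otimes> z) = lc_proj j x"
proof -
  have z: "z \<in> carrier G" using lower_central_carrier[OF assms(2)] .
  have "inv x \<otimes> (x \<otimes> z) = z" using assms(1) z by simp
  then have "lc_proj j x = lc_proj j (x \<otimes> z)" using assms z lc_proj_eq_iff[of x "x \<otimes> z" j] by simp
  then show ?thesis ..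
qed

lemma lc_proj_absorb_left:
  assumes "x \<in> carrier G" "z \<in> lower_central G (Suc j)"
  shows "lc_proj j (z \<otimes> x) = lc_proj j x"
proof -
  have z: "z \<in> carrier G" using lower_central_carrier[OF assms(2)] .
  have "z \<otimes> x = x \<otimes> conjugate (inv x) z" using assms(1) z by (simp add: conjugate_def m_assoc)
  moreover have "conjugate (inv x) z \<in> lower_central G (Suc j)"
    using normal_conjugate[OF lower_central_normal inv_closed[OF assms(1)] assms(2)] .
  ultimately show ?thesis using lc_proj_absorb_right[OF assms(1)] by simp
qed

lemma lc_proj_conjugate:
  assumes "j \<ge> 1" "x \<in> carrier G" "u \<in> lower_central G j"
  shows "lc_proj j (conjugate x u) = lc_proj j u"
proof -
  have u: "u \<in> carrier G" using lower_central_carrier[OF assms(3)] .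
  show ?thesis
    using lc_proj_absorb_left[OF u commutator_lower_central_Suc[OF assms]] conjugate_eq_commutator[OF assms(2) u] by simp
qed

lemma lc_proj_commute:
  assumes "j \<ge> 1" "x \<in> carrier G" "u \<in> lower_central G j"
  shows "lc_proj j (x \<otimes> u) = lc_proj j (u \<otimes> x)"
proof -
  have u: "u \<in> carrier G" using lower_central_carrier[OF assms(3)] .
  have "x \<otimes> u = conjugate x u \<otimes> x" using assms(2) u by (simp add: conjugate_def m_assoc)
  moreover have "lc_proj j (conjugate x u \<otimes> x) = lc_proj j (u \<otimes> x)"
    by (rule lc_proj_cong_mult) (use lc_proj_conjugate[OF assms] assms(2) u in auto)
  ultimately show ?thesis by simp
qed

lemma lc_proj_pow_cong:
  assumes "lc_proj j x = lc_proj j y" "x \<in> carrier G" "y \<in> carrier G"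
  shows "lc_proj j (x [^] (a::nat)) = lc_proj j (y [^] a)"
proof (induction a)
  case (Suc a)
  show ?case unfolding nat_pow_Suc
    by (rule lc_proj_cong_mult) (use Suc assms in auto)
qed simp

lemma lower_central_pow: "x \<in> lower_central G j \<Longrightarrow> x [^] (a::nat) \<in> lower_central G j"
  by (induction a) (auto simp: subgroup.one_closed[OF lower_central_subgroup] subgroup.m_closed[OF lower_central_subgroup])

text \<open>
  Conjugation is trivial on \<open>G\<^bsub>i+k\<^esub>/G\<^bsub>i+k+1\<^esub>\<close>, so that the commutator identities become bilinearity.
\<close>
lemma lc_proj_commutator_mult_left:
  assumes "i \<ge> 1" "k \<ge> 1" "x \<in> lower_central G i" "x' \<in> lower_central G i" "y \<in> lower_central G k"
  shows "lc_proj (i + k) (commutator (x \<otimes> x') y) = lc_proj (i + k) (commutator x y \<otimes> commutator x' y)"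
proof -
  have c: "x \<in> carrier G" "x' \<in> carrier G" "y \<in> carrier G" using assms(3-5) lower_central_carrier by auto
  have in1: "commutator x' y \<in> lower_central G (i + k)" using commutator_lower_central[OF assms(1,2,4,5)] .
  have in2: "commutator x y \<in> lower_central G (i + k)" using commutator_lower_central[OF assms(1,2,3,5)] .
  have ik: "i + k \<ge> 1" using assms(1) by simp
  have "lc_proj (i + k) (commutator (x \<otimes> x') y) = lc_proj (i + k) (commutator x' y \<otimes> commutator x y)"
    unfolding commutator_mult_left[OF c]
    by (rule lc_proj_cong_mult) (use lc_proj_conjugate[OF ik c(1) in1] c in auto)
  also have "\<dots> = lc_proj (i + k) (commutator x y \<otimes> commutator x' y)"
    using lc_proj_commute[OF ik _ in2, of "commutator x' y"] c by simp
  finally show ?thesis .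
qed

lemma lc_proj_commutator_inv:
  assumes "lc_proj j (commutator x y) = lc_proj j u" "x \<in> carrier G" "y \<in> carrier G" "u \<in> carrier G"
  shows "lc_proj j (commutator y x) = lc_proj j (inv u)"
proof -
  interpret p: group_hom G "G Mod lower_central G (Suc j)" "lc_proj j" by (rule lc_proj_hom)
  have "commutator y x = inv (commutator x y)" using assms inv_commutator by simp
  then show ?thesis using assms by (simp only: p.hom_inv commutator_closed)
qed

lemma lc_proj_commutator_cong_left:
  assumes "i \<ge> 1" "k \<ge> 1" "x \<in> lower_central G i" "x' \<in> lower_central G i" "y \<in> lower_central G k"
    and "lc_proj i x = lc_proj i x'"
  shows "lc_proj (i + k) (commutator x y) = lc_proj (i + k) (commutator x' y)"
proof -
  have c: "x \<in> carrier G" "x' \<in> carrier G" "y \<in> carrier G" using assms(3-5) lower_central_carrier by auto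
  define t where "t = inv x \<otimes> x'"
  have t: "t \<in> lower_central G (Suc i)" using lc_proj_eq_iff[OF c(1,2)] assms(6) by (simp add: t_def)
  have t': "t \<in> lower_central G i" using t lower_central_Suc_subset by blast
  have x': "x' = x \<otimes> t" using c by (simp add: t_def)
  have "commutator t y \<in> lower_central G (Suc i + k)" using commutator_lower_central[OF _ assms(2) t assms(5)] by simp
  then have "lc_proj (i + k) (commutator x y \<otimes> commutator t y) = lc_proj (i + k) (commutator x y)"
    using lc_proj_absorb_right[of "commutator x y" "commutator t y" "i + k"] c by simp
  then show ?thesis using lc_proj_commutator_mult_left[OF assms(1-3) t' assms(5)] x' by simp
qed

lemma lc_proj_commutator_cong:
  assumes "i \<ge> 1" "k \<ge> 1" "x \<in> lower_central G i" "x' \<in> lower_central G i"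
    "y \<in> lower_central G k" "y' \<in> lower_central G k" "lc_proj i x = lc_proj i x'" "lc_proj k y = lc_proj k y'"
  shows "lc_proj (i + k) (commutator x y) = lc_proj (i + k) (commutator x' y')"
proof -
  have c: "x \<in> carrier G" "x' \<in> carrier G" "y \<in> carrier G" "y' \<in> carrier G"
    using assms(3-6) lower_central_carrier by auto
  have "lc_proj (k + i) (commutator y x') = lc_proj (k + i) (commutator y' x')" by (rule lc_proj_commutator_cong_left) (use assms in auto)
  then have "lc_proj (i + k) (commutator x' y) = lc_proj (i + k) (inv (commutator y' x'))"
    using lc_proj_commutator_inv[of "i + k" y x' "commutator y' x'"] c by (simp add: add.commute)
  then show ?thesis using lc_proj_commutator_cong_left[OF assms(1-5,7)] inv_commutator c by simp
qed

lemma lc_proj_commutator_pow_left: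
  assumes "i \<ge> 1" "k \<ge> 1" "x \<in> lower_central G i" "y \<in> lower_central G k"
  shows "lc_proj (i + k) (commutator (x [^] (a::nat)) y) = lc_proj (i + k) (commutator x y [^] a)"
proof (induction a)
  case 0
  then show ?case using lower_central_carrier[OF assms(4)] by simp
next
  case (Suc a)
  have c: "x \<in> carrier G" "y \<in> carrier G" using assms(3,4) lower_central_carrier by auto
  have "lc_proj (i + k) (commutator (x [^] a \<otimes> x) y) = lc_proj (i + k) (commutator (x [^] a) y \<otimes> commutator x y)"
    by (rule lc_proj_commutator_mult_left) (use assms lower_central_pow in auto)
  also have "\<dots> = lc_proj (i + k) (commutator x y [^] a \<otimes> commutator x y)"
    by (rule lc_proj_cong_mult) (use Suc c in auto)
  finally show ?case by simp
qed

lemma lc_proj_commutator_pow: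
  assumes "i \<ge> 1" "k \<ge> 1" "x \<in> lower_central G i" "y \<in> lower_central G k"
  shows "lc_proj (i + k) (commutator (x [^] (a::nat)) (y [^] (b::nat))) = lc_proj (i + k) (commutator x y [^] (a * b))"
proof -
  have c: "x \<in> carrier G" "y \<in> carrier G" using assms(3,4) lower_central_carrier by auto
  have "lc_proj (k + i) (commutator (y [^] b) x) = lc_proj (k + i) (commutator y x [^] b)"
    by (rule lc_proj_commutator_pow_left) (use assms in auto)
  then have "lc_proj (i + k) (commutator x (y [^] b)) = lc_proj (i + k) (inv (commutator y x [^] b))"
    using lc_proj_commutator_inv[of "i + k" "y [^] b" x "commutator y x [^] b"] c by (simp add: add.commute)
  also have "inv (commutator y x [^] b) = commutator x y [^] b"
    using c inv_commutator nat_pow_inv[of "commutator y x" b] by simp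
  finally have 1: "lc_proj (i + k) (commutator x (y [^] b)) = lc_proj (i + k) (commutator x y [^] b)" .
  have "lc_proj (i + k) (commutator (x [^] a) (y [^] b)) = lc_proj (i + k) (commutator x (y [^] b) [^] a)"
    by (rule lc_proj_commutator_pow_left) (use assms lower_central_pow in auto)
  also have "\<dots> = lc_proj (i + k) ((commutator x y [^] b) [^] a)"
    by (rule lc_proj_pow_cong[OF 1]) (use c in auto)
  also have "(commutator x y [^] b) [^] a = commutator x y [^] (a * b)"
    using c by (simp add: nat_pow_pow mult.commute)
  finally show ?thesis .
qed

end

section \<open>Elements of the lower central series are distorted\<close>

context fg_nilpotent begin

abbreviation ball :: "nat \<Rightarrow> 'a set" where "ball n \<equiv> gen_ball F n"

lemmas ball_carrier = gen_ball_carrier[OF F_carrier]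
  and ball_mult = gen_ball_mult[OF F_carrier]
  and ball_inv = gen_ball_inv[OF F_carrier]
  and ball_finite = gen_ball_finite[OF F_finite]

lemma ball_Wball: "g \<in> ball (C * n) \<Longrightarrow> g \<in> Wball 1 0 C n"
proof -
  assume "g \<in> ball (C * n)"
  then obtain xs where xs: "set xs \<subseteq> F \<union> (\<lambda>x. inv x) ` F" "length xs \<le> C * n" "g = lprod G xs"
    unfolding gen_ball_def by blast
  have wl: "(1, x) \<in> wletters" if "x \<in> F \<union> (\<lambda>x. inv x) ` F" for x
    using that letters.gen letters.gen_inv m_pos by (auto simp: wletters_def)
  have "lprod G xs = wprod (map (Pair 1) xs)" by (induction xs) auto
  moreover have "wprod (map (Pair 1) xs) \<in> Wball 1 0 C n" unfolding Wball_def
  proof (rule countedI)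
    show "set (map (Pair 1) xs) \<subseteq> wletters" using wl xs(1) by auto
    fix k
    have "wcount k (map (Pair 1) xs) = (if k = 1 then length xs else 0)" by (induction xs) auto
    then show "wcount k (map (Pair 1) xs) \<le> (if 1 \<le> k then C * n ^ (k - 0) else 0)"
      using xs(2) by auto
  qed
  ultimately show ?thesis using xs(3) by simp
qed

text \<open>
  For \<open>c = [x,y]\<close> with \<open>x\<close> of weight \<open>i\<close> and \<open>y\<close> of weight \<open>k\<close> write \<open>a = q n\<^sup>k + r\<close> with \<open>r < n\<^sup>k\<close>. By
  bilinearity \<open>c\<^sup>a\<close> agrees modulo the next term with the product of the commutators of \<open>x\<^sup>q\<close> with the
  \<open>n\<^sup>k\<close>-th power of \<open>y\<close>, and of \<open>x\<close> with \<open>y\<^sup>r\<close>. All exponents are in the range of the induction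
  hypotheses, and a commutator is affected only modulo the next term if its entries are replaced by
  short elements.
\<close>
lemma letter_pow_short:
  assumes "(j, c) \<in> letters"
  shows "\<exists>C'. \<forall>n\<ge>1. \<forall>a\<le>C * n ^ j. \<exists>v\<in>ball (C' * n) \<inter> lcs j. lc_proj j v = lc_proj j (c [^] a)"
  using assms
proof (induction j c arbitrary: C rule: letters.induct)
  have base: "\<exists>C'. \<forall>n\<ge>1. \<forall>a\<le>C * n ^ 1. \<exists>v\<in>ball (C' * n) \<inter> lcs 1. lc_proj 1 v = lc_proj 1 (x [^] a)"
    if x: "x \<in> F \<union> (\<lambda>x. inv x) ` F" for x C
  proof (rule exI[of _ C], intro allI impI)
    fix n a :: nat assume "a \<le> C * n ^ 1"
    moreover have "x [^] a \<in> ball a" using gen_ball_pow[OF F_carrier gen_ball_letter[OF F_carrier x]] .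
    ultimately have "x [^] a \<in> ball (C * n)" using gen_ball_mono[of a "C * n"] by auto
    moreover from this have "x [^] a \<in> lcs 1" using ball_carrier by simp
    ultimately show "\<exists>v\<in>ball (C * n) \<inter> lcs 1. lc_proj 1 v = lc_proj 1 (x [^] a)" by blast
  qed
  {
    case (gen x)
    then show ?case using base[of x C] by blast
  next
    case (gen_inv x)
    then show ?case using base[of "inv x" C] by blast
  next
    case (bracket i x k y)
    have i: "1 \<le> i" "x \<in> lcs i" and k: "1 \<le> k" "y \<in> lcs k"
      using letters_lcs[OF bracket.hyps(1)] letters_lcs[OF bracket.hyps(2)] by auto
    have c: "x \<in> carrier G" "y \<in> carrier G" using i(2) k(2) lower_central_carrier by auto
    obtain C1 where C1: "\<forall>n\<ge>1. \<forall>a\<le>C * n ^ i. \<exists>v\<in>ball (C1 * n) \<inter> lcs i. lc_proj i v = lc_proj i (x [^] a)"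
      using bracket.IH(1) by blast
    obtain C2 where C2: "\<forall>n\<ge>1. \<forall>a\<le>1 * n ^ k. \<exists>v\<in>ball (C2 * n) \<inter> lcs k. lc_proj k v = lc_proj k (y [^] a)"
      using bracket.IH(2) by blast
    obtain C3 where C3: "\<forall>n\<ge>1. \<forall>a\<le>1 * n ^ i. \<exists>v\<in>ball (C3 * n) \<inter> lcs i. lc_proj i v = lc_proj i (x [^] a)"
      using bracket.IH(1) by blast
    have commutator_ball: "commutator u v \<in> ball (2 * (a + b))" if "u \<in> ball a" "v \<in> ball b" for u v a b
    proof -
      have "commutator u v \<in> ball (a + b + a + b)"
        unfolding commutator_def using that by (intro ball_mult ball_inv)
      moreover have "a + b + a + b = 2 * (a + b)" by simp
      ultimately show ?thesis by (simp only:)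
    qed
    show ?case
    proof (rule exI[of _ "2 * (C1 + C2) + 2 * (C3 + C2)"], intro allI impI)
      fix n a :: nat assume n: "1 \<le> n" and a: "a \<le> C * n ^ (i + k)"
      define q r where "q = a div n ^ k" and "r = a mod n ^ k"
      have nk: "n ^ k > 0" using n by simp
      have "q * n ^ k \<le> (C * n ^ i) * n ^ k"
        using order_trans[OF div_times_less_eq_dividend a] by (simp only: q_def power_add mult.assoc)
      then have "q \<le> C * n ^ i" using nk mult_le_cancel2 by blast
      then obtain v1 where v1: "v1 \<in> ball (C1 * n)" "v1 \<in> lcs i" "lc_proj i v1 = lc_proj i (x [^] q)"
        using C1 n by blast
      obtain v2 where v2: "v2 \<in> ball (C2 * n)" "v2 \<in> lcs k" "lc_proj k v2 = lc_proj k (y [^] (n ^ k))"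
        using C2 n by force
      have "1 \<le> 1 * n ^ i" using n by simp
      then obtain v3 where v3: "v3 \<in> ball (C3 * n)" "v3 \<in> lcs i" "lc_proj i v3 = lc_proj i (x [^] (1::nat))"
        using C3 n by blast
      have "r \<le> 1 * n ^ k" using nk by (simp add: r_def less_imp_le)
      then obtain v4 where v4: "v4 \<in> ball (C2 * n)" "v4 \<in> lcs k" "lc_proj k v4 = lc_proj k (y [^] r)"
        using C2 n by blast
      have vc: "v1 \<in> carrier G" "v2 \<in> carrier G" "v3 \<in> carrier G" "v4 \<in> carrier G"
        using v1(1) v2(1) v3(1) v4(1) ball_carrier by auto
      have p12: "lc_proj (i + k) (commutator v1 v2) = lc_proj (i + k) (commutator x y [^] (q * n ^ k))"
      proof -
        have "lc_proj (i + k) (commutator v1 v2) = lc_proj (i + k) (commutator (x [^] q) (y [^] (n ^ k)))"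
          by (rule lc_proj_commutator_cong) (use i k v1 v2 lower_central_pow in auto)
        then show ?thesis using lc_proj_commutator_pow[OF i(1) k(1) i(2) k(2)] by simp
      qed
      have p34: "lc_proj (i + k) (commutator v3 v4) = lc_proj (i + k) (commutator x y [^] (1 * r))"
      proof -
        have "lc_proj (i + k) (commutator v3 v4) = lc_proj (i + k) (commutator (x [^] (1::nat)) (y [^] r))"
          by (rule lc_proj_commutator_cong) (use i k v3 v4 c lower_central_pow in auto)
        then show ?thesis using lc_proj_commutator_pow[OF i(1) k(1) i(2) k(2), of 1 r] by simp
      qed
      have "lc_proj (i + k) (commutator v1 v2 \<otimes> commutator v3 v4) = lc_proj (i + k) (commutator x y [^] (q * n ^ k) \<otimes> commutator x y [^] (1 * r))"
        by (rule lc_proj_cong_mult[OF p12 p34]) (use vc c in auto)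
      also have "commutator x y [^] (q * n ^ k) \<otimes> commutator x y [^] (1 * r) = commutator x y [^] a"
      proof -
        have "q * n ^ k + 1 * r = a" by (simp only: q_def r_def mult_1 div_mult_mod_eq)
        then show ?thesis using nat_pow_mult[OF commutator_closed[OF c], of "q * n ^ k" "1 * r"] by (simp only:)
      qed
      finally have "lc_proj (i + k) (commutator v1 v2 \<otimes> commutator v3 v4) = lc_proj (i + k) (commutator x y [^] a)" .
      moreover have "commutator v1 v2 \<otimes> commutator v3 v4 \<in> ball (2 * (C1 * n + C2 * n) + 2 * (C3 * n + C2 * n))"
        by (intro ball_mult commutator_ball v1 v2 v3 v4)
      then have "commutator v1 v2 \<otimes> commutator v3 v4 \<in> ball ((2 * (C1 + C2) + 2 * (C3 + C2)) * n)"
        by (simp add: algebra_simps)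
      moreover have "commutator v1 v2 \<otimes> commutator v3 v4 \<in> lcs (i + k)"
        by (intro subgroup.m_closed[OF lower_central_subgroup] commutator_lower_central i k v1 v2 v3 v4)
      ultimately show "\<exists>v\<in>ball ((2 * (C1 + C2) + 2 * (C3 + C2)) * n) \<inter> lcs (i + k). lc_proj (i + k) v = lc_proj (i + k) (commutator x y [^] a)"
        by blast
    qed
  }
qed

lemma lc_proj_wprod_filter:
  assumes j: "1 \<le> j" and p: "p \<in> wletters" "fst p = j"
    and w: "set w \<subseteq> wletters" "\<And>q. q \<in> set w \<Longrightarrow> fst q = j"
  shows "lc_proj j (wprod w) = lc_proj j (snd p [^] length (filter (\<lambda>q. q = p) w) \<otimes> wprod (filter (\<lambda>q. q \<noteq> p) w))"
  using w
proof (induction w)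
  case (Cons q w)
  have pc: "snd p \<in> carrier G" using wletters_carrier[OF p(1)] .
  have q: "q \<in> wletters" "snd q \<in> carrier G" using Cons.prems(1) wletters_carrier by auto
  have wc: "set w \<subseteq> wletters" using Cons.prems(1) by simp
  let ?a = "length (filter (\<lambda>q. q = p) w)" and ?u = "wprod (filter (\<lambda>q. q \<noteq> p) w)"
  have uc: "?u \<in> carrier G" using wc by (intro wprod_closed) auto
  have IH: "lc_proj j (wprod w) = lc_proj j (snd p [^] ?a \<otimes> ?u)"
    by (rule Cons.IH[OF wc]) (use Cons.prems(2) in simp)
  have "lc_proj j (snd q \<otimes> wprod w) = lc_proj j (snd q \<otimes> (snd p [^] ?a \<otimes> ?u))"
    by (rule lc_proj_cong_mult[OF refl IH]) (use q pc uc wc in auto)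
  moreover have "lc_proj j (snd q \<otimes> (snd p [^] ?a \<otimes> ?u)) = lc_proj j (snd p [^] ?a \<otimes> (snd q \<otimes> ?u))"
  proof -
    have "snd p \<in> lcs j" using wletters_lcs[OF p(1)] p(2) by simp
    from lower_central_pow[OF this]
    have "lc_proj j (snd q \<otimes> snd p [^] ?a) = lc_proj j (snd p [^] ?a \<otimes> snd q)"
      by (rule lc_proj_commute[OF j q(2)])
    then have "lc_proj j (snd q \<otimes> snd p [^] ?a \<otimes> ?u) = lc_proj j (snd p [^] ?a \<otimes> snd q \<otimes> ?u)"
      by (rule lc_proj_cong_mult[OF _ refl]) (use q pc uc in auto)
    then show ?thesis using q pc uc by (simp add: m_assoc)
  qed
  ultimately show ?case
  proof (cases "q = p")
    case True
    have "snd p \<otimes> snd p [^] ?a = snd p [^] Suc ?a" by (rule nat_pow_Suc2[OF pc, symmetric])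
    then have "snd p \<otimes> (snd p [^] ?a \<otimes> ?u) = snd p [^] Suc ?a \<otimes> ?u" using pc uc by (simp add: m_assoc[symmetric])
    then show ?thesis using \<open>lc_proj j (snd q \<otimes> wprod w) = _\<close> True by simp
  qed simp
qed simp

lemma lc_proj_word_short:
  assumes j: "1 \<le> j" and "finite S" "S \<subseteq> {p \<in> wletters. fst p = j}"
  shows "\<exists>C'. \<forall>n\<ge>1. \<forall>w. set w \<subseteq> S \<longrightarrow> length w \<le> C * n ^ j \<longrightarrow> (\<exists>v\<in>ball (C' * n) \<inter> lcs j. lc_proj j v = lc_proj j (wprod w))"
  using assms(2,3)
proof (induction S rule: finite_induct)
  case empty
  then show ?case
    using gen_ball_one subgroup.one_closed[OF lower_central_subgroup[of j]] by (intro exI[of _ 0]) auto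
next
  case (insert p S)
  obtain C1 where C1: "\<forall>n\<ge>1. \<forall>w. set w \<subseteq> S \<longrightarrow> length w \<le> C * n ^ j \<longrightarrow> (\<exists>v\<in>ball (C1 * n) \<inter> lcs j. lc_proj j v = lc_proj j (wprod w))"
    using insert by auto
  have p: "p \<in> wletters" "fst p = j" using insert.prems by auto
  have "(j, snd p) \<in> letters" using p by (cases p) (auto simp: wletters_def)
  then obtain C2 where C2: "\<forall>n\<ge>1. \<forall>a\<le>C * n ^ j. \<exists>v\<in>ball (C2 * n) \<inter> lcs j. lc_proj j v = lc_proj j (snd p [^] a)"
    using letter_pow_short by blast
  have "\<exists>v\<in>ball ((C2 + C1) * n) \<inter> lcs j. lc_proj j v = lc_proj j (wprod w)"
    if n: "n \<ge> 1" and w: "set w \<subseteq> insert p S" "length w \<le> C * n ^ j" for n w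
  proof -
    let ?a = "length (filter (\<lambda>q. q = p) w)" and ?u = "filter (\<lambda>q. q \<noteq> p) w"
    have u: "set ?u \<subseteq> S" "length ?u \<le> C * n ^ j" using w order_trans[OF length_filter_le] by auto
    have a: "?a \<le> C * n ^ j" using order_trans[OF length_filter_le w(2)] .
    obtain v1 where v1: "v1 \<in> ball (C1 * n)" "v1 \<in> lcs j" "lc_proj j v1 = lc_proj j (wprod ?u)" using C1 n u by blast
    obtain v2 where v2: "v2 \<in> ball (C2 * n)" "v2 \<in> lcs j" "lc_proj j v2 = lc_proj j (snd p [^] ?a)" using C2 n a by blast
    have wl: "set w \<subseteq> wletters" "\<And>q. q \<in> set w \<Longrightarrow> fst q = j" using w(1) insert.prems by auto
    have uw: "set ?u \<subseteq> wletters" using wl(1) by auto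
    have "lc_proj j (v2 \<otimes> v1) = lc_proj j (snd p [^] ?a \<otimes> wprod ?u)"
      by (rule lc_proj_cong_mult[OF v2(3) v1(3)])
        (use ball_carrier v1(1) v2(1) wletters_carrier[OF p(1)] uw in auto)
    also have "\<dots> = lc_proj j (wprod w)" using lc_proj_wprod_filter[OF j p wl] by simp
    finally have "lc_proj j (v2 \<otimes> v1) = lc_proj j (wprod w)" .
    moreover have "v2 \<otimes> v1 \<in> ball ((C2 + C1) * n)" using ball_mult[OF v2(1) v1(1)] by (simp add: algebra_simps)
    moreover have "v2 \<otimes> v1 \<in> lcs j" using v1 v2 subgroup.m_closed[OF lower_central_subgroup] by blast
    ultimately show ?thesis by blast
  qed
  then show ?case by blast
qed

lemma lc_proj_wprod_top:
  assumes j: "1 \<le> j" and w: "set w \<subseteq> wletters" "\<And>q. q \<in> set w \<Longrightarrow> j \<le> fst q"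
  shows "lc_proj j (wprod w) = lc_proj j (wprod (filter (\<lambda>q. fst q = j) w))"
  using w
proof (induction w)
  case (Cons q w)
  have q: "q \<in> wletters" "snd q \<in> carrier G" using Cons.prems(1) wletters_carrier by auto
  have wc: "set w \<subseteq> wletters" using Cons.prems(1) by simp
  have fc: "wprod (filter (\<lambda>q. fst q = j) w) \<in> carrier G" using wc by (intro wprod_closed) auto
  have IH: "lc_proj j (wprod w) = lc_proj j (wprod (filter (\<lambda>q. fst q = j) w))"
    by (rule Cons.IH[OF wc]) (use Cons.prems(2) in simp)
  show ?case
  proof (cases "fst q = j")
    case True
    have "lc_proj j (snd q \<otimes> wprod w) = lc_proj j (snd q \<otimes> wprod (filter (\<lambda>q. fst q = j) w))"
      by (rule lc_proj_cong_mult[OF refl IH]) (use q fc wc in auto)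
    then show ?thesis using True by simp
  next
    case False
    then have "Suc j \<le> fst q" using Cons.prems(2)[of q] by simp
    moreover have "snd q \<in> lcs (fst q)" using wletters_lcs[OF q(1)] .
    ultimately have "snd q \<in> lcs (Suc j)" using lower_central_antimono by blast
    then have "lc_proj j (snd q \<otimes> wprod w) = lc_proj j (wprod w)" using lc_proj_absorb_left wc by simp
    then show ?thesis using False IH by simp
  qed
qed simp

text \<open>
  Let \<open>u \<in> G\<^sub>j\<close> have the required word. By the preceding lemmas some short \<open>v \<in> G\<^sub>j\<close> agrees with it
  modulo \<open>G\<^bsub>j+1\<^esub>\<close>. Being short, \<open>v\<close> has such a word too, so that the quotient of \<open>u\<close> and \<open>v\<close> lies in the
  weighted ball of \<open>G\<^bsub>j+1\<^esub>\<close>, to which the descending induction applies.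
\<close>
theorem Wball_subset_ball:
  assumes "1 \<le> j"
  shows "\<exists>C'. \<forall>n\<ge>1. Wball j 0 C n \<subseteq> ball (C' * n)"
proof (cases "j \<le> Suc m")
  case True
  then show ?thesis using assms
  proof (induction j arbitrary: C rule: inc_induct)
    case base
    have "Wball (Suc m) 0 C n \<subseteq> ball (0 * n)" for n
      using Wball_lcs[of _ "Suc m" 0 C n] lower_central_trivial gen_ball_one by auto
    then show ?case by blast
  next
    case (step j)
    obtain C1 where C1: "\<forall>n\<ge>1. \<forall>w. set w \<subseteq> {p \<in> wletters. fst p = j} \<longrightarrow> length w \<le> C * n ^ j \<longrightarrow>
        (\<exists>v\<in>ball (C1 * n) \<inter> lcs j. lc_proj j v = lc_proj j (wprod w))"
      using lc_proj_word_short[OF step.prems finite_wletters_weight subset_refl, of C] by blast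
    obtain C2 where C2: "\<forall>n\<ge>1. \<forall>g\<in>Wball 1 0 C1 n. g \<in> lcs j \<longrightarrow> g \<in> Wball j 0 C2 n"
      using Wball_inter_lcs[OF step.prems] by blast
    obtain C3 where C3: "\<forall>n\<ge>1. \<forall>g\<in>Wball j 0 (C2 + C) n. g \<in> lcs (Suc j) \<longrightarrow> g \<in> Wball (Suc j) 0 C3 n"
      using Wball_descend[OF step.prems] by blast
    obtain C4 where C4: "\<forall>n\<ge>1. Wball (Suc j) 0 C3 n \<subseteq> ball (C4 * n)"
      using step.IH[of C3] step.prems by auto
    have "u \<in> ball ((C1 + C4) * n)" if n: "n \<ge> 1" and u: "u \<in> Wball j 0 C n" for n u
    proof -
      obtain w where w: "set w \<subseteq> wletters" "wprod w = u" "\<And>k. wcount k w \<le> (if j \<le> k then C * n ^ (k - 0) else 0)"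
        using Wball_word[OF u] by blast
      let ?w = "filter (\<lambda>q. fst q = j) w"
      have "set ?w \<subseteq> {p \<in> wletters. fst p = j}" using w(1) by auto
      moreover have "length ?w \<le> C * n ^ j" using w(3)[of j] by (simp add: wcount_def)
      ultimately obtain v where v: "v \<in> ball (C1 * n)" "v \<in> lcs j" "lc_proj j v = lc_proj j (wprod ?w)"
        using C1 n by blast
      have "lc_proj j v = lc_proj j u"
        using v(3) lc_proj_wprod_top[OF step.prems w(1) word_weight_ge[OF w(3)]] w(2) by simp
      then have "inv v \<otimes> u \<in> lcs (Suc j)"
        using lc_proj_eq_iff ball_carrier[OF v(1)] Wball_carrier[OF u] by blast
      moreover have "inv v \<otimes> u \<in> Wball j 0 (C2 + C) n"
        using C2 n ball_Wball[OF v(1)] v(2) by (intro Wball_mult Wball_inv u) blast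
      ultimately have "inv v \<otimes> u \<in> ball (C4 * n)" using C3 C4 n by blast
      from ball_mult[OF v(1) this] show ?thesis
        using ball_carrier[OF v(1)] Wball_carrier[OF u] by (simp add: algebra_simps)
    qed
    then show ?case by blast
  qed
next
  case False
  have "Wball j 0 C n \<subseteq> ball (0 * n)" for n
    using Wball_lcs[of _ j 0 C n] lcs_trivial[of j] False gen_ball_one by auto
  then show ?thesis by blast
qed

end

section \<open>Counting layer by layer\<close>

lemma card_le_image_times_fibre:
  assumes "finite S" "\<And>y. y \<in> f ` S \<Longrightarrow> card {x \<in> S. f x = y} \<le> K"
  shows "card S \<le> card (f ` S) * K"
proof -
  have "S = (\<Union>y\<in>f ` S. {x \<in> S. f x = y})" by blast
  then have "card S \<le> (\<Sum>y\<in>f ` S. card {x \<in> S. f x = y})"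
    using card_UN_le[of "f ` S" "\<lambda>y. {x \<in> S. f x = y}"] assms(1) by simp
  also have "\<dots> \<le> (\<Sum>y\<in>f ` S. K)" using assms(2) by (rule sum_mono)
  finally show ?thesis by simp
qed

context group begin

text \<open>
  Two elements of a class of \<open>q\<close> differ by an element of \<open>B\<close>, so that a class is no larger than \<open>B\<close>.
\<close>
lemma card_le_classes:
  assumes A: "finite A" "A \<subseteq> carrier G" and B: "finite B"
    and quot: "\<And>x y. x \<in> A \<Longrightarrow> y \<in> A \<Longrightarrow> q x = q y \<Longrightarrow> inv x \<otimes> y \<in> B"
  shows "card A \<le> card (q ` A) * card B"
proof (rule card_le_image_times_fibre[OF A(1)])
  fix z assume "z \<in> q ` A"
  then obtain x where x: "x \<in> A" "z = q x" by blast
  have xc: "x \<in> carrier G" using x(1) A(2) by blast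
  have "(\<lambda>y. inv x \<otimes> y) ` {y \<in> A. q y = z} \<subseteq> B" using quot[OF x(1)] x(2) by auto
  moreover have "inj_on (\<lambda>y. inv x \<otimes> y) {y \<in> A. q y = z}"
    by (rule inj_onI) (use A(2) xc in \<open>auto simp: subset_iff\<close>)
  ultimately show "card {y \<in> A. q y = z} \<le> card B" using B card_inj_on_le by blast
qed

text \<open>
  Choose a representative in each class of \<open>A\<close>; multiplying it by elements of \<open>B\<close> stays in its class.
\<close>
lemma card_classes_times_le:
  assumes A: "A \<subseteq> carrier G" and B: "B \<subseteq> carrier G" and C: "finite C"
    and prod: "\<And>x b. x \<in> A \<Longrightarrow> b \<in> B \<Longrightarrow> x \<otimes> b \<in> C \<and> q (x \<otimes> b) = q x"
  shows "card (q ` A) * card B \<le> card C"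
proof -
  define s where "s = inv_into A q"
  have s: "s z \<in> A" "q (s z) = z" if "z \<in> q ` A" for z
    using that by (simp_all add: s_def inv_into_into f_inv_into_f)
  let ?f = "\<lambda>p. s (fst p) \<otimes> snd p"
  have "?f ` (q ` A \<times> B) \<subseteq> C" using prod s(1) by force
  moreover have "inj_on ?f (q ` A \<times> B)"
  proof (rule inj_onI)
    fix p p' assume p: "p \<in> q ` A \<times> B" and p': "p' \<in> q ` A \<times> B" and eq: "?f p = ?f p'"
    have val: "q (?f r) = fst r \<and> s (fst r) \<in> carrier G \<and> snd r \<in> carrier G" if "r \<in> q ` A \<times> B" for r
    proof -
      have "fst r \<in> q ` A" "snd r \<in> B" using that by (auto simp: mem_Times_iff)
      then show ?thesis using prod s[of "fst r"] A B by auto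
    qed
    have f: "fst p = fst p'" using val[OF p] val[OF p'] eq by metis
    moreover have "snd p = snd p'" using val[OF p] val[OF p'] eq f by (metis l_cancel)
    ultimately show "p = p'" by (rule prod_eqI)
  qed
  ultimately have "card (q ` A \<times> B) \<le> card C" using C card_inj_on_le by blast
  then show ?thesis by (simp add: card_cartesian_product)
qed

end

lemma (in comm_group) card_bounded_coordinates:
  assumes sys: "dual_system G B d \<chi> e" and B: "subgroup B G" and fin: "finite (null_part B d \<chi>)"
    and S: "S \<subseteq> B" "\<And>i x. i < d \<Longrightarrow> x \<in> S \<Longrightarrow> \<bar>\<chi> i x\<bar> \<le> int N"
  shows "card S \<le> (2 * N + 1) ^ d * card (null_part B d \<chi>)"
proof -
  define h where "h = (\<lambda>x. ((\<lambda>i\<in>{..<d}. \<chi> i x), x \<otimes> inv (lattice_part G d \<chi> e x)))"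
  let ?R = "({..<d} \<rightarrow>\<^sub>E {- int N..int N}) \<times> null_part B d \<chi>"
  have finR: "finite ?R" using fin by (intro finite_cartesian_product finite_PiE) auto
  have "h ` S \<subseteq> ?R"
  proof
    fix z assume "z \<in> h ` S"
    then obtain x where x: "x \<in> S" "z = h x" by blast
    have "(\<lambda>i\<in>{..<d}. \<chi> i x) \<in> {..<d} \<rightarrow>\<^sub>E {- int N..int N}"
    proof (intro restrict_PiE_iff[THEN iffD2] ballI)
      fix i assume "i \<in> {..<d}"
      then have "\<bar>\<chi> i x\<bar> \<le> int N" using S(2) x(1) by simp
      then show "\<chi> i x \<in> {- int N..int N}" unfolding atLeastAtMost_iff by linarith
    qed
    moreover have "x \<otimes> inv (lattice_part G d \<chi> e x) \<in> null_part B d \<chi>"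
      using lattice_part(3)[OF sys B] S(1) x(1) by blast
    ultimately show "z \<in> ?R" using x(2) by (simp add: h_def)
  qed
  moreover have "inj_on h S"
  proof (rule inj_onI)
    fix x y assume x: "x \<in> S" and y: "y \<in> S" and eq: "h x = h y"
    have "\<chi> i x = \<chi> i y" if "i < d" for i
    proof -
      have "(\<lambda>i\<in>{..<d}. \<chi> i x) i = (\<lambda>i\<in>{..<d}. \<chi> i y) i" using eq unfolding h_def by simp
      then show ?thesis using that by simp
    qed
    moreover have "x \<in> B" "y \<in> B" using x y S(1) by auto
    ultimately show "x = y" using eq dual_coordinates_inject[OF sys B] by (simp add: h_def)
  qed
  ultimately have "card S \<le> card ?R" using finR card_inj_on_le by blast
  also have "\<dots> = (2 * N + 1) ^ d * card (null_part B d \<chi>)"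
    by (simp add: card_cartesian_product card_PiE nat_add_distrib nat_mult_distrib flip: mult_2)
  finally show ?thesis .
qed

context fg_nilpotent begin

abbreviation lc_quot :: "nat \<Rightarrow> 'a set monoid" where "lc_quot \<equiv> lower_central_quotient G"

lemma lc_quot_simps [simp]:
  "carrier (lc_quot j) = lc_proj j ` lcs j"
  "U \<otimes>\<^bsub>lc_quot j\<^esub> V = U <#> V"
  "\<one>\<^bsub>lc_quot j\<^esub> = lcs (Suc j)"
proof -
  show "carrier (lc_quot j) = lc_proj j ` lcs j"
    by (simp add: lower_central_quotient_def carrier_FactGroup lower_central_proj_def)
  show "U \<otimes>\<^bsub>lc_quot j\<^esub> V = U <#> V" "\<one>\<^bsub>lc_quot j\<^esub> = lcs (Suc j)"
    by (simp_all add: lower_central_quotient_def)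
qed

lemma lc_quot_hom: "group_hom (G\<lparr>carrier := lcs j\<rparr>) (lc_quot j) (lc_proj j)"
proof -
  have N: "lcs (Suc j) \<lhd> G\<lparr>carrier := lcs j\<rparr>"
    by (rule normal_restrict_supergroup[OF lower_central_subgroup lower_central_normal lower_central_Suc_subset])
  have 1: "group (G\<lparr>carrier := lcs j\<rparr>)" using subgroup.subgroup_is_group[OF lower_central_subgroup is_group] .
  have 2: "group (lc_quot j)" unfolding lower_central_quotient_def using normal.factorgroup_is_group[OF N] by simp
  show ?thesis
  proof (intro group_hom.intro group_hom_axioms.intro 1 2 homI)
    fix x y assume "x \<in> carrier (G\<lparr>carrier := lcs j\<rparr>)" "y \<in> carrier (G\<lparr>carrier := lcs j\<rparr>)"
    then have "x \<in> carrier G" "y \<in> carrier G" using lower_central_carrier by auto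
    then show "lc_proj j (x \<otimes>\<^bsub>G\<lparr>carrier := lcs j\<rparr>\<^esub> y) = lc_proj j x \<otimes>\<^bsub>lc_quot j\<^esub> lc_proj j y" using lc_proj_mult by simp
  qed simp
qed

lemma lc_quot_comm_group: "j \<ge> 1 \<Longrightarrow> comm_group (lc_quot j)"
proof -
  assume j: "j \<ge> 1"
  interpret h: group_hom "G\<lparr>carrier := lcs j\<rparr>" "lc_quot j" "lc_proj j" by (rule lc_quot_hom)
  show ?thesis
  proof (rule h.H.group_comm_groupI)
    fix U V assume "U \<in> carrier (lc_quot j)" "V \<in> carrier (lc_quot j)"
    then obtain x y where xy: "U = lc_proj j x" "x \<in> lcs j" "V = lc_proj j y" "y \<in> lcs j" by auto
    then have c: "x \<in> carrier G" "y \<in> carrier G" using lower_central_carrier by auto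
    show "U \<otimes>\<^bsub>lc_quot j\<^esub> V = V \<otimes>\<^bsub>lc_quot j\<^esub> U"
      using lc_proj_commute[OF j c(1) xy(4)] lc_proj_mult c xy by simp
  qed
qed

lemma lc_quot_generated:
  assumes j: "j \<ge> 1"
  shows "generate (lc_quot j) (lc_proj j ` {x. (j, x) \<in> letters}) = carrier (lc_quot j)"
proof
  interpret A: comm_group "lc_quot j" by (rule lc_quot_comm_group[OF j])
  have lg: "x \<in> lcs j" if "(j, x) \<in> letters" for x using letters_lcs[OF that] by blast
  have sub: "lc_proj j ` {x. (j, x) \<in> letters} \<subseteq> carrier (lc_quot j)" using lg by auto
  show "generate (lc_quot j) (lc_proj j ` {x. (j, x) \<in> letters}) \<subseteq> carrier (lc_quot j)"
    using A.generate_incl[OF sub] .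
  show "carrier (lc_quot j) \<subseteq> generate (lc_quot j) (lc_proj j ` {x. (j, x) \<in> letters})"
  proof
    fix U assume "U \<in> carrier (lc_quot j)"
    then obtain g where g: "U = lc_proj j g" "g \<in> lcs j" by auto
    obtain w where w: "set w \<subseteq> wletters" "\<forall>p\<in>set w. j \<le> fst p" "wprod w = g" using lcs_word[OF j g(2)] by blast
    let ?w = "filter (\<lambda>q. fst q = j) w"
    have eq: "lc_proj j (wprod w) = lc_proj j (wprod ?w)" by (rule lc_proj_wprod_top[OF j w(1)]) (use w(2) in blast)
    have top: "lc_proj j (wprod v) \<in> generate (lc_quot j) (lc_proj j ` {x. (j, x) \<in> letters})"
      if "set v \<subseteq> {p \<in> wletters. fst p = j}" for v
      using that
    proof (induction v)
      case Nil
      have "lc_proj j \<one> = \<one>\<^bsub>lc_quot j\<^esub>" by (simp add: lc_proj_one)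
      then show ?case using generate.one[of "lc_quot j"] by (simp only: wprod_simps)
    next
      case (Cons p v)
      have p: "p \<in> wletters" "fst p = j" using Cons.prems by auto
      have "(j, snd p) \<in> letters" using p by (cases p) (auto simp: wletters_def)
      then have 1: "lc_proj j (snd p) \<in> generate (lc_quot j) (lc_proj j ` {x. (j, x) \<in> letters})"
        by (intro generate.incl) blast
      have 2: "lc_proj j (wprod v) \<in> generate (lc_quot j) (lc_proj j ` {x. (j, x) \<in> letters})"
        using Cons by simp
      have "wprod v \<in> carrier G" using Cons.prems by (intro wprod_closed) auto
      then have "lc_proj j (wprod (p # v)) = lc_proj j (snd p) \<otimes>\<^bsub>lc_quot j\<^esub> lc_proj j (wprod v)"
        using lc_proj_mult wletters_carrier[OF p(1)] by simp
      then show ?case using generate.eng[OF 1 2] by (simp only:)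
    qed
    have "set ?w \<subseteq> {p \<in> wletters. fst p = j}" using w(1) by auto
    from top[OF this] have "lc_proj j (wprod ?w) \<in> generate (lc_quot j) (lc_proj j ` {x. (j, x) \<in> letters})" .
    then show "U \<in> generate (lc_quot j) (lc_proj j ` {x. (j, x) \<in> letters})" unfolding g(1) w(3)[symmetric] eq .
  qed
qed

lemma lc_quot_generators:
  "finite (lc_proj j ` {x. (j, x) \<in> letters})" "lc_proj j ` {x. (j, x) \<in> letters} \<subseteq> carrier (lc_quot j)"
proof -
  show "finite (lc_proj j ` {x. (j, x) \<in> letters})" using finite_letters by blast
  have "{x. (j, x) \<in> letters} \<subseteq> lcs j" using letters_lcs by blast
  then show "lc_proj j ` {x. (j, x) \<in> letters} \<subseteq> carrier (lc_quot j)" unfolding lc_quot_simps(1) by (rule image_mono)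
qed

definition layer_image :: "'a set \<Rightarrow> nat \<Rightarrow> 'a set set" where
  "layer_image H j = lc_proj j ` (H \<inter> lcs j)"

definition layer :: "'a set \<Rightarrow> nat \<Rightarrow> nat \<Rightarrow> 'a set" where
  "layer H j n = ball n \<inter> H \<inter> lcs j"

lemma layer_finite: "finite (layer H j n)"
  unfolding layer_def by (intro finite_Int disjI1 ball_finite)

lemma layer_carrier: "x \<in> layer H j n \<Longrightarrow> x \<in> carrier G"
  unfolding layer_def by (rule ball_carrier[of x n]) blast

lemma layer_image_subgroup:
  assumes "subgroup H G"
  shows "subgroup (layer_image H j) (lc_quot j)"
proof -
  interpret h: group_hom "G\<lparr>carrier := lcs j\<rparr>" "lc_quot j" "lc_proj j" by (rule lc_quot_hom)
  have "subgroup (H \<inter> lcs j) G" using subgroups_Inter_pair[OF assms lower_central_subgroup] .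
  then have "subgroup (H \<inter> lcs j) (G\<lparr>carrier := lcs j\<rparr>)"
    using subgroup_incl lower_central_subgroup by blast
  then show ?thesis unfolding layer_image_def by (rule h.subgroup_img_is_subgroup)
qed

text \<open>
  By collection, the image of \<open>g\<close> is a sum of \<open>O(n\<^sup>j)\<close> images of letters of weight \<open>j\<close>; letters of
  higher weight vanish in the quotient.
\<close>
lemma additive_bounded_on_ball:
  assumes j: "j \<ge> 1" and \<chi>: "additive_on (lc_quot j) (carrier (lc_quot j)) \<chi>"
  shows "\<exists>K. \<forall>n\<ge>1. \<forall>g\<in>ball n \<inter> lcs j. \<bar>\<chi> (lc_proj j g)\<bar> \<le> int (K * n ^ j)"
proof -
  interpret A: comm_group "lc_quot j" by (rule lc_quot_comm_group[OF j])
  obtain C where C: "\<forall>n\<ge>1. \<forall>g\<in>Wball 1 0 1 n. g \<in> lcs j \<longrightarrow> g \<in> Wball j 0 C n" using Wball_inter_lcs[OF j] by blast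
  define B where "B = (\<Sum>p\<in>{p \<in> wletters. fst p = j}. nat \<bar>\<chi> (lc_proj j (snd p))\<bar>)"
  have bound: "\<bar>\<chi> (lc_proj j (wprod v))\<bar> \<le> int (length v * B)" if "set v \<subseteq> {p \<in> wletters. fst p = j}" for v
    using that
  proof (induction v)
    case Nil
    have "lc_proj j \<one> = \<one>\<^bsub>lc_quot j\<^esub>" by (simp add: lc_proj_one)
    then show ?case using A.additive_one[OF \<chi> A.subgroup_self] by simp
  next
    case (Cons p v)
    have p: "p \<in> wletters" "fst p = j" using Cons.prems by auto
    have v: "set v \<subseteq> wletters" "\<And>q. q \<in> set v \<Longrightarrow> j \<le> fst q" using Cons.prems by auto
    have pg: "snd p \<in> lcs j" using wletters_lcs[OF p(1)] p(2) by simp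
    have vg: "wprod v \<in> lcs j" by (rule wprod_lcs[OF v])
    have "lc_proj j (wprod (p # v)) = lc_proj j (snd p) \<otimes>\<^bsub>lc_quot j\<^esub> lc_proj j (wprod v)"
      using lc_proj_mult wletters_carrier[OF p(1)] wprod_closed[OF v(1)] by simp
    moreover have "lc_proj j (snd p) \<in> carrier (lc_quot j)" "lc_proj j (wprod v) \<in> carrier (lc_quot j)" using pg vg by auto
    ultimately have "\<chi> (lc_proj j (wprod (p # v))) = \<chi> (lc_proj j (snd p)) + \<chi> (lc_proj j (wprod v))"
      using additive_onD[OF \<chi>] by metis
    moreover have "nat \<bar>\<chi> (lc_proj j (snd p))\<bar> \<le> B"
      unfolding B_def using p finite_wletters_weight
      by (intro member_le_sum[of p _ "\<lambda>p. nat \<bar>\<chi> (lc_proj j (snd p))\<bar>"]) auto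
    moreover have "\<bar>\<chi> (lc_proj j (wprod v))\<bar> \<le> int (length v * B)" using Cons by simp
    ultimately show ?case by simp
  qed
  have "\<bar>\<chi> (lc_proj j g)\<bar> \<le> int (C * B * n ^ j)" if n: "n \<ge> 1" and g: "g \<in> ball n \<inter> lcs j" for n g
  proof -
    have "g \<in> Wball 1 0 1 n" using ball_Wball[of g 1 n] g by simp
    then have gW: "g \<in> Wball j 0 C n" using C n g by blast
    obtain w where w: "set w \<subseteq> wletters" "wprod w = g" "\<And>k. wcount k w \<le> (if j \<le> k then C * n ^ (k - 0) else 0)"
      using Wball_word[OF gW] by blast
    let ?w = "filter (\<lambda>q. fst q = j) w"
    have "set ?w \<subseteq> {p \<in> wletters. fst p = j}" using w(1) by auto
    from bound[OF this] have "\<bar>\<chi> (lc_proj j g)\<bar> \<le> int (length ?w * B)"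
      using lc_proj_wprod_top[OF j w(1) word_weight_ge[OF w(3)]] w(2) by simp
    moreover have "length ?w \<le> C * n ^ j" using w(3)[of j] by (simp add: wcount_def)
    then have "length ?w * B \<le> C * n ^ j * B" by (rule mult_le_mono1)
    then have "length ?w * B \<le> C * B * n ^ j" by (simp only: mult.assoc mult.commute[of B])
    ultimately show ?thesis by (meson of_nat_mono order_trans)
  qed
  then show ?thesis by blast
qed

text \<open>
  The coordinates on the image of \<open>H\<close> extend, up to a factor, to the whole of \<open>G\<^sub>j/G\<^bsub>j+1\<^esub>\<close>, where they
  are of size \<open>O(n\<^sup>j)\<close> on the ball. There are \<open>d\<close> of them, and they determine an element up to a
  finite group.
\<close>
lemma card_layer_image_le:
  assumes j: "j \<ge> 1" and H: "subgroup H G"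
    and sys: "dual_system (lc_quot j) (layer_image H j) d \<chi> e" and fin: "finite (null_part (layer_image H j) d \<chi>)"
  shows "\<exists>K. \<forall>n\<ge>1. card (lc_proj j ` layer H j n) \<le> K * n ^ (j * d)"
proof -
  interpret A: comm_group "lc_quot j" by (rule lc_quot_comm_group[OF j])
  note L = layer_image_subgroup[OF H, of j]
  have "\<exists>K. i < d \<longrightarrow> (\<forall>n\<ge>1. \<forall>z\<in>lc_proj j ` layer H j n. \<bar>\<chi> i z\<bar> \<le> int (K * n ^ j))" for i
  proof (cases "i < d")
    case True
    then have add: "additive_on (lc_quot j) (layer_image H j) (\<chi> i)" using sys by (simp add: dual_system_def)
    obtain c \<psi> where \<psi>: "c > 0" "additive_on (lc_quot j) (carrier (lc_quot j)) \<psi>" "\<forall>x\<in>layer_image H j. \<psi> x = c * \<chi> i x"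
      using A.additive_extend[OF L add lc_quot_generators lc_quot_generated[OF j]] by blast
    obtain K where K: "\<forall>n\<ge>1. \<forall>g\<in>ball n \<inter> lcs j. \<bar>\<psi> (lc_proj j g)\<bar> \<le> int (K * n ^ j)"
      using additive_bounded_on_ball[OF j \<psi>(2)] by blast
    have "\<bar>\<chi> i z\<bar> \<le> int (K * n ^ j)" if n: "n \<ge> 1" and z: "z \<in> lc_proj j ` layer H j n" for n z
    proof -
      obtain g where g: "z = lc_proj j g" "g \<in> ball n" "g \<in> H" "g \<in> lcs j" using z by (auto simp: layer_def)
      have "z \<in> layer_image H j" using g by (auto simp: layer_image_def)
      then have "\<psi> z = c * \<chi> i z" using \<psi>(3) by blast
      then have "\<bar>\<psi> z\<bar> = c * \<bar>\<chi> i z\<bar>" using \<psi>(1) by (simp add: abs_mult)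
      moreover have "1 * \<bar>\<chi> i z\<bar> \<le> c * \<bar>\<chi> i z\<bar>" using \<psi>(1) by (intro mult_right_mono) auto
      moreover have "\<bar>\<psi> z\<bar> \<le> int (K * n ^ j)" using K n g by blast
      ultimately show ?thesis by linarith
    qed
    then show ?thesis by blast
  qed blast
  then obtain K where K: "\<And>i n z. i < d \<Longrightarrow> n \<ge> 1 \<Longrightarrow> z \<in> lc_proj j ` layer H j n \<Longrightarrow> \<bar>\<chi> i z\<bar> \<le> int (K i * n ^ j)"
    by metis
  define K' where "K' = (\<Sum>i<d. K i)"
  have "card (lc_proj j ` layer H j n) \<le> (2 * K' + 1) ^ d * card (null_part (layer_image H j) d \<chi>) * n ^ (j * d)"
    if n: "n \<ge> 1" for n
  proof -
    have "card (lc_proj j ` layer H j n) \<le> (2 * (K' * n ^ j) + 1) ^ d * card (null_part (layer_image H j) d \<chi>)"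
    proof (rule A.card_bounded_coordinates[OF sys L fin])
      show "lc_proj j ` layer H j n \<subseteq> layer_image H j" by (auto simp: layer_def layer_image_def)
      fix i z assume i: "i < d" and z: "z \<in> lc_proj j ` layer H j n"
      have "K i \<le> K'" unfolding K'_def using i by (intro member_le_sum) auto
      then have "K i * n ^ j \<le> K' * n ^ j" by (rule mult_le_mono1)
      then have "int (K i * n ^ j) \<le> int (K' * n ^ j)" by (simp only: of_nat_le_iff)
      then show "\<bar>\<chi> i z\<bar> \<le> int (K' * n ^ j)" using K[OF i n z] by linarith
    qed
    also have "(2 * (K' * n ^ j) + 1) ^ d \<le> ((2 * K' + 1) * n ^ j) ^ d"
    proof (rule power_mono)
      have "1 \<le> n ^ j" using n by simp
      then show "2 * (K' * n ^ j) + 1 \<le> (2 * K' + 1) * n ^ j" by (simp add: algebra_simps)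
    qed simp
    also have "((2 * K' + 1) * n ^ j) ^ d = (2 * K' + 1) ^ d * n ^ (j * d)"
      by (simp only: power_mult_distrib power_mult)
    finally have "card (lc_proj j ` layer H j n) \<le> ((2 * K' + 1) ^ d * n ^ (j * d)) * card (null_part (layer_image H j) d \<chi>)"
      by simp
    then show ?thesis by (simp only: ac_simps)
  qed
  then show ?thesis by blast
qed

lemma pow_Wball:
  assumes j: "j \<ge> 1" and h: "h \<in> lcs j"
  shows "\<exists>C. \<forall>n\<ge>1. \<forall>a\<le>n ^ j. h [^] a \<in> Wball j 0 C n"
proof -
  obtain w where w: "set w \<subseteq> wletters" "\<forall>p\<in>set w. j \<le> fst p" "wprod w = h" using lcs_word[OF j h] by blast
  have hw: "h \<in> counted (\<lambda>k. wcount k w)" using countedI[OF w(1), of "\<lambda>k. wcount k w"] w(3) by simp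
  have pow: "h [^] a \<in> counted (\<lambda>k. a * wcount k w)" for a :: nat
  proof (induction a)
    case 0
    then show ?case using counted_one by simp
  next
    case (Suc a)
    then show ?case using counted_mult[OF Suc hw] by (simp add: add.commute)
  qed
  have "h [^] a \<in> Wball j 0 (length w) n" if n: "n \<ge> 1" and a: "a \<le> n ^ j" for n a
    unfolding Wball_def
  proof (rule counted_mono[OF pow])
    fix k
    show "a * wcount k w \<le> (if j \<le> k then length w * n ^ (k - 0) else 0)"
    proof (cases "j \<le> k")
      case True
      have "a \<le> n ^ k" using a power_increasing[OF True n] by linarith
      moreover have "wcount k w \<le> length w" by (simp add: wcount_def)
      ultimately have "a * wcount k w \<le> n ^ k * length w" by (rule mult_le_mono)
      then show ?thesis using True by (simp add: mult.commute)
    next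
      case False
      then have "filter (\<lambda>p. fst p = k) w = []" using w(2) unfolding filter_empty_conv by blast
      then show ?thesis by (simp add: wcount_def)
    qed
  qed
  then show ?thesis by blast
qed

text \<open>
  If \<open>h i \<in> H\<close> are lifts of the dual elements \<open>e i\<close>, then the products of powers of the \<open>h i\<close> with
  exponents below \<open>n\<^sup>j\<close> have length \<open>O(n)\<close> and are told apart by their coordinates.
\<close>
lemma card_layer_image_ge:
  assumes j: "j \<ge> 1" and H: "subgroup H G"
    and sys: "dual_system (lc_quot j) (layer_image H j) d \<chi> e"
  shows "\<exists>K. \<forall>n\<ge>1. n ^ (j * d) \<le> card (lc_proj j ` layer H j (K * n))"
proof -
  interpret A: comm_group "lc_quot j" by (rule lc_quot_comm_group[OF j])
  note L = layer_image_subgroup[OF H, of j]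
  have add: "additive_on (lc_quot j) (layer_image H j) (\<chi> i)" if "i < d" for i
    using sys that by (simp add: dual_system_def)
  have "\<exists>h. i < d \<longrightarrow> h \<in> H \<inter> lcs j \<and> lc_proj j h = e i" for i
  proof (cases "i < d")
    case True
    then have "e i \<in> lc_proj j ` (H \<inter> lcs j)" using sys unfolding dual_system_def layer_image_def by blast
    then show ?thesis by (metis imageE)
  qed blast
  then obtain h where h: "\<And>i. i < d \<Longrightarrow> h i \<in> H" "\<And>i. i < d \<Longrightarrow> h i \<in> lcs j" "\<And>i. i < d \<Longrightarrow> lc_proj j (h i) = e i"
    by (metis IntE)
  have "\<exists>C. i < d \<longrightarrow> (\<forall>n\<ge>1. \<forall>a\<le>n ^ j. h i [^] a \<in> Wball j 0 C n)" for i
    using pow_Wball[OF j h(2)] by (cases "i < d") auto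
  then obtain C where C: "\<And>i n a. i < d \<Longrightarrow> n \<ge> 1 \<Longrightarrow> a \<le> n ^ j \<Longrightarrow> h i [^] (a::nat) \<in> Wball j 0 (C i) n"
    by metis
  \<comment> \<open>\<open>Q a k\<close> is the product of the \<open>h i [^] a i\<close> over \<open>i < k\<close> in increasing order\<close>
  define Q where "Q = (\<lambda>(a :: nat \<Rightarrow> nat). rec_nat \<one> (\<lambda>k z. z \<otimes> h k [^] a k))"
  have Q: "Q a k \<in> H \<inter> lcs j \<and> (\<forall>n\<ge>1. (\<forall>i<k. a i \<le> n ^ j) \<longrightarrow> Q a k \<in> Wball j 0 (\<Sum>i<k. C i) n) \<and>
      (\<forall>i<d. \<chi> i (lc_proj j (Q a k)) = (if i < k then int (a i) else 0))" if "k \<le> d" for a k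
    using that
  proof (induction k)
    case 0
    have "lc_proj j \<one> = \<one>\<^bsub>lc_quot j\<^esub>" by (simp add: lc_proj_one)
    then have "\<chi> i (lc_proj j \<one>) = 0" if "i < d" for i using A.additive_one[OF add[OF that] L] by metis
    then show ?case
      using subgroup.one_closed[OF H] subgroup.one_closed[OF lower_central_subgroup[of j]] Wball_one
      by (simp add: Q_def)
  next
    case (Suc k)
    then have k: "k < d" "k \<le> d" by auto
    have IH: "Q a k \<in> H" "Q a k \<in> lcs j"
      "\<And>n. n \<ge> 1 \<Longrightarrow> \<forall>i<k. a i \<le> n ^ j \<Longrightarrow> Q a k \<in> Wball j 0 (\<Sum>i<k. C i) n"
      "\<And>i. i < d \<Longrightarrow> \<chi> i (lc_proj j (Q a k)) = (if i < k then int (a i) else 0)"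
      using Suc.IH[OF k(2)] by auto
    have QS: "Q a (Suc k) = Q a k \<otimes> h k [^] a k" by (simp add: Q_def)
    have hH: "h k [^] b \<in> H" for b :: nat
      by (induction b) (use subgroup.m_closed[OF H] subgroup.one_closed[OF H] h(1)[OF k(1)] in auto)
    have hg: "h k [^] a k \<in> lcs j" by (rule lower_central_pow[OF h(2)[OF k(1)]])
    have hc: "h k \<in> carrier G" "Q a k \<in> carrier G" using lower_central_carrier h(2)[OF k(1)] IH(2) by auto
    have pe: "lc_proj j (h k [^] b) \<in> layer_image H j \<and> (\<forall>i<d. \<chi> i (lc_proj j (h k [^] b)) = (if i = k then int b else 0))" for b :: nat
    proof (induction b)
      case 0
      have "lc_proj j \<one> = \<one>\<^bsub>lc_quot j\<^esub>" by (simp add: lc_proj_one)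
      then have "\<chi> i (lc_proj j \<one>) = 0" "lc_proj j \<one> \<in> layer_image H j" if "i < d" for i
        using A.additive_one[OF add[OF that] L] subgroup.one_closed[OF L] by metis+
      then show ?case using k(1) by auto
    next
      case (Suc b)
      have e: "e k \<in> layer_image H j" "\<And>i. i < d \<Longrightarrow> \<chi> i (e k) = (if i = k then 1 else 0)"
        using sys k(1) by (auto simp: dual_system_def)
      have eq: "lc_proj j (h k [^] Suc b) = lc_proj j (h k [^] b) \<otimes>\<^bsub>lc_quot j\<^esub> e k"
        using lc_proj_mult[of "h k [^] b" "h k"] hc(1) h(3)[OF k(1)] by simp
      show ?case unfolding eq
        using Suc.IH e subgroup.m_closed[OF L] additive_onD[OF add] by auto
    qed
    have eq: "lc_proj j (Q a (Suc k)) = lc_proj j (Q a k) \<otimes>\<^bsub>lc_quot j\<^esub> lc_proj j (h k [^] a k)"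
      using lc_proj_mult hc QS by simp
    have QL: "lc_proj j (Q a k) \<in> layer_image H j" using IH(1,2) by (auto simp: layer_image_def)
    have "\<chi> i (lc_proj j (Q a (Suc k))) = (if i < Suc k then int (a i) else 0)" if i: "i < d" for i
      unfolding eq using additive_onD[OF add[OF i] QL] pe[of "a k"] IH(4)[OF i] i by auto
    moreover have "Q a (Suc k) \<in> Wball j 0 (\<Sum>i<Suc k. C i) n" if "n \<ge> 1" "\<forall>i<Suc k. a i \<le> n ^ j" for n
    proof -
      have "Q a k \<in> Wball j 0 (\<Sum>i<k. C i) n" using IH(3) that by simp
      moreover have "h k [^] a k \<in> Wball j 0 (C k) n" using C[OF k(1)] that by simp
      ultimately show ?thesis using Wball_mult QS by simp
    qed
    moreover have "Q a (Suc k) \<in> H \<inter> lcs j"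
      unfolding QS using IH(1,2) hH hg subgroup.m_closed[OF H] subgroup.m_closed[OF lower_central_subgroup] by blast
    ultimately show ?case by blast
  qed
  obtain K where K: "\<forall>n\<ge>1. Wball j 0 (\<Sum>i<d. C i) n \<subseteq> ball (K * n)" using Wball_subset_ball[OF j] by blast
  have "n ^ (j * d) \<le> card (lc_proj j ` layer H j (K * n))" if n: "n \<ge> 1" for n
  proof -
    let ?D = "{..<d} \<rightarrow>\<^sub>E {..<n ^ j}"
    have "(\<lambda>a. lc_proj j (Q a d)) ` ?D \<subseteq> lc_proj j ` layer H j (K * n)"
    proof
      fix z assume "z \<in> (\<lambda>a. lc_proj j (Q a d)) ` ?D"
      then obtain a where a: "z = lc_proj j (Q a d)" "a \<in> ?D" by blast
      have "\<forall>i<d. a i \<le> n ^ j" using a(2) by (auto simp: PiE_iff less_imp_le)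
      then have "Q a d \<in> Wball j 0 (\<Sum>i<d. C i) n" "Q a d \<in> H \<inter> lcs j" using Q[of d a] n by auto
      then have "Q a d \<in> layer H j (K * n)" using K n by (auto simp: layer_def)
      then show "z \<in> lc_proj j ` layer H j (K * n)" using a(1) by blast
    qed
    moreover have "inj_on (\<lambda>a. lc_proj j (Q a d)) ?D"
    proof (rule inj_onI)
      fix a b assume a: "a \<in> ?D" and b: "b \<in> ?D" and eq: "lc_proj j (Q a d) = lc_proj j (Q b d)"
      show "a = b"
      proof (rule PiE_ext[OF a b])
        fix i assume "i \<in> {..<d}"
        then have "int (a i) = int (b i)" using Q[of d a] Q[of d b] eq by (metis lessThan_iff order_refl)
        then show "a i = b i" by simp
      qed
    qed
    ultimately have "card ?D \<le> card (lc_proj j ` layer H j (K * n))"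
      using layer_finite by (intro card_inj_on_le) auto
    then show ?thesis by (simp add: card_PiE power_mult)
  qed
  then show ?thesis by blast
qed

lemma card_layer_le:
  assumes H: "subgroup H G"
  shows "card (layer H j n) \<le> card (lc_proj j ` layer H j n) * card (layer H (Suc j) (2 * n))"
proof (rule card_le_classes[OF layer_finite _ layer_finite])
  show "layer H j n \<subseteq> carrier G" using layer_carrier by blast
  fix x y assume x: "x \<in> layer H j n" and y: "y \<in> layer H j n" and eq: "lc_proj j x = lc_proj j y"
  have "inv x \<otimes> y \<in> lcs (Suc j)" using lc_proj_eq_iff[OF layer_carrier[OF x] layer_carrier[OF y]] eq by blast
  moreover have "inv x \<otimes> y \<in> H"
    using x y subgroup.m_closed[OF H] subgroup.m_inv_closed[OF H] by (auto simp: layer_def)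
  moreover have "inv x \<otimes> y \<in> ball (n + n)" using x y by (intro ball_mult ball_inv) (auto simp: layer_def)
  ultimately show "inv x \<otimes> y \<in> layer H (Suc j) (2 * n)" by (simp add: layer_def mult_2)
qed

lemma card_layer_ge:
  assumes H: "subgroup H G"
  shows "card (lc_proj j ` layer H j a) * card (layer H (Suc j) b) \<le> card (layer H j (a + b))"
proof (rule card_classes_times_le[OF _ _ layer_finite])
  show "layer H j a \<subseteq> carrier G" "layer H (Suc j) b \<subseteq> carrier G" using layer_carrier by blast+
  fix x y assume x: "x \<in> layer H j a" and y: "y \<in> layer H (Suc j) b"
  have yj: "y \<in> lcs (Suc j)" using y by (simp add: layer_def)
  then have "y \<in> lcs j" using lower_central_Suc_subset[of j] by blast
  then have "x \<otimes> y \<in> lcs j" using x subgroup.m_closed[OF lower_central_subgroup] by (auto simp: layer_def)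
  moreover have "x \<otimes> y \<in> H" using x y subgroup.m_closed[OF H] by (auto simp: layer_def)
  moreover have "x \<otimes> y \<in> ball (a + b)" using x y by (intro ball_mult) (auto simp: layer_def)
  ultimately show "x \<otimes> y \<in> layer H j (a + b) \<and> lc_proj j (x \<otimes> y) = lc_proj j x"
    using lc_proj_absorb_right[OF layer_carrier[OF x] yj] by (simp add: layer_def)
qed

lemma layer_top: "layer H (Suc m) n = {\<one>} \<inter> H"
  using gen_ball_one lower_central_trivial by (auto simp: layer_def)

context
  fixes H :: "'a set" and d :: "nat \<Rightarrow> nat"
  assumes H: "subgroup H G"
    and d: "\<And>j. j \<ge> 1 \<Longrightarrow> \<exists>\<chi> e. dual_system (lc_quot j) (layer_image H j) (d j) \<chi> e \<and> finite (null_part (layer_image H j) (d j) \<chi>)"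
begin

text \<open>
  Multiplication over the layers. Passing to the fibre of the projection doubles the radius at each
  of the boundedly many steps.
\<close>
lemma layer_upper:
  assumes "j \<ge> 1" "j \<le> Suc m"
  shows "\<exists>K. \<forall>n\<ge>1. card (layer H j n) \<le> K * n ^ (\<Sum>i\<in>{j..m}. i * d i)"
  using assms(2,1)
proof (induction j rule: inc_induct)
  case base
  have "card (layer H (Suc m) n) \<le> 1" for n
    unfolding layer_top by (rule order_trans[OF card_mono[of "{\<one>}"]]) auto
  then show ?case by (intro exI[of _ 1]) simp
next
  case (step j)
  obtain K1 where K1: "\<forall>n\<ge>1. card (layer H (Suc j) n) \<le> K1 * n ^ (\<Sum>i\<in>{Suc j..m}. i * d i)" using step.IH by auto
  obtain K2 where K2: "\<forall>n\<ge>1. card (lc_proj j ` layer H j n) \<le> K2 * n ^ (j * d j)"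
    using d[OF step.prems] card_layer_image_le[OF step.prems H] by blast
  let ?E = "\<Sum>i\<in>{Suc j..m}. i * d i"
  have E: "(\<Sum>i\<in>{j..m}. i * d i) = j * d j + ?E" using step.hyps by (simp add: sum.atLeast_Suc_atMost)
  have "card (layer H j n) \<le> (K2 * (K1 * 2 ^ ?E)) * n ^ (\<Sum>i\<in>{j..m}. i * d i)" if n: "n \<ge> 1" for n
  proof -
    have "card (layer H j n) \<le> card (lc_proj j ` layer H j n) * card (layer H (Suc j) (2 * n))" by (rule card_layer_le[OF H])
    also have "\<dots> \<le> (K2 * n ^ (j * d j)) * (K1 * (2 * n) ^ ?E)"
      using K1[rule_format, of "2 * n"] K2[rule_format, OF n] n by (intro mult_le_mono) auto
    also have "\<dots> = (K2 * (K1 * 2 ^ ?E)) * n ^ (\<Sum>i\<in>{j..m}. i * d i)"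
      unfolding E by (simp add: power_add power_mult_distrib)
    finally show ?thesis .
  qed
  then show ?case by blast
qed

lemma layer_lower:
  assumes "j \<ge> 1" "j \<le> Suc m"
  shows "\<exists>K. \<forall>n\<ge>1. n ^ (\<Sum>i\<in>{j..m}. i * d i) \<le> card (layer H j (K * n))"
  using assms(2,1)
proof (induction j rule: inc_induct)
  case base
  have "layer H (Suc m) n = {\<one>}" for n using layer_top subgroup.one_closed[OF H] by auto
  then show ?case by simp
next
  case (step j)
  obtain K1 where K1: "\<forall>n\<ge>1. n ^ (\<Sum>i\<in>{Suc j..m}. i * d i) \<le> card (layer H (Suc j) (K1 * n))" using step.IH by auto
  obtain K2 where K2: "\<forall>n\<ge>1. n ^ (j * d j) \<le> card (lc_proj j ` layer H j (K2 * n))"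
    using d[OF step.prems] card_layer_image_ge[OF step.prems H] by blast
  have E: "(\<Sum>i\<in>{j..m}. i * d i) = j * d j + (\<Sum>i\<in>{Suc j..m}. i * d i)"
    using step.hyps by (simp add: sum.atLeast_Suc_atMost)
  have "n ^ (\<Sum>i\<in>{j..m}. i * d i) \<le> card (layer H j ((K2 + K1) * n))" if n: "n \<ge> 1" for n
  proof -
    have "n ^ (\<Sum>i\<in>{j..m}. i * d i) = n ^ (j * d j) * n ^ (\<Sum>i\<in>{Suc j..m}. i * d i)"
      unfolding E by (rule power_add)
    also have "\<dots> \<le> card (lc_proj j ` layer H j (K2 * n)) * card (layer H (Suc j) (K1 * n))"
      using K1 K2 n by (intro mult_le_mono) auto
    also have "\<dots> \<le> card (layer H j (K2 * n + K1 * n))" by (rule card_layer_ge[OF H])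
    finally show ?thesis by (simp add: algebra_simps)
  qed
  then show ?case by blast
qed

theorem card_ball_subgroup:
  "\<exists>K. \<forall>n\<ge>1. card (ball n \<inter> H) \<le> K * n ^ (\<Sum>i\<in>{1..m}. i * d i) \<and>
    n ^ (\<Sum>i\<in>{1..m}. i * d i) \<le> card (ball (K * n) \<inter> H)"
proof -
  have l: "layer H 1 n = ball n \<inter> H" for n
    unfolding layer_def using ball_carrier[of _ n] by auto
  obtain K1 where K1: "\<forall>n\<ge>1. card (ball n \<inter> H) \<le> K1 * n ^ (\<Sum>i\<in>{1..m}. i * d i)"
    using layer_upper[of 1] unfolding l by auto
  obtain K2 where K2: "\<forall>n\<ge>1. n ^ (\<Sum>i\<in>{1..m}. i * d i) \<le> card (ball (K2 * n) \<inter> H)"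
    using layer_lower[of 1] unfolding l by auto
  have "card (ball n \<inter> H) \<le> (K1 + K2) * n ^ (\<Sum>i\<in>{1..m}. i * d i)" if "n \<ge> 1" for n
    using K1 that by (auto simp: algebra_simps intro: trans_le_add1)
  moreover have "n ^ (\<Sum>i\<in>{1..m}. i * d i) \<le> card (ball ((K1 + K2) * n) \<inter> H)" if "n \<ge> 1" for n
  proof -
    have "card (ball (K2 * n) \<inter> H) \<le> card (ball ((K1 + K2) * n) \<inter> H)"
      using gen_ball_mono[of "K2 * n" "(K1 + K2) * n"] ball_finite by (intro card_mono) auto
    then show ?thesis using K2 that by (meson order_trans)
  qed
  ultimately show ?thesis by blast
qed

end

end

section \<open>Schreier graphs and growth exponents\<close>

lemma graph_ball_relpow: "graph_ball E x n = {y. \<exists>k\<le>n. (x, y) \<in> (E \<union> E\<inverse>) ^^ k}"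
proof -
  have "graph_dist E x y \<le> enat n \<longleftrightarrow> (\<exists>k\<le>n. (x, y) \<in> (E \<union> E\<inverse>) ^^ k)" for y
  proof
    assume le: "graph_dist E x y \<le> enat n"
    show "\<exists>k\<le>n. (x, y) \<in> (E \<union> E\<inverse>) ^^ k"
    proof (rule ccontr)
      assume none: "\<not> ?thesis"
      have "enat (Suc n) \<le> graph_dist E x y"
        unfolding graph_dist_def
      proof (rule Inf_greatest)
        fix z assume "z \<in> {enat k |k. (x, y) \<in> (E \<union> E\<inverse>) ^^ k}"
        then obtain k where k: "z = enat k" "(x, y) \<in> (E \<union> E\<inverse>) ^^ k" by blast
        then have "\<not> k \<le> n" using none by blast
        then show "enat (Suc n) \<le> z" using k(1) by simp
      qed
      then have "enat (Suc n) \<le> enat n" using le by (rule order_trans)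
      then show False by simp
    qed
  next
    assume "\<exists>k\<le>n. (x, y) \<in> (E \<union> E\<inverse>) ^^ k"
    then obtain k where k: "k \<le> n" "(x, y) \<in> (E \<union> E\<inverse>) ^^ k" by blast
    have "graph_dist E x y \<le> enat k" unfolding graph_dist_def by (rule Inf_lower) (use k in blast)
    also have "enat k \<le> enat n" using k by simp
    finally show "graph_dist E x y \<le> enat n" .
  qed
  then show ?thesis by (simp add: graph_ball_def)
qed

context group begin

text \<open>
  The Cayley graph and the Schreier graph at once: \<open>q\<close> is the identity or the map to left cosets, and
  the condition on \<open>q\<close> says that left multiplication descends to the vertices.
\<close>
lemma action_graph_relpow:
  assumes F: "F \<subseteq> carrier G"
    and act: "\<And>s x y. s \<in> carrier G \<Longrightarrow> x \<in> carrier G \<Longrightarrow> y \<in> carrier G \<Longrightarrow> q x = q y \<Longrightarrow> q (s \<otimes> x) = q (s \<otimes> y)"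
    and E: "E = {(q g, q (f \<otimes> g)) | f g. f \<in> F \<and> g \<in> carrier G}"
  shows "(q \<one>, z) \<in> (E \<union> E\<inverse>) ^^ k \<longleftrightarrow>
    (\<exists>xs. set xs \<subseteq> F \<union> (\<lambda>x. inv x) ` F \<and> length xs = k \<and> z = q (lprod G xs))"
proof (induction k arbitrary: z)
  case (Suc k)
  let ?S = "F \<union> (\<lambda>x. inv x) ` F"
  have step: "(q y, z) \<in> E \<union> E\<inverse> \<longleftrightarrow> (\<exists>s\<in>?S. z = q (s \<otimes> y))" if y: "y \<in> carrier G" for y z
  proof
    assume "(q y, z) \<in> E \<union> E\<inverse>"
    then consider f g where "f \<in> F" "g \<in> carrier G" "q y = q g" "z = q (f \<otimes> g)"
      | f g where "f \<in> F" "g \<in> carrier G" "q y = q (f \<otimes> g)" "z = q g"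
      unfolding E by blast
    then show "\<exists>s\<in>?S. z = q (s \<otimes> y)"
    proof cases
      case (1 f g)
      have "f \<in> carrier G" using 1(1) F by blast
      then have "z = q (f \<otimes> y)" using act[OF _ y 1(2,3)] 1(4) by simp
      then show ?thesis using 1(1) by blast
    next
      case (2 f g)
      have f: "f \<in> carrier G" using 2(1) F by blast
      have "z = q (inv f \<otimes> y)" using act[of "inv f" y "f \<otimes> g"] f y 2(2-4) by simp
      then show ?thesis using 2(1) by blast
    qed
  next
    assume "\<exists>s\<in>?S. z = q (s \<otimes> y)"
    then consider f where "f \<in> F" "z = q (f \<otimes> y)" | f where "f \<in> F" "z = q (inv f \<otimes> y)" by blast
    then show "(q y, z) \<in> E \<union> E\<inverse>"
    proof cases
      case 1
      then show ?thesis using y unfolding E by blast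
    next
      case (2 f)
      have f: "f \<in> carrier G" using 2(1) F by blast
      then have "q y = q (f \<otimes> (inv f \<otimes> y))" "inv f \<otimes> y \<in> carrier G" using y by simp_all
      then show ?thesis using 2 unfolding E by blast
    qed
  qed
  show ?case
  proof
    assume "(q \<one>, z) \<in> (E \<union> E\<inverse>) ^^ Suc k"
    then obtain u where u: "(q \<one>, u) \<in> (E \<union> E\<inverse>) ^^ k" "(u, z) \<in> E \<union> E\<inverse>" by (meson relpow_Suc_E)
    obtain xs where xs: "set xs \<subseteq> ?S" "length xs = k" "u = q (lprod G xs)" using u(1) Suc.IH by blast
    have "lprod G xs \<in> carrier G" using xs symm_carrier[OF F] by (auto intro!: lprod_closed)
    then obtain s where "s \<in> ?S" "z = q (s \<otimes> lprod G xs)" using step u(2) xs(3) by blast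
    then show "\<exists>xs. set xs \<subseteq> ?S \<and> length xs = Suc k \<and> z = q (lprod G xs)"
      using xs by (intro exI[of _ "s # xs"]) simp
  next
    assume "\<exists>xs. set xs \<subseteq> ?S \<and> length xs = Suc k \<and> z = q (lprod G xs)"
    then obtain s xs where xs: "s \<in> ?S" "set xs \<subseteq> ?S" "length xs = k" "z = q (s \<otimes> lprod G xs)"
      by (metis length_Suc_conv list.set_intros(1) lprod_simps(2) set_subset_Cons subset_code(1))
    have "lprod G xs \<in> carrier G" using xs(2) symm_carrier[OF F] by (auto intro!: lprod_closed)
    then have "(q (lprod G xs), z) \<in> E \<union> E\<inverse>" using step xs by blast
    moreover have "(q \<one>, q (lprod G xs)) \<in> (E \<union> E\<inverse>) ^^ k" using Suc.IH xs by blast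
    ultimately show "(q \<one>, z) \<in> (E \<union> E\<inverse>) ^^ Suc k" by (rule relpow_Suc_I[rotated])
  qed
qed auto

lemma action_graph_ball:
  assumes "F \<subseteq> carrier G"
    and "\<And>s x y. s \<in> carrier G \<Longrightarrow> x \<in> carrier G \<Longrightarrow> y \<in> carrier G \<Longrightarrow> q x = q y \<Longrightarrow> q (s \<otimes> x) = q (s \<otimes> y)"
  shows "graph_ball {(q g, q (f \<otimes> g)) | f g. f \<in> F \<and> g \<in> carrier G} (q \<one>) n = q ` gen_ball F n"
proof -
  define E where "E = {(q g, q (f \<otimes> g)) | f g. f \<in> F \<and> g \<in> carrier G}"
  have rel: "(q \<one>, z) \<in> (E \<union> E\<inverse>) ^^ k \<longleftrightarrow>
      (\<exists>xs. set xs \<subseteq> F \<union> (\<lambda>x. inv x) ` F \<and> length xs = k \<and> z = q (lprod G xs))" for z k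
    by (rule action_graph_relpow[OF assms(1) _ E_def]) (rule assms(2))
  have "graph_ball E (q \<one>) n = q ` gen_ball F n" unfolding graph_ball_relpow rel gen_ball_def by auto
  then show ?thesis by (simp only: E_def)
qed

lemma word_ball_eq: "F \<subseteq> carrier G \<Longrightarrow> word_ball G F n = gen_ball F n"
  using action_graph_ball[of F "\<lambda>g. g" n] by (simp add: word_ball_def cayley_edges_def)

lemma schreier_ball_eq:
  assumes F: "F \<subseteq> carrier G" and H: "subgroup H G"
  shows "schreier_ball G F H n = (\<lambda>g. g <# H) ` gen_ball F n"
  unfolding schreier_ball_def schreier_edges_def
proof (rule action_graph_ball[OF F])
  fix s x y assume c: "s \<in> carrier G" "x \<in> carrier G" "y \<in> carrier G" and eq: "x <# H = y <# H"
  show "(s \<otimes> x) <# H = (s \<otimes> y) <# H"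
    using lcos_m_assoc[OF subgroup.subset[OF H] c(1,2)] lcos_m_assoc[OF subgroup.subset[OF H] c(1,3)] eq
    by simp
qed

lemma lcos_eq_imp:
  assumes H: "subgroup H G" and x: "x \<in> carrier G" and y: "y \<in> carrier G" and eq: "x <# H = y <# H"
  shows "inv x \<otimes> y \<in> H"
proof -
  have "y \<otimes> \<one> \<in> y <# H" using subgroup.one_closed[OF H] unfolding l_coset_def by blast
  then have "y \<in> x <# H" using eq y by simp
  then obtain h where h: "h \<in> H" "y = x \<otimes> h" unfolding l_coset_def by blast
  then have "inv x \<otimes> y = h" using x subgroup.mem_carrier[OF H] by simp
  then show ?thesis using h by simp
qed

lemma card_gen_ball_le:
  assumes F: "finite F" "F \<subseteq> carrier G" and H: "subgroup H G"
  shows "card (gen_ball F n) \<le> card ((\<lambda>g. g <# H) ` gen_ball F n) * card (gen_ball F (2 * n) \<inter> H)"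
proof (rule card_le_classes)
  have c: "x \<in> carrier G" if "x \<in> gen_ball F n" for x using gen_ball_carrier[OF F(2) that] .
  then show "gen_ball F n \<subseteq> carrier G" by blast
  show "finite (gen_ball F n)" "finite (gen_ball F (2 * n) \<inter> H)" using gen_ball_finite[OF F(1)] by auto
  fix x y assume x: "x \<in> gen_ball F n" and y: "y \<in> gen_ball F n" and eq: "x <# H = y <# H"
  have "inv x \<otimes> y \<in> H" by (rule lcos_eq_imp[OF H c[OF x] c[OF y] eq])
  moreover have "inv x \<otimes> y \<in> gen_ball F (n + n)" by (intro gen_ball_mult[OF F(2)] gen_ball_inv[OF F(2)] x y)
  ultimately show "inv x \<otimes> y \<in> gen_ball F (2 * n) \<inter> H" by (simp add: mult_2)
qed

lemma card_gen_ball_ge: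
  assumes F: "finite F" "F \<subseteq> carrier G" and H: "subgroup H G"
  shows "card ((\<lambda>g. g <# H) ` gen_ball F n) * card (gen_ball F n \<inter> H) \<le> card (gen_ball F (2 * n))"
proof (rule card_classes_times_le[OF _ _ gen_ball_finite[OF F(1)]])
  have c: "x \<in> carrier G" if "x \<in> gen_ball F n" for x using gen_ball_carrier[OF F(2) that] .
  then show "gen_ball F n \<subseteq> carrier G" "gen_ball F n \<inter> H \<subseteq> carrier G" by blast+
  fix x h assume x: "x \<in> gen_ball F n" and h: "h \<in> gen_ball F n \<inter> H"
  have "x \<otimes> h \<in> gen_ball F (n + n)" using gen_ball_mult[OF F(2) x] h by blast
  moreover have "x \<otimes> h \<in> x <# H" using h unfolding l_coset_def by blast
  from l_repr_independence[OF this c[OF x] H] have "(x \<otimes> h) <# H = x <# H" ..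
  ultimately show "x \<otimes> h \<in> gen_ball F (2 * n) \<and> (x \<otimes> h) <# H = x <# H" by (simp add: mult_2)
qed

end

text \<open>
  The lower bound is known only at multiples of \<open>K\<close>; monotonicity fills the gaps at the expense of
  the constant.
\<close>
lemma growth_equiv_power:
  fixes f :: "nat \<Rightarrow> nat"
  assumes mono: "mono f" and K: "\<forall>n\<ge>1. f n \<le> K * n ^ D \<and> n ^ D \<le> f (K * n)"
  shows "growth_equiv (\<lambda>n. real (f n)) (\<lambda>n. real n ^ D)"
  unfolding growth_equiv_def
proof (intro exI conjI)
  define K' where "K' = K + 1"
  define C where "C = real ((2 * K') ^ D + K)"
  have C1: "real ((2 * K') ^ D) \<le> C" "real ((2 * K') ^ D) \<ge> 1" by (simp_all add: C_def K'_def)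
  show C: "C > 0" using C1 by linarith
  show "\<forall>\<^sub>F n in sequentially. 1 / C \<le> real (f n) / real n ^ D \<and> real (f n) / real n ^ D \<le> C"
    unfolding eventually_sequentially
  proof (intro exI[of _ K'] allI impI)
    fix n assume n: "K' \<le> n"
    then have n1: "n \<ge> 1" by (simp add: K'_def)
    \<comment> \<open>the largest multiple of \<open>K'\<close> below \<open>n\<close> is at least \<open>n / 2\<close>\<close>
    define q where "q = n div K'"
    have K'p: "K' > 0" by (simp add: K'_def)
    have q1: "q \<ge> 1" using n K'p by (simp add: q_def Suc_le_eq div_greater_zero_iff)
    have qn: "K * q \<le> n"
    proof -
      have "K * q \<le> q * K'" by (simp add: K'_def)
      also have "\<dots> \<le> n" by (simp add: q_def)
      finally show ?thesis .
    qed
    have "n = q * K' + n mod K'" by (simp add: q_def)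
    moreover have "n mod K' \<le> K'" using K'p by (simp add: less_imp_le)
    moreover have "K' \<le> q * K'" using q1 by simp
    ultimately have "n \<le> q * K' + q * K'" by linarith
    then have "n \<le> 2 * K' * q" by (simp add: algebra_simps)
    then have "n ^ D \<le> (2 * K' * q) ^ D" by (rule power_mono) simp
    also have "\<dots> = (2 * K') ^ D * q ^ D" by (rule power_mult_distrib)
    also have "\<dots> \<le> (2 * K') ^ D * f n"
    proof (rule mult_le_mono2)
      have "q ^ D \<le> f (K * q)" using K q1 by blast
      also have "\<dots> \<le> f n" using monoD[OF mono qn] .
      finally show "q ^ D \<le> f n" .
    qed
    finally have "real (n ^ D) \<le> real ((2 * K') ^ D * f n)" by (simp only: of_nat_le_iff)
    then have "real n ^ D \<le> real ((2 * K') ^ D) * real (f n)" by simp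
    also have "\<dots> \<le> C * real (f n)" using C1(1) by (rule mult_right_mono) simp
    finally have lo: "real n ^ D \<le> C * real (f n)" .
    have "f n \<le> K * n ^ D" using K n1 by blast
    then have "real (f n) \<le> real (K * n ^ D)" by (simp only: of_nat_le_iff)
    also have "\<dots> = real K * real n ^ D" by simp
    also have "\<dots> \<le> C * real n ^ D" by (rule mult_right_mono) (simp_all add: C_def)
    finally have up: "real (f n) \<le> C * real n ^ D" .
    have p: "real n ^ D > 0" using n1 by simp
    show "1 / C \<le> real (f n) / real n ^ D \<and> real (f n) / real n ^ D \<le> C"
      using lo up p C by (simp add: divide_simps mult.commute)
  qed
qed

text \<open>
  Doubling the argument changes a power of \<open>n\<close> only by a constant, so that the two inequalities
  determine \<open>b\<close> up to a constant.
\<close>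
lemma growth_equiv_quotient:
  fixes b g h :: "nat \<Rightarrow> nat"
  assumes g: "growth_equiv (\<lambda>n. real (g n)) (\<lambda>n. real n ^ DG)"
    and h: "growth_equiv (\<lambda>n. real (h n)) (\<lambda>n. real n ^ DH)"
    and le: "\<And>n. g n \<le> b n * h (2 * n)" and ge: "\<And>n. b n * h n \<le> g (2 * n)"
  shows "growth_equiv (\<lambda>n. real (b n)) (\<lambda>n. real n powr (real DG - real DH))"
proof -
  obtain Cg where Cg: "Cg > 0" "\<forall>\<^sub>F n in sequentially. 1 / Cg \<le> real (g n) / real n ^ DG \<and> real (g n) / real n ^ DG \<le> Cg"
    using g unfolding growth_equiv_def by blast
  obtain Ch where Ch: "Ch > 0" "\<forall>\<^sub>F n in sequentially. 1 / Ch \<le> real (h n) / real n ^ DH \<and> real (h n) / real n ^ DH \<le> Ch"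
    using h unfolding growth_equiv_def by blast
  obtain Ng where Ng: "\<And>n. n \<ge> Ng \<Longrightarrow> 1 / Cg \<le> real (g n) / real n ^ DG \<and> real (g n) / real n ^ DG \<le> Cg"
    using Cg(2) unfolding eventually_sequentially by blast
  obtain Nh where Nh: "\<And>n. n \<ge> Nh \<Longrightarrow> 1 / Ch \<le> real (h n) / real n ^ DH \<and> real (h n) / real n ^ DH \<le> Ch"
    using Ch(2) unfolding eventually_sequentially by blast
  have gb: "real n ^ DG \<le> Cg * real (g n) \<and> real (g n) \<le> Cg * real n ^ DG" if "n \<ge> Ng" "n \<ge> 1" for n
    using Ng[OF that(1)] that(2) Cg(1) by (simp add: divide_simps mult.commute)
  have hb: "real n ^ DH \<le> Ch * real (h n) \<and> real (h n) \<le> Ch * real n ^ DH" if "n \<ge> Nh" "n \<ge> 1" for n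
    using Nh[OF that(1)] that(2) Ch(1) by (simp add: divide_simps mult.commute)
  define C where "C = Cg * Ch * 2 ^ DG * 2 ^ DH"
  have C: "C > 0" using Cg(1) Ch(1) by (simp add: C_def)
  show ?thesis
    unfolding growth_equiv_def eventually_sequentially
  proof (intro exI[of _ C] conjI C exI[of _ "Ng + Nh + 1"] allI impI)
    fix n assume n: "n \<ge> Ng + Nh + 1"
    define P where "P = real n ^ DG"
    define Q where "Q = real n ^ DH"
    have n0: "real n > 0" using n by simp
    have PQ: "P > 0" "Q > 0" using n0 by (simp_all add: P_def Q_def)
    have pw: "real n powr (real DG - real DH) = P / Q"
      using n0 by (simp add: powr_diff powr_realpow P_def Q_def)
    have g1: "P \<le> Cg * real (g n)" using gb[of n] n by (simp add: P_def)
    have g2: "real (g (2 * n)) \<le> Cg * (2 ^ DG * P)" using gb[of "2 * n"] n by (simp add: P_def power_mult_distrib)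
    have h1: "Q \<le> Ch * real (h n)" using hb[of n] n by (simp add: Q_def)
    have h2: "real (h (2 * n)) \<le> Ch * (2 ^ DH * Q)" using hb[of "2 * n"] n by (simp add: Q_def power_mult_distrib)
    have le': "real (g n) \<le> real (b n) * real (h (2 * n))" using le[of n] by (metis of_nat_le_iff of_nat_mult)
    have ge': "real (b n) * real (h n) \<le> real (g (2 * n))" using ge[of n] by (metis of_nat_le_iff of_nat_mult)
    have one: "(1::real) \<le> 2 ^ DG" "(1::real) \<le> 2 ^ DH" by simp_all
    have "P \<le> Cg * (real (b n) * real (h (2 * n)))"
      using g1 mult_left_mono[OF le', of Cg] Cg(1) by linarith
    also have "\<dots> \<le> Cg * (real (b n) * (Ch * (2 ^ DH * Q)))"
      using h2 Cg(1) by (intro mult_left_mono) auto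
    also have "\<dots> = (Cg * Ch * 2 ^ DH * real (b n) * Q) * 1" by simp
    also have "\<dots> \<le> (Cg * Ch * 2 ^ DH * real (b n) * Q) * 2 ^ DG"
      using one(1) Cg(1) Ch(1) PQ by (intro mult_left_mono) auto
    also have "\<dots> = C * real (b n) * Q" by (simp add: C_def)
    finally have lo: "P \<le> C * real (b n) * Q" .
    have "real (b n) * Q \<le> real (b n) * (Ch * real (h n))" using h1 by (rule mult_left_mono) simp
    also have "\<dots> = Ch * (real (b n) * real (h n))" by simp
    also have "\<dots> \<le> Ch * (Cg * (2 ^ DG * P))"
      using ge' g2 Ch(1) by (intro mult_left_mono) auto
    also have "\<dots> = (Cg * Ch * 2 ^ DG * P) * 1" by simp
    also have "\<dots> \<le> (Cg * Ch * 2 ^ DG * P) * 2 ^ DH"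
      using one(2) Cg(1) Ch(1) PQ by (intro mult_left_mono) auto
    also have "\<dots> = C * P" by (simp add: C_def)
    finally have up: "real (b n) * Q \<le> C * P" .
    show "1 / C \<le> real (b n) / real n powr (real DG - real DH)"
      "real (b n) / real n powr (real DG - real DH) \<le> C"
      unfolding pw using lo up PQ C by (simp_all add: divide_simps mult.commute mult.left_commute)
  qed
qed

lemma growth_equiv_log_ratio:
  assumes "growth_equiv a (\<lambda>n. real n powr s)"
  shows "log_ratio a \<longlonglongrightarrow> s"
proof -
  obtain C where C: "C > 0" "\<forall>\<^sub>F n in sequentially. 1 / C \<le> a n / real n powr s \<and> a n / real n powr s \<le> C"
    using assms unfolding growth_equiv_def by blast
  have "filterlim (\<lambda>n. ln (real n)) at_infinity sequentially"
    by (rule filterlim_at_top_imp_at_infinity[OF filterlim_compose[OF ln_at_top filterlim_real_sequentially]])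
  then have lim: "(\<lambda>n. ln C / ln (real n)) \<longlonglongrightarrow> 0"
    by (rule tendsto_divide_0[OF tendsto_const])
  have "\<forall>\<^sub>F n in sequentially. norm (log_ratio a n - s) \<le> ln C / ln (real n)"
    using C(2) eventually_ge_at_top[of 2]
  proof eventually_elim
    case (elim n)
    define t where "t = a n / real n powr s"
    have n: "real n > 1" "ln (real n) > 0" using elim(2) by auto
    have t: "1 / C \<le> t" "t \<le> C" using elim(1) by (auto simp: t_def)
    have tp: "t > 0" using t(1) C(1) by (meson divide_pos_pos less_le_trans zero_less_one)
    have "ln t \<le> ln C" using t tp C(1) by simp
    moreover have "ln (1 / C) \<le> ln t" using t tp C(1) by (subst ln_le_cancel_iff) auto
    then have "- ln C \<le> ln t" using C(1) by (simp add: ln_div)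
    ultimately have abs: "\<bar>ln t\<bar> \<le> ln C" by linarith
    have "a n = t * real n powr s" using n by (simp add: t_def)
    then have "ln (a n) = ln t + s * ln (real n)" using tp n by (simp add: ln_mult ln_powr)
    then have "log_ratio a n - s = ln t / ln (real n)"
      using n(2) by (simp add: log_ratio_def field_simps)
    then show ?case using abs n(2) by (simp add: divide_right_mono)
  qed
  then have "(\<lambda>n. norm (log_ratio a n - s)) \<longlonglongrightarrow> 0"
    by (intro tendsto_sandwich[OF _ _ tendsto_const lim]) auto
  then have "(\<lambda>n. log_ratio a n - s) \<longlonglongrightarrow> 0" by (rule tendsto_norm_zero_cancel)
  then show ?thesis by (simp add: LIM_zero_iff)
qed

lemma growth_equiv_power_powr:
  assumes "growth_equiv a (\<lambda>n. real n ^ D)"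
  shows "growth_equiv a (\<lambda>n. real n powr real D)"
proof -
  obtain C where C: "C > 0" "\<forall>\<^sub>F n in sequentially. 1 / C \<le> a n / real n ^ D \<and> a n / real n ^ D \<le> C"
    using assms unfolding growth_equiv_def by blast
  have "\<forall>\<^sub>F n in sequentially. 1 / C \<le> a n / real n powr real D \<and> a n / real n powr real D \<le> C"
    using C(2) eventually_gt_at_top[of 0] by eventually_elim (simp add: powr_realpow)
  then show ?thesis unfolding growth_equiv_def using C(1) by blast
qed

context fg_nilpotent begin

lemma lc_rel_rank_dual_system:
  assumes H: "subgroup H G" and j: "j \<ge> 1"
  shows "\<exists>\<chi> e. dual_system (lc_quot j) (layer_image H j) (lc_rel_rank G H j) \<chi> e \<and>
    finite (null_part (layer_image H j) (lc_rel_rank G H j) \<chi>)"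
proof -
  interpret A: comm_group "lc_quot j" by (rule lc_quot_comm_group[OF j])
  note L = layer_image_subgroup[OF H, of j]
  obtain d \<chi> e where sys: "dual_system (lc_quot j) (layer_image H j) d \<chi> e" "finite (null_part (layer_image H j) d \<chi>)"
    using A.dual_system_exists[OF L lc_quot_generators lc_quot_generated[OF j]] by blast
  have "lc_rel_rank G H j = d"
    using A.abelian_rank_dual_system[OF L sys] by (simp add: lc_rel_rank_def layer_image_def)
  then show ?thesis using sys by blast
qed

lemma lc_rel_rank_zero:
  assumes H: "subgroup H G" and j: "j > m"
  shows "lc_rel_rank G H j = 0"
proof -
  have j1: "j \<ge> 1" using j by simp
  interpret A: comm_group "lc_quot j" by (rule lc_quot_comm_group[OF j1])
  note L = layer_image_subgroup[OF H, of j]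
  have sys: "dual_system (lc_quot j) (layer_image H j) 0 \<chi> e" for \<chi> e by (simp add: dual_system_def)
  have "finite (layer_image H j)" unfolding layer_image_def lcs_trivial[OF j] by simp
  then have "finite (null_part (layer_image H j) 0 \<chi>)" for \<chi> by (simp add: null_part_def)
  from A.abelian_rank_dual_system[OF L sys this] show ?thesis by (simp add: lc_rel_rank_def layer_image_def)
qed

text \<open>
  So the growth of \<open>G\<close> is the special case \<open>H = G\<close> of the relative growth.
\<close>
lemma lc_rank_carrier: "lc_rank G j = lc_rel_rank G (carrier G) j"
proof -
  have "carrier G \<inter> lcs j = lcs j" using lower_central_carrier[of _ j] by blast
  then have "lc_proj j ` (carrier G \<inter> lcs j) = carrier (lc_quot j)" by simp
  then show ?thesis unfolding lc_rank_def lc_rel_rank_def by (simp del: lc_quot_simps)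
qed

lemma rel_hom_dim_sum:
  assumes "subgroup H G"
  shows "rel_hom_dim G H = (\<Sum>j\<in>{1..m}. j * lc_rel_rank G H j)"
  unfolding rel_hom_dim_def
proof (rule suminf_finite)
  fix j assume "j \<notin> {1..m}"
  then have "j = 0 \<or> j > m" by auto
  then show "j * lc_rel_rank G H j = 0" using lc_rel_rank_zero[OF assms] by auto
qed simp

lemma hom_dim_carrier: "hom_dim G = rel_hom_dim G (carrier G)"
  unfolding hom_dim_def rel_hom_dim_def lc_rank_carrier ..

lemma suminf_rank_difference:
  assumes "subgroup H G"
  shows "suminf (\<lambda>j. real j * (real (lc_rank G j) - real (lc_rel_rank G H j))) = real (hom_dim G) - real (rel_hom_dim G H)"
proof -
  have "suminf (\<lambda>j. real j * (real (lc_rank G j) - real (lc_rel_rank G H j))) =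
      (\<Sum>j\<in>{1..m}. real j * (real (lc_rank G j) - real (lc_rel_rank G H j)))"
  proof (rule suminf_finite)
    fix j assume "j \<notin> {1..m}"
    then have "j = 0 \<or> j > m" by auto
    then show "real j * (real (lc_rank G j) - real (lc_rel_rank G H j)) = 0"
      using lc_rel_rank_zero[OF assms] lc_rel_rank_zero[OF subgroup_self] lc_rank_carrier by auto
  qed simp
  also have "\<dots> = real (\<Sum>j\<in>{1..m}. j * lc_rank G j) - real (\<Sum>j\<in>{1..m}. j * lc_rel_rank G H j)"
    by (simp add: sum_subtractf right_diff_distrib)
  also have "(\<Sum>j\<in>{1..m}. j * lc_rank G j) = hom_dim G"
    unfolding hom_dim_carrier rel_hom_dim_sum[OF subgroup_self] lc_rank_carrier ..
  finally show ?thesis by (simp add: rel_hom_dim_sum[OF assms])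
qed

lemma rel_growth_equiv:
  assumes H: "subgroup H G"
  shows "growth_equiv (\<lambda>n. real (card (ball n \<inter> H))) (\<lambda>n. real n ^ rel_hom_dim G H)"
proof -
  have "mono (\<lambda>n. card (ball n \<inter> H))"
    using gen_ball_mono ball_finite by (intro monoI card_mono) blast+
  then show ?thesis
    using card_ball_subgroup[OF H lc_rel_rank_dual_system[OF H]] growth_equiv_power
    unfolding rel_hom_dim_sum[OF H] by blast
qed

lemma schreier_growth_equiv:
  assumes H: "subgroup H G"
  shows "growth_equiv (\<lambda>n. real (card ((\<lambda>g. g <# H) ` ball n)))
    (\<lambda>n. real n powr (real (hom_dim G) - real (rel_hom_dim G H)))"
proof (rule growth_equiv_quotient)
  show "growth_equiv (\<lambda>n. real (card (ball n))) (\<lambda>n. real n ^ hom_dim G)"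
  proof -
    have "ball n \<inter> carrier G = ball n" for n using ball_carrier[of _ n] by blast
    then show ?thesis using rel_growth_equiv[OF subgroup_self] by (simp add: hom_dim_carrier)
  qed
  show "growth_equiv (\<lambda>n. real (card (ball n \<inter> H))) (\<lambda>n. real n ^ rel_hom_dim G H)"
    by (rule rel_growth_equiv[OF H])
  show "card (ball n) \<le> card ((\<lambda>g. g <# H) ` ball n) * card (ball (2 * n) \<inter> H)" for n
    by (rule card_gen_ball_le[OF F_finite F_carrier H])
  show "card ((\<lambda>g. g <# H) ` ball n) * card (ball n \<inter> H) \<le> card (ball (2 * n))" for n
    by (rule card_gen_ball_ge[OF F_finite F_carrier H])
qed

end

theorem theorem5:
  fixes G :: "('a, 'b) monoid_scheme" and F H :: "'a set"
  assumes "nilpotent_group G"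
    and "finite F" and "F \<subseteq> carrier G" and "generate G F = carrier G"
    and "subgroup H G"
  shows "convergent (log_ratio (rel_growth_fun G F H)) \<and>
         rel_growth G F H = real (rel_hom_dim G H) \<and>
         convergent (log_ratio (schreier_growth_fun G F H)) \<and>
         schreier_growth G F H = suminf (\<lambda>j. real j * (real (lc_rank G j) - real (lc_rel_rank G H j))) \<and>
         schreier_growth G F H = real (hom_dim G) - real (rel_hom_dim G H) \<and>
         growth_equiv (rel_growth_fun G F H) (\<lambda>n. real n ^ rel_hom_dim G H) \<and>
         growth_equiv (schreier_growth_fun G F H)
           (\<lambda>n. real n powr (real (hom_dim G) - real (rel_hom_dim G H)))"
proof -
  obtain k where G: "group G" and k: "lower_central G (k + 1) = {\<one>\<^bsub>G\<^esub>}"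
    using assms(1) unfolding nilpotent_group_def by blast
  interpret group G by (rule G)
  have "lower_central G (Suc (Suc k)) = {\<one>\<^bsub>G\<^esub>}"
    using lower_central_Suc_subset[of "Suc k"] k subgroup.one_closed[OF lower_central_subgroup[of "Suc (Suc k)"]]
    by auto
  \<comment> \<open>the class is enlarged by one to cover the trivial group\<close>
  then interpret fg_nilpotent G F "Suc k"
    using assms(2-4) by unfold_locales auto
  have rel: "rel_growth_fun G F H = (\<lambda>n. real (card (ball n \<inter> H)))"
    by (rule ext) (simp only: rel_growth_fun_def word_ball_eq[OF assms(3)])
  have sch: "schreier_growth_fun G F H = (\<lambda>n. real (card ((\<lambda>g. g <#\<^bsub>G\<^esub> H) ` ball n)))"
    by (rule ext) (simp only: schreier_growth_fun_def schreier_ball_eq[OF assms(3,5)])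
  have 1: "growth_equiv (rel_growth_fun G F H) (\<lambda>n. real n ^ rel_hom_dim G H)"
    unfolding rel by (rule rel_growth_equiv[OF assms(5)])
  have 2: "growth_equiv (schreier_growth_fun G F H)
      (\<lambda>n. real n powr (real (hom_dim G) - real (rel_hom_dim G H)))"
    unfolding sch by (rule schreier_growth_equiv[OF assms(5)])
  have l1: "log_ratio (rel_growth_fun G F H) \<longlonglongrightarrow> real (rel_hom_dim G H)"
    by (rule growth_equiv_log_ratio[OF growth_equiv_power_powr[OF 1]])
  have l2: "log_ratio (schreier_growth_fun G F H) \<longlonglongrightarrow> real (hom_dim G) - real (rel_hom_dim G H)"
    by (rule growth_equiv_log_ratio[OF 2])
  show ?thesis
    using 1 2 convergentI[OF l1] convergentI[OF l2] limI[OF l1] limI[OF l2] suminf_rank_difference[OF assms(5)]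
    by (simp add: rel_growth_def schreier_growth_def)
qed

end
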